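(* There exist universal constants $C,c>0$ such that the following holds. Let $\mathbb{H}\in\{\mathbb{R},\mathbb{C}\}$, let $m,d\geq 1$ be integers, and let $\boldsymbol{A}\in\mathbb{H}^{m\times d}$ be a standard Gaussian random matrix. Let $0<\delta<0.05$, $\boldsymbol{x}_0\in\mathbb{H}^d$ and $\boldsymbol{\eta}\in\mathbb{R}^m$. If $m\geq C\log(1/\delta)\,\delta^{-2}d$, then with probability at least $1-2\exp(-c\delta^2 m)$, every $$\hat{\boldsymbol{x}}\in\operatorname*{argmin}_{\boldsymbol{x}\in\mathbb{H}^d}\big\||\boldsymbol{A}\boldsymbol{x}|-|\boldsymbol{A}\boldsymbol{x}_0|-\boldsymbol{\eta}\big\|_2$$ satisfies $$\mathrm{dist}(\hat{\boldsymbol{x}},\boldsymbol{x}_0)\leq\frac{2\beta_0^{\mathbb{H}}}{1-\delta}\cdot\frac{\|\boldsymbol{\eta}\|_2}{\sqrt{m}},$$ where $\beta_0^{\mathbb{R}}=\sqrt{\frac{\pi}{\pi-2}}$ and $\beta_0^{\mathbb{C}}=\sqrt{\frac{4}{4-\pi}}$.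
   Context: A standard Gaussian random matrix in $\mathbb{H}^{m\times d}$ is one whose rows are i.i.d. standard Gaussian random vectors, i.e. distributed as $\mathcal{N}(\boldsymbol{0},\boldsymbol{I})$ if $\mathbb{H}=\mathbb{R}$, and as $\mathcal{N}(\boldsymbol{0},\boldsymbol{I}/2)+\mathrm{i}\,\mathcal{N}(\boldsymbol{0},\boldsymbol{I}/2)$ (independent real and imaginary parts) if $\mathbb{H}=\mathbb{C}$. For $\boldsymbol{x},\boldsymbol{y}\in\mathbb{H}^d$, $\mathrm{dist}(\boldsymbol{x},\boldsymbol{y}):=\min\{\|\boldsymbol{x}-c\boldsymbol{y}\|_2 : c\in\mathbb{H},\ |c|=1\}$. $|\boldsymbol{A}\boldsymbol{x}|\in\mathbb{R}_+^m$ denotes the vector of entrywise absolute values of $\boldsymbol{A}\boldsymbol{x}$. *)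

theory Defs
  imports
    "HOL-Probability.Probability"
    "Jordan_Normal_Form.Matrix"
begin

text \<open>
  Vectors and matrices are those of \<open>Jordan_Normal_Form\<close>, so that the dimensions \<open>m\<close>, \<open>d\<close> are
  ordinary natural numbers that can be quantified after the universal constants. The type
  name \<open>vec\<close> is qualified because \<open>HOL-Analysis\<close> has a type of the same name.
\<close>

definition norm2 :: "'a::real_normed_vector Matrix.vec \<Rightarrow> real" where
  "norm2 v = L2_set (\<lambda>i. norm (vec_index v i)) {..<dim_vec v}"

text \<open>
  The infimum is a minimum, the unit sphere of the scalar field being compact
  (it is \<open>{1, -1}\<close> for \<open>real\<close>).
\<close>

definition phase_dist :: "'a::real_normed_field Matrix.vec \<Rightarrow> 'a Matrix.vec \<Rightarrow> real" where
  "phase_dist x y = (INF c\<in>{c. norm c = 1}. norm2 (x - c \<cdot>\<^sub>v y))"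

definition gaussian_real :: "real measure" where
  "gaussian_real = density lborel std_normal_density"

text \<open>
  The second argument of \<^const>\<open>normal_density\<close> is the standard deviation, so both the real and
  the imaginary part have variance \<open>1/2\<close>.
\<close>

definition gaussian_complex :: "complex measure" where
  "gaussian_complex =
     distr (density lborel (normal_density 0 (sqrt (1/2))) \<Otimes>\<^sub>M
            density lborel (normal_density 0 (sqrt (1/2))))
       borel (\<lambda>(a, b). Complex a b)"

text \<open>
  The law of \<open>m\<close> independent rows, each consisting of \<open>d\<close> independent entries with law \<open>\<gamma>\<close>; an
  outcome \<open>\<omega>\<close> has the entry \<open>\<omega> i j\<close> in row \<open>i\<close> and column \<open>j\<close>. As the identity covariance makes
  the coordinates of a standard Gaussian vector independent, \<open>\<gamma> = gaussian_real\<close> and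
  \<open>\<gamma> = gaussian_complex\<close> give the law of a standard Gaussian random matrix over the real
  and over the complex numbers.
\<close>

definition iid_rows :: "'a measure \<Rightarrow> nat \<Rightarrow> nat \<Rightarrow> (nat \<Rightarrow> nat \<Rightarrow> 'a) measure" where
  "iid_rows \<gamma> m d = Pi\<^sub>M {..<m} (\<lambda>_. Pi\<^sub>M {..<d} (\<lambda>_. \<gamma>))"

definition matrix_of :: "nat \<Rightarrow> nat \<Rightarrow> (nat \<Rightarrow> nat \<Rightarrow> 'a) \<Rightarrow> 'a Matrix.mat" where
  "matrix_of m d \<omega> = Matrix.mat m d (\<lambda>(i, j). \<omega> i j)"

definition amplitude_loss ::
  "'a::real_normed_field Matrix.mat \<Rightarrow> 'a Matrix.vec \<Rightarrow> real Matrix.vec \<Rightarrow> 'a Matrix.vec \<Rightarrow> real" where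
  "amplitude_loss A x0 \<eta> x = norm2 (map_vec norm (A *\<^sub>v x) - map_vec norm (A *\<^sub>v x0) - \<eta>)"

definition beta0_real :: real where
  "beta0_real = sqrt (pi / (pi - 2))"

definition beta0_complex :: real where
  "beta0_complex = sqrt (4 / (4 - pi))"

end

theory Submission
  imports Defs "HOL-Real_Asymp.Real_Asymp"
begin

text \<open>
  A minimiser \<open>x\<close> has residual \<open>\<parallel>|Ax| - |Ax\<^sub>0|\<parallel> \<le> 2 \<parallel>\<eta>\<parallel>\<close>, so it suffices to bound \<open>\<parallel>|Ax| - |Ax\<^sub>0|\<parallel>\<close> below by
  \<open>(1 - \<delta>) / \<beta>\<^sub>0 \<cdot> sqrt m \<cdot> dist x x\<^sub>0\<close>, uniformly in \<open>x\<close> for the fixed \<open>x\<^sub>0\<close>. After aligning the phase and rescaling,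
  \<open>x = t (v + r e)\<close> and \<open>x\<^sub>0 = t r e\<close> with unit vectors \<open>v\<close>, \<open>e\<close> and \<open>r \<ge> 0\<close>.

  In expectation the bound holds with constant \<open>1 / \<beta>\<^sub>0\<^sup>2 = 1 - \<kappa>\<close>, where \<open>\<kappa> = (E |g|)\<^sup>2\<close>: for standard Gaussians
  \<open>g\<close>, \<open>h\<close> with correlation \<open>\<rho>\<close> one has \<open>E |g||h| \<le> \<kappa> + (1 - \<kappa>) \<rho>\<close>. Indeed
  \<open>C \<rho> = E |g||h| - \<kappa>\<close> satisfies \<open>(C \<rho>)\<^sup>2 \<le> C 1 \<cdot> C (\<rho>\<^sup>2)\<close> by Cauchy-Schwarz and the semigroup property, and
  \<open>C \<rho> \<le> \<rho>\<close>; iterating gives \<open>C \<rho> \<le> C 1 \<cdot> \<rho>\<close>.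

  Lower tails of sums of nonnegative variables only need second moments, so every single \<open>(v, r)\<close> is controlled with
  probability \<open>1 - exp (- c \<delta>\<^sup>2 m)\<close>, and a net of mesh of order \<open>\<delta>\<close> settles bounded \<open>r\<close>. For large \<open>r\<close>, that is
  for \<open>x\<close> near \<open>x\<^sub>0\<close>, the map \<open>r \<mapsto> |av + r ae| - r |ae|\<close> is decreasing, whence its modulus dominates a function of
  \<open>v\<close> alone, whose second moment still exceeds \<open>1 - \<kappa>\<close>.
\<close>

subsection \<open>Rotation invariant laws\<close>

text \<open>The bound must hold for all \<open>x\<close> at once with the sharp constant, so
  discretisation may cost only an error proportional to \<delta>. A net of that mesh in d dimensions
  has about (1/\<delta>)^d points; balancing its logarithm against the exponent \<delta>^2 m yields
  the condition m \<ge> C log(1/\<delta>) \<delta>^-2 d. Passing from the net to all points takes an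
  operator norm bound, for which a net of mesh 1/2 suffices. The ratio \<open>r\<close> is
  unbounded, so no finite net covers it. This forces the separate treatment of large
  \<open>r\<close>, whose cutoff enters \<open>C\<close> and hence must not depend on d or on the
  vectors.

  Real and complex scalars share one proof: it takes from the law only invariance under (x, y) -> (c
  x + s y, c y - cj s x) and some moments. The values \<kappa> = 2/\<pi> and \<kappa> = \<pi>/4 turn
  1/sqrt(1 - \<kappa>) into the two stated constants.

  The event quantifies over all minimisers. Its measurability has to be proved, because a
  non-measurable set has \<open>measure\<close> 0 and an inclusion would give no lower bound on its
  probability.\<close>

definition dot :: "nat \<Rightarrow> (nat \<Rightarrow> 'a::real_normed_field) \<Rightarrow> (nat \<Rightarrow> 'a) \<Rightarrow> 'a" where
  "dot d a x = (\<Sum>j<d. a j * x j)"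

lemma measurable_dot [measurable]:
  fixes \<gamma> :: "'a::{real_normed_field,second_countable_topology} measure"
  assumes [measurable_cong]: "sets \<gamma> = sets borel"
  shows "(\<lambda>a. dot d a x) \<in> borel_measurable (Pi\<^sub>M {..<d} (\<lambda>_. \<gamma>))"
  unfolding dot_def by measurable

text \<open>The identity for real and conjugation for complex scalars instantiate \<open>cj\<close>.\<close>

locale rotation_invariant_law = prob_space \<gamma>
  for \<gamma> :: "'a::{real_normed_field,euclidean_space} measure" +
  fixes cj :: "'a \<Rightarrow> 'a"
  assumes sets_\<gamma> [measurable_cong, simp]: "sets \<gamma> = sets borel"
    and cj_add: "cj (x + y) = cj x + cj y"
    and cj_mult: "cj (x * y) = cj x * cj y"
    and cj_cj [simp]: "cj (cj x) = x"
    and cj_of_real [simp]: "cj (of_real t) = of_real t"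
    and mult_cj: "x * cj x = of_real ((norm x)\<^sup>2)"
    and rotation: "\<lbrakk>f \<in> borel_measurable (borel \<Otimes>\<^sub>M borel); 0 \<le> c; c\<^sup>2 + (norm s)\<^sup>2 = 1\<rbrakk> \<Longrightarrow>
      (\<integral>\<^sup>+x. \<integral>\<^sup>+y. f (of_real c * x + s * y, of_real c * y - cj s * x) \<partial>\<gamma> \<partial>\<gamma>) =
      (\<integral>\<^sup>+x. \<integral>\<^sup>+y. f (x, y) \<partial>\<gamma> \<partial>\<gamma>)"
begin

abbreviation rows :: "nat \<Rightarrow> (nat \<Rightarrow> 'a) measure" where
  "rows d \<equiv> Pi\<^sub>M {..<d} (\<lambda>_. \<gamma>)"

abbreviation pairs :: "('a \<times> 'a) measure" where
  "pairs \<equiv> \<gamma> \<Otimes>\<^sub>M \<gamma>"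

lemma space_\<gamma> [simp]: "space \<gamma> = UNIV"
  using sets_eq_imp_space_eq[OF sets_\<gamma>] by simp

lemma emeasure_UNIV [simp]: "emeasure \<gamma> UNIV = 1"
  using emeasure_space_1 by simp

sublocale pair: pair_prob_space \<gamma> \<gamma> ..

lemma cj_minus: "cj (- x) = - cj x"
  using cj_mult[of "- 1" x] cj_of_real[of "- 1"] by simp

lemma cj_diff: "cj (x - y) = cj x - cj y"
  using cj_add[of x "- y"] by (simp add: cj_minus)

text \<open>Parameters of the Givens rotation that turns (\<open>p\<close>, \<open>x\<close>) into
  its length; the zero vector is met by the identity.\<close>

lemma rotation_scaled:
  assumes "0 \<le> p"
  obtains c s where "0 \<le> c" "c\<^sup>2 + (norm s)\<^sup>2 = 1"
    "c * sqrt (p\<^sup>2 + (norm x)\<^sup>2) = p" "s * of_real (sqrt (p\<^sup>2 + (norm x)\<^sup>2)) = (x :: 'a)"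
proof (cases "p\<^sup>2 + (norm x)\<^sup>2 = 0")
  case True
  then have "p = 0" "x = 0" by (auto simp: add_nonneg_eq_0_iff)
  then show ?thesis using that[of 1 0] by simp
next
  case False
  define n where "n = sqrt (p\<^sup>2 + (norm x)\<^sup>2)"
  have n: "n > 0" "n\<^sup>2 = p\<^sup>2 + (norm x)\<^sup>2"
    using False by (auto simp: n_def add_nonneg_pos less_le)
  have "(p / n)\<^sup>2 + (norm (x / of_real n))\<^sup>2 = (p\<^sup>2 + (norm x)\<^sup>2) / n\<^sup>2"
    by (simp add: norm_divide power_divide add_divide_distrib)
  then have "(p / n)\<^sup>2 + (norm (x / of_real n))\<^sup>2 = 1" by (metis False divide_self n(2))
  then show ?thesis
    using that[of "p / n" "x / of_real n"] n(1) \<open>0 \<le> p\<close> unfolding n_def[symmetric] by simp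
qed

text \<open>The integrand depends on the first rotated coordinate only, so the second one integrates
  out against a probability measure.\<close>

lemma nn_integral_add_scaled:
  assumes [measurable]: "f \<in> borel_measurable borel" and p: "0 \<le> p"
  shows "(\<integral>\<^sup>+x. \<integral>\<^sup>+y. f (of_real p * x + s * y) \<partial>\<gamma> \<partial>\<gamma>) =
    (\<integral>\<^sup>+x. f (of_real (sqrt (p\<^sup>2 + (norm s)\<^sup>2)) * x) \<partial>\<gamma>)"
proof -
  define n where "n = sqrt (p\<^sup>2 + (norm s)\<^sup>2)"
  obtain c t where ct: "0 \<le> c" "c\<^sup>2 + (norm t)\<^sup>2 = 1" and p': "c * n = p" and s': "t * of_real n = s"
    using rotation_scaled[OF p, of s] unfolding n_def by auto
  have "(\<integral>\<^sup>+x. \<integral>\<^sup>+y. f (of_real p * x + s * y) \<partial>\<gamma> \<partial>\<gamma>) =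
    (\<integral>\<^sup>+x. \<integral>\<^sup>+y. (\<lambda>(x, y). f (of_real n * x)) (of_real c * x + t * y, of_real c * y - cj t * x) \<partial>\<gamma> \<partial>\<gamma>)"
    by (simp add: p'[symmetric] s'[symmetric] algebra_simps)
  also have "\<dots> = (\<integral>\<^sup>+x. \<integral>\<^sup>+y. f (of_real n * x) \<partial>\<gamma> \<partial>\<gamma>)"
    by (subst rotation[OF _ ct]) auto
  finally show ?thesis by (simp add: n_def emeasure_space_1)
qed

text \<open>A QR factorisation in law. In the induction the new entry of the row is rotated against
  the sample that carries \<open>dot d a e\<close>, so that the product with \<open>e\<close> again
  involves a single sample; what is left over merges with the independent part
  \<open>of_real r * y\<close>. The equation for \<open>q\<close> is multiplied by \<open>p\<close>
  because \<open>e\<close> may vanish on the first \<open>d\<close> coordinates, where a quotient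
  would make no sense.\<close>

theorem joint_law_ex:
  "\<exists>p q r. 0 \<le> p \<and> 0 \<le> r \<and> p\<^sup>2 = (\<Sum>j<d. (norm (e j))\<^sup>2) \<and> of_real p * q = (\<Sum>j<d. u j * cj (e j)) \<and>
     (norm q)\<^sup>2 + r\<^sup>2 = (\<Sum>j<d. (norm (u j))\<^sup>2) \<and>
     (\<forall>f\<in>borel_measurable (borel \<Otimes>\<^sub>M borel).
       (\<integral>\<^sup>+a. f (dot d a e, dot d a u) \<partial>rows d) =
       (\<integral>\<^sup>+x. \<integral>\<^sup>+y. f (of_real p * x, q * x + of_real r * y) \<partial>\<gamma> \<partial>\<gamma>))"
proof (induction d)
  case 0
  interpret Q: product_prob_space "\<lambda>_. \<gamma>" "{} :: nat set" by unfold_locales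
  show ?case
    by (intro exI[of _ 0]) (auto simp: dot_def Q.P.emeasure_space_1)
next
  case (Suc d)
  interpret Q: product_prob_space "\<lambda>_. \<gamma>" "{..<d}" by unfold_locales
  from Suc obtain p q r where pr: "0 \<le> p" "0 \<le> r" "p\<^sup>2 = (\<Sum>j<d. (norm (e j))\<^sup>2)"
    and pq: "of_real p * q = (\<Sum>j<d. u j * cj (e j))"
    and qr: "(norm q)\<^sup>2 + r\<^sup>2 = (\<Sum>j<d. (norm (u j))\<^sup>2)"
    and IH: "\<And>f. f \<in> borel_measurable (borel \<Otimes>\<^sub>M borel) \<Longrightarrow>
       (\<integral>\<^sup>+a. f (dot d a e, dot d a u) \<partial>rows d) =
       (\<integral>\<^sup>+x. \<integral>\<^sup>+y. f (of_real p * x, q * x + of_real r * y) \<partial>\<gamma> \<partial>\<gamma>)"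
    by blast
  define x w where "x = e d" and "w = u d"
  define n where "n = sqrt (p\<^sup>2 + (norm x)\<^sup>2)"
  obtain c s where cs: "0 \<le> c" "c\<^sup>2 + (norm s)\<^sup>2 = 1" and p': "c * n = p" and x': "s * of_real n = x"
    using rotation_scaled[OF pr(1), of x] unfolding n_def by auto
  \<comment> \<open>The coordinates of (\<open>q\<close>, \<open>w\<close>) in the rotated frame; as
    the rotation is unitary, the sum of their squares is preserved.\<close>
  define q' t where "q' = of_real c * q + w * cj s" and "t = of_real c * w - q * s"
  define r' where "r' = sqrt (r\<^sup>2 + (norm t)\<^sup>2)"
  have ss: "s * cj s = of_real ((norm s)\<^sup>2)" and cc: "of_real (c\<^sup>2) + of_real ((norm s)\<^sup>2) = (1 :: 'a)"
    using mult_cj arg_cong[OF cs(2), of of_real] by (simp_all only: of_real_add of_real_1)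
  have "n\<^sup>2 = p\<^sup>2 + (norm x)\<^sup>2" by (simp add: n_def)
  then have n: "0 \<le> n" "n\<^sup>2 = (\<Sum>j<Suc d. (norm (e j))\<^sup>2)" by (simp_all add: n_def x_def pr(3))
  have "of_real n * q' = of_real (c * n) * q + w * cj (s * of_real n)"
    by (simp add: q'_def algebra_simps cj_mult)
  then have nq: "of_real n * q' = (\<Sum>j<Suc d. u j * cj (e j))"
    by (simp add: p' x' pq) (simp add: x_def w_def)
  have "of_real ((norm q')\<^sup>2 + (norm t)\<^sup>2) = q' * cj q' + t * cj t"
    by (simp add: mult_cj)
  also have "\<dots> = (of_real (c\<^sup>2) + s * cj s) * (q * cj q + w * cj w)"
    by (simp add: q'_def t_def cj_add cj_mult cj_diff algebra_simps power2_eq_square)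
  also have "\<dots> = of_real ((norm q)\<^sup>2 + (norm w)\<^sup>2)"
    by (simp only: ss cc mult_cj) simp
  finally have qt: "(norm q')\<^sup>2 + (norm t)\<^sup>2 = (norm q)\<^sup>2 + (norm w)\<^sup>2"
    by (simp only: of_real_eq_iff)
  have r': "0 \<le> r'" "(norm q')\<^sup>2 + r'\<^sup>2 = (\<Sum>j<Suc d. (norm (u j))\<^sup>2)"
    using qt qr by (auto simp: r'_def w_def)
  have "(\<integral>\<^sup>+a. f (dot (Suc d) a e, dot (Suc d) a u) \<partial>Pi\<^sub>M {..<Suc d} (\<lambda>_. \<gamma>)) =
       (\<integral>\<^sup>+x. \<integral>\<^sup>+y. f (of_real n * x, q' * x + of_real r' * y) \<partial>\<gamma> \<partial>\<gamma>)"
    if [measurable]: "f \<in> borel_measurable (borel \<Otimes>\<^sub>M borel)" for f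
  proof -
    define F where "F = (\<lambda>(g, h). \<integral>\<^sup>+y. f (g + y * x, h + y * w) \<partial>\<gamma>)"
    have F_measurable: "F \<in> borel_measurable (borel \<Otimes>\<^sub>M borel)"
      unfolding F_def by measurable
    have "(\<integral>\<^sup>+a. f (dot (Suc d) a e, dot (Suc d) a u) \<partial>Pi\<^sub>M {..<Suc d} (\<lambda>_. \<gamma>)) =
      (\<integral>\<^sup>+a. \<integral>\<^sup>+y. f (dot (Suc d) (a(d := y)) e, dot (Suc d) (a(d := y)) u) \<partial>\<gamma> \<partial>rows d)"
      unfolding lessThan_Suc by (rule Q.product_nn_integral_insert) (auto simp flip: lessThan_Suc)
    also have "\<dots> = (\<integral>\<^sup>+a. F (dot d a e, dot d a u) \<partial>rows d)"
      by (simp add: dot_def F_def x_def w_def)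
    also have "\<dots> = (\<integral>\<^sup>+g. \<integral>\<^sup>+z. F (of_real p * g, q * g + of_real r * z) \<partial>\<gamma> \<partial>\<gamma>)"
      by (rule IH[OF F_measurable])
    also have "\<dots> = (\<integral>\<^sup>+g. \<integral>\<^sup>+z. \<integral>\<^sup>+y. f (of_real p * g + y * x, q * g + of_real r * z + y * w) \<partial>\<gamma> \<partial>\<gamma> \<partial>\<gamma>)"
      by (simp add: F_def)
    \<comment> \<open>With \<open>z\<close> outermost the rotation can act on the pair
      (\<open>g\<close>, \<open>y\<close>); the later exchange brings \<open>z\<close> and
      \<open>y\<close> together, to be merged by \<open>nn_integral_add_scaled\<close>.\<close>
    also have "\<dots> = (\<integral>\<^sup>+z. \<integral>\<^sup>+g. \<integral>\<^sup>+y. f (of_real p * g + y * x, q * g + of_real r * z + y * w) \<partial>\<gamma> \<partial>\<gamma> \<partial>\<gamma>)"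
      by (rule pair.Fubini'[symmetric]) measurable
    also have "\<dots> = (\<integral>\<^sup>+z. \<integral>\<^sup>+g. \<integral>\<^sup>+y. f (of_real n * g, q' * g + t * y + of_real r * z) \<partial>\<gamma> \<partial>\<gamma> \<partial>\<gamma>)"
    proof (rule nn_integral_cong)
      fix z
      have 1: "of_real p * g + y * x = of_real n * (of_real c * g + s * y)" for g y
        by (simp add: p'[symmetric] x'[symmetric] algebra_simps)
      have 2: "q * g + y * w = q' * (of_real c * g + s * y) + t * (of_real c * y - cj s * g)" for g y
      proof -
        have "q' * (of_real c * g + s * y) + t * (of_real c * y - cj s * g) =
          (of_real (c\<^sup>2) + s * cj s) * (q * g + y * w)"
          by (simp add: q'_def t_def algebra_simps power2_eq_square)
        then show ?thesis by (simp only: ss cc mult_1_left)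
      qed
      have 3: "q * g + of_real r * z + y * w =
          q' * (of_real c * g + s * y) + t * (of_real c * y - cj s * g) + of_real r * z" for g y
        unfolding 2[symmetric] by simp
      have "(\<integral>\<^sup>+g. \<integral>\<^sup>+y. f (of_real p * g + y * x, q * g + of_real r * z + y * w) \<partial>\<gamma> \<partial>\<gamma>) =
        (\<integral>\<^sup>+g. \<integral>\<^sup>+y. (\<lambda>(g, y). f (of_real n * g, q' * g + t * y + of_real r * z))
           (of_real c * g + s * y, of_real c * y - cj s * g) \<partial>\<gamma> \<partial>\<gamma>)"
        by (simp only: 1 3 prod.case)
      also have "\<dots> = (\<integral>\<^sup>+g. \<integral>\<^sup>+y. f (of_real n * g, q' * g + t * y + of_real r * z) \<partial>\<gamma> \<partial>\<gamma>)"
        by (subst rotation[OF _ cs]) auto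
      finally show "(\<integral>\<^sup>+g. \<integral>\<^sup>+y. f (of_real p * g + y * x, q * g + of_real r * z + y * w) \<partial>\<gamma> \<partial>\<gamma>) =
        (\<integral>\<^sup>+g. \<integral>\<^sup>+y. f (of_real n * g, q' * g + t * y + of_real r * z) \<partial>\<gamma> \<partial>\<gamma>)" .
    qed
    also have "\<dots> = (\<integral>\<^sup>+g. \<integral>\<^sup>+z. \<integral>\<^sup>+y. f (of_real n * g, q' * g + t * y + of_real r * z) \<partial>\<gamma> \<partial>\<gamma> \<partial>\<gamma>)"
      by (rule pair.Fubini') measurable
    also have "\<dots> = (\<integral>\<^sup>+g. \<integral>\<^sup>+z. f (of_real n * g, q' * g + of_real r' * z) \<partial>\<gamma> \<partial>\<gamma>)"
    proof (rule nn_integral_cong)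
      fix g
      show "(\<integral>\<^sup>+z. \<integral>\<^sup>+y. f (of_real n * g, q' * g + t * y + of_real r * z) \<partial>\<gamma> \<partial>\<gamma>) =
        (\<integral>\<^sup>+z. f (of_real n * g, q' * g + of_real r' * z) \<partial>\<gamma>)"
        using nn_integral_add_scaled[OF _ pr(2), of "\<lambda>h. f (of_real n * g, q' * g + h)" t]
        by (simp add: r'_def add_ac)
    qed
    finally show ?thesis .
  qed
  then show ?case using n nq r' by blast
qed

end

lemma distr_eqI_nn_integral:
  assumes [measurable]: "X \<in> measurable M N" "Y \<in> measurable M' N"
    and eq: "\<And>f. f \<in> borel_measurable N \<Longrightarrow> (\<integral>\<^sup>+x. f (X x) \<partial>M) = (\<integral>\<^sup>+x. f (Y x) \<partial>M')"
  shows "distr M N X = distr M' N Y"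
proof (rule measure_eqI)
  fix A assume "A \<in> sets (distr M N X)"
  then have [measurable]: "A \<in> sets N" by simp
  have "emeasure (distr M N X) A = (\<integral>\<^sup>+x. indicator A (X x) \<partial>M)"
    using nn_integral_distr[of X M N "indicator A"] by simp
  also have "\<dots> = (\<integral>\<^sup>+x. indicator A (Y x) \<partial>M')" by (rule eq) simp
  also have "\<dots> = emeasure (distr M' N Y) A"
    using nn_integral_distr[of Y M' N "indicator A"] by simp
  finally show "emeasure (distr M N X) A = emeasure (distr M' N Y) A" .
qed simp

context rotation_invariant_law
begin

lemma nn_integral_dot:
  assumes [measurable]: "f \<in> borel_measurable borel"
  shows "(\<integral>\<^sup>+a. f (dot d a u) \<partial>rows d) =
    (\<integral>\<^sup>+x. f (of_real (L2_set (\<lambda>j. norm (u j)) {..<d}) * x) \<partial>\<gamma>)"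
proof -
  obtain p q r where p: "0 \<le> p" "p\<^sup>2 = (\<Sum>j<d. (norm (u j))\<^sup>2)"
    and law: "\<And>f. f \<in> borel_measurable (borel \<Otimes>\<^sub>M borel) \<Longrightarrow>
       (\<integral>\<^sup>+a. f (dot d a u, dot d a u) \<partial>rows d) = (\<integral>\<^sup>+x. \<integral>\<^sup>+y. f (of_real p * x, q * x + of_real r * y) \<partial>\<gamma> \<partial>\<gamma>)"
    using joint_law_ex[of u d u] by blast
  have "p = L2_set (\<lambda>j. norm (u j)) {..<d}"
    using p by (simp add: L2_set_def real_sqrt_unique[symmetric])
  then show ?thesis using law[of "\<lambda>(x, y). f x"] by simp
qed

text \<open>A unit vector \<open>e\<close> forces \<open>p = 1\<close>, so \<open>q\<close> is the
  inner product itself. It may be taken real because phases are aligned beforehand; both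
  coefficients are then real, as in \<open>norm_corr\<close>.\<close>

lemma joint_law:
  assumes e: "(\<Sum>j<d. (norm (e j))\<^sup>2) = 1" and \<alpha>: "(\<Sum>j<d. u j * cj (e j)) = of_real \<alpha>"
  obtains \<beta> where "0 \<le> \<beta>" "\<alpha>\<^sup>2 + \<beta>\<^sup>2 = (\<Sum>j<d. (norm (u j))\<^sup>2)"
    "distr (rows d) (borel \<Otimes>\<^sub>M borel) (\<lambda>a. (dot d a e, dot d a u)) =
     distr pairs (borel \<Otimes>\<^sub>M borel) (\<lambda>(x, y). (x, of_real \<alpha> * x + of_real \<beta> * y))"
proof -
  obtain p q r where p: "0 \<le> p" "p\<^sup>2 = (\<Sum>j<d. (norm (e j))\<^sup>2)" and q: "of_real p * q = (\<Sum>j<d. u j * cj (e j))"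
    and r: "0 \<le> r" "(norm q)\<^sup>2 + r\<^sup>2 = (\<Sum>j<d. (norm (u j))\<^sup>2)"
    and law: "\<And>f. f \<in> borel_measurable (borel \<Otimes>\<^sub>M borel) \<Longrightarrow>
       (\<integral>\<^sup>+a. f (dot d a e, dot d a u) \<partial>rows d) =
       (\<integral>\<^sup>+x. \<integral>\<^sup>+y. f (of_real p * x, q * x + of_real r * y) \<partial>\<gamma> \<partial>\<gamma>)"
    using joint_law_ex[of e d u] by blast
  have 1: "p = 1" using p e by (simp add: power2_eq_1_iff)
  then have 2: "q = of_real \<alpha>" using q \<alpha> by simp
  show ?thesis
  proof (rule that[OF r(1)])
    show "\<alpha>\<^sup>2 + r\<^sup>2 = (\<Sum>j<d. (norm (u j))\<^sup>2)" using r(2) 2 by simp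
    show "distr (rows d) (borel \<Otimes>\<^sub>M borel) (\<lambda>a. (dot d a e, dot d a u)) =
      distr pairs (borel \<Otimes>\<^sub>M borel) (\<lambda>(x, y). (x, of_real \<alpha> * x + of_real r * y))"
    proof (rule distr_eqI_nn_integral)
      fix f :: "'a \<times> 'a \<Rightarrow> ennreal" assume [measurable]: "f \<in> borel_measurable (borel \<Otimes>\<^sub>M borel)"
      show "(\<integral>\<^sup>+a. f (dot d a e, dot d a u) \<partial>rows d) =
        (\<integral>\<^sup>+z. f (case z of (x, y) \<Rightarrow> (x, of_real \<alpha> * x + of_real r * y)) \<partial>pairs)"
        by (subst law) (auto simp: 1 2 nn_integral_fst[symmetric])
    qed measurable
  qed
qed

end

text \<open>\<kappa> is the squared mean modulus. \<open>exp_moment\<close> yields the upper tail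
  and the fourth moment. \<open>no_atom\<close> and \<open>directional_moment\<close> serve the
  regime of large \<open>r\<close>, where the limiting second moment is at least 1/2 and
  \<open>1 / 2 < \<kappa>\<close> leaves a margin above 1 - \<kappa>. The bound 4/5 keeps 1 -
  \<kappa> away from 0 and still admits \<pi>/4.\<close>

locale gaussian_law = rotation_invariant_law +
  fixes \<kappa> :: real
  assumes nn_second_moment: "(\<integral>\<^sup>+x. ennreal ((norm x)\<^sup>2) \<partial>\<gamma>) = 1"
    and exp_moment: "(\<integral>\<^sup>+x. ennreal (exp ((norm x)\<^sup>2 / 4)) \<partial>\<gamma>) \<le> 2"
    and nn_mean_norm: "(\<integral>\<^sup>+x. ennreal (norm x) \<partial>\<gamma>) = ennreal (sqrt \<kappa>)"
    and \<kappa>_bounds: "1 / 2 < \<kappa>" "\<kappa> \<le> 4 / 5"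
    and no_atom: "emeasure \<gamma> {0} = 0"
    and directional_moment: "norm w = 1 \<Longrightarrow> 1 / 2 \<le> (\<integral>x. (x \<bullet> w)\<^sup>2 \<partial>\<gamma>)"
begin

section \<open>Correlation of the moduli of two Gaussian variables\<close>

lemma measure_UNIV [simp]: "measure \<gamma> UNIV = 1"
  using prob_space by simp

lemma \<kappa>_pos: "0 < \<kappa>" "\<kappa> < 1" using \<kappa>_bounds by auto

lemma second_moment: "has_bochner_integral \<gamma> (\<lambda>x. (norm x)\<^sup>2) 1"
  by (rule has_bochner_integral_nn_integral) (auto simp: nn_second_moment)

lemma mean_norm: "has_bochner_integral \<gamma> norm (sqrt \<kappa>)"
  using \<kappa>_pos by (intro has_bochner_integral_nn_integral) (auto simp: nn_mean_norm)

lemmas integrable_sq [simp] = integrable.intros[OF second_moment]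
lemmas integrable_norm [simp] = integrable.intros[OF mean_norm]
lemmas integral_sq [simp] = has_bochner_integral_integral_eq[OF second_moment]
lemmas integral_norm [simp] = has_bochner_integral_integral_eq[OF mean_norm]

text \<open>The Ornstein-Uhlenbeck (Mehler) operator with correlation \<rho>, applied to the
  norm.\<close>

definition smoothed :: "real \<Rightarrow> 'a \<Rightarrow> real" where
  "smoothed \<rho> x = (\<integral>y. norm (of_real \<rho> * x + of_real (sqrt (1 - \<rho>\<^sup>2)) * y) \<partial>\<gamma>)"

text \<open>E |g||h| for correlation \<rho>, written with the conditional expectation given
  \<open>g = x\<close>.\<close>

definition norm_corr :: "real \<Rightarrow> real" where
  "norm_corr \<rho> = (\<integral>x. norm x * smoothed \<rho> x \<partial>\<gamma>)"

lemma integrable_norm_affine [simp]: "integrable \<gamma> (\<lambda>y. norm (x + of_real \<sigma> * y))"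
proof (rule Bochner_Integration.integrable_bound)
  show "integrable \<gamma> (\<lambda>y. norm x + \<bar>\<sigma>\<bar> * norm y)" by simp
  show "AE y in \<gamma>. norm (norm (x + of_real \<sigma> * y)) \<le> norm (norm x + \<bar>\<sigma>\<bar> * norm y)"
    by (auto intro!: norm_triangle_le simp: norm_mult)
qed simp

lemma measurable_smoothed [measurable]: "smoothed \<rho> \<in> borel_measurable borel"
proof -
  have "smoothed \<rho> \<in> borel_measurable \<gamma>"
    unfolding smoothed_def by measurable
  then show ?thesis by simp
qed

lemma smoothed_nonneg [simp]: "0 \<le> smoothed \<rho> x"
  by (simp add: smoothed_def)

lemma ennreal_smoothed:
  "ennreal (smoothed \<rho> x) = (\<integral>\<^sup>+y. ennreal (norm (of_real \<rho> * x + of_real (sqrt (1 - \<rho>\<^sup>2)) * y)) \<partial>\<gamma>)"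
  unfolding smoothed_def by (rule nn_integral_eq_integral[symmetric]) auto

context
  fixes \<rho> :: real
  assumes \<rho>: "0 \<le> \<rho>" "\<rho> \<le> 1"
begin

lemma sqrt_bounds: "0 \<le> sqrt (1 - \<rho>\<^sup>2)" "sqrt (1 - \<rho>\<^sup>2) \<le> 1" "0 \<le> 1 - \<rho>\<^sup>2"
  using \<rho> by (auto simp: power_le_one)

lemma smoothed_le: "smoothed \<rho> x \<le> \<rho> * norm x + sqrt \<kappa>"
proof -
  have "smoothed \<rho> x \<le> (\<integral>y. \<rho> * norm x + norm y \<partial>\<gamma>)"
    unfolding smoothed_def
  proof (rule integral_mono)
    fix y
    have "norm (of_real \<rho> * x + of_real (sqrt (1 - \<rho>\<^sup>2)) * y) \<le> \<rho> * norm x + sqrt (1 - \<rho>\<^sup>2) * norm y"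
      using \<rho> sqrt_bounds by (intro norm_triangle_le) (simp add: norm_mult)
    also have "\<dots> \<le> \<rho> * norm x + norm y"
      using sqrt_bounds mult_left_le_one_le[of "norm y" "sqrt (1 - \<rho>\<^sup>2)"] by simp
    finally show "norm (of_real \<rho> * x + of_real (sqrt (1 - \<rho>\<^sup>2)) * y) \<le> \<rho> * norm x + norm y" .
  qed simp_all
  also have "\<dots> = \<rho> * norm x + sqrt \<kappa>" by (simp add: prob_space)
  finally show ?thesis .
qed

text \<open>Stationarity of the Gaussian law under the Mehler operator.\<close>

lemma has_mean_smoothed: "has_bochner_integral \<gamma> (smoothed \<rho>) (sqrt \<kappa>)"
proof (rule has_bochner_integral_nn_integral)
  have "(\<integral>\<^sup>+x. ennreal (smoothed \<rho> x) \<partial>\<gamma>) =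
    (\<integral>\<^sup>+x. \<integral>\<^sup>+y. ennreal (norm (of_real \<rho> * x + of_real (sqrt (1 - \<rho>\<^sup>2)) * y)) \<partial>\<gamma> \<partial>\<gamma>)"
    by (simp add: ennreal_smoothed)
  also have "\<dots> = (\<integral>\<^sup>+x. ennreal (norm x) \<partial>\<gamma>)"
    using nn_integral_add_scaled[OF _ \<rho>(1), of "\<lambda>x. ennreal (norm x)" "of_real (sqrt (1 - \<rho>\<^sup>2))"] sqrt_bounds
    by simp
  finally show "(\<integral>\<^sup>+x. ennreal (smoothed \<rho> x) \<partial>\<gamma>) = ennreal (sqrt \<kappa>)" by (simp add: nn_mean_norm)
qed (use \<kappa>_pos in auto)

lemma integrable_norm_smoothed: "integrable \<gamma> (\<lambda>x. norm x * smoothed \<rho> x)"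
proof (rule Bochner_Integration.integrable_bound)
  show "integrable \<gamma> (\<lambda>x. \<rho> * (norm x)\<^sup>2 + sqrt \<kappa> * norm x)" by simp
  have "norm x * smoothed \<rho> x \<le> \<rho> * (norm x)\<^sup>2 + sqrt \<kappa> * norm x" for x
    using mult_left_mono[OF smoothed_le norm_ge_zero, of x] by (simp add: algebra_simps power2_eq_square)
  then show "AE x in \<gamma>. norm (norm x * smoothed \<rho> x) \<le> norm (\<rho> * (norm x)\<^sup>2 + sqrt \<kappa> * norm x)"
    using \<rho> \<kappa>_pos by simp
qed simp

text \<open>Integrates the triangle inequality. The slope 1 is cruder than 1 - \<kappa>, but linear
  decay in \<rho> is enough to bound the ratio that \<open>norm_corr_le\<close> iterates.\<close>

lemma norm_corr_le_add: "norm_corr \<rho> \<le> \<kappa> + \<rho>"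
proof -
  have "norm_corr \<rho> \<le> (\<integral>x. \<rho> * (norm x)\<^sup>2 + sqrt \<kappa> * norm x \<partial>\<gamma>)"
    unfolding norm_corr_def
  proof (rule integral_mono[OF integrable_norm_smoothed])
    show "norm x * smoothed \<rho> x \<le> \<rho> * (norm x)\<^sup>2 + sqrt \<kappa> * norm x" for x
      using mult_left_mono[OF smoothed_le norm_ge_zero, of x] by (simp add: algebra_simps power2_eq_square)
  qed simp
  also have "\<dots> = \<rho> + \<kappa>" using \<kappa>_pos by simp
  finally show ?thesis by simp
qed

lemma ennreal_norm_corr:
  "ennreal (norm_corr \<rho>) = (\<integral>\<^sup>+x. \<integral>\<^sup>+y. ennreal (norm x * norm (of_real \<rho> * x + of_real (sqrt (1 - \<rho>\<^sup>2)) * y)) \<partial>\<gamma> \<partial>\<gamma>)"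
proof -
  have "ennreal (norm_corr \<rho>) = (\<integral>\<^sup>+x. ennreal (norm x * smoothed \<rho> x) \<partial>\<gamma>)"
    unfolding norm_corr_def by (rule nn_integral_eq_integral[symmetric]) (auto simp: integrable_norm_smoothed)
  then show ?thesis
    by (simp add: ennreal_mult ennreal_smoothed nn_integral_cmult)
qed

end

text \<open>Semigroup property and self-adjointness in one computation: the square is expanded with
  two independent copies \<open>y\<close> and \<open>z\<close>, and rotating (\<open>x\<close>,
  \<open>y\<close>) turns one factor into \<open>norm x\<close> while the other becomes
  \<open>\<rho>\<^sup>2\<close> times \<open>x\<close> plus independent terms in \<open>y\<close>
  and \<open>z\<close>.\<close>

lemma has_integral_smoothed_sq:
  assumes \<rho>: "0 \<le> \<rho>" "\<rho> \<le> 1"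
  shows "has_bochner_integral \<gamma> (\<lambda>x. (smoothed \<rho> x)\<^sup>2) (norm_corr (\<rho>\<^sup>2))"
proof (rule has_bochner_integral_nn_integral)
  have \<rho>2: "0 \<le> \<rho>\<^sup>2" "\<rho>\<^sup>2 \<le> 1" using \<rho> by (auto simp: power_le_one)
  define \<sigma> where "\<sigma> = sqrt (1 - \<rho>\<^sup>2)"
  have \<sigma>: "0 \<le> \<sigma>" "\<rho>\<^sup>2 + \<sigma>\<^sup>2 = 1" using sqrt_bounds[OF \<rho>] by (auto simp: \<sigma>_def)
  have \<sigma>': "(of_real \<rho>)\<^sup>2 + (of_real \<sigma>)\<^sup>2 = (1::'a)"
    using \<sigma>(2) by (metis of_real_1 of_real_add of_real_power)
  have "(\<integral>\<^sup>+x. ennreal ((smoothed \<rho> x)\<^sup>2) \<partial>\<gamma>) = (\<integral>\<^sup>+x. \<integral>\<^sup>+z. \<integral>\<^sup>+y.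
      ennreal (norm (of_real \<rho> * x + of_real \<sigma> * y)) * ennreal (norm (of_real \<rho> * x + of_real \<sigma> * z)) \<partial>\<gamma> \<partial>\<gamma> \<partial>\<gamma>)"
    by (simp add: power2_eq_square[of "smoothed _ _"] ennreal_mult ennreal_smoothed nn_integral_cmult nn_integral_multc \<sigma>_def)
  also have "\<dots> = (\<integral>\<^sup>+z. \<integral>\<^sup>+x. \<integral>\<^sup>+y.
      ennreal (norm (of_real \<rho> * x + of_real \<sigma> * y)) * ennreal (norm (of_real \<rho> * x + of_real \<sigma> * z)) \<partial>\<gamma> \<partial>\<gamma> \<partial>\<gamma>)"
    by (rule pair.Fubini'[symmetric]) measurable
  also have "\<dots> = (\<integral>\<^sup>+z. \<integral>\<^sup>+x. \<integral>\<^sup>+y. ennreal (norm x) * ennreal (norm (of_real \<rho> * (of_real \<rho> * x - of_real \<sigma> * y) + of_real \<sigma> * z)) \<partial>\<gamma> \<partial>\<gamma> \<partial>\<gamma>)"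
  proof (rule nn_integral_cong)
    fix z
    have "of_real \<rho> * (of_real \<rho> * x + of_real \<sigma> * y) - of_real \<sigma> * (of_real \<rho> * y - of_real \<sigma> * x) =
      ((of_real \<rho>)\<^sup>2 + (of_real \<sigma>)\<^sup>2) * x" for x y :: 'a
      by (simp add: algebra_simps power2_eq_square)
    then have eq: "of_real \<rho> * (of_real \<rho> * x + of_real \<sigma> * y) - of_real \<sigma> * (of_real \<rho> * y - of_real \<sigma> * x) = x" for x y :: 'a
      unfolding \<sigma>' by simp
    show "(\<integral>\<^sup>+x. \<integral>\<^sup>+y. ennreal (norm (of_real \<rho> * x + of_real \<sigma> * y)) * ennreal (norm (of_real \<rho> * x + of_real \<sigma> * z)) \<partial>\<gamma> \<partial>\<gamma>) =
      (\<integral>\<^sup>+x. \<integral>\<^sup>+y. ennreal (norm x) * ennreal (norm (of_real \<rho> * (of_real \<rho> * x - of_real \<sigma> * y) + of_real \<sigma> * z)) \<partial>\<gamma> \<partial>\<gamma>)"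
      using rotation[of "\<lambda>(x, y). ennreal (norm x) * ennreal (norm (of_real \<rho> * (of_real \<rho> * x - of_real \<sigma> * y) + of_real \<sigma> * z))" \<rho> "of_real \<sigma>"]
        \<rho> \<sigma> by (simp add: eq)
  qed
  also have "\<dots> = (\<integral>\<^sup>+x. \<integral>\<^sup>+z. \<integral>\<^sup>+y. ennreal (norm x) * ennreal (norm (of_real \<rho> * (of_real \<rho> * x - of_real \<sigma> * y) + of_real \<sigma> * z)) \<partial>\<gamma> \<partial>\<gamma> \<partial>\<gamma>)"
    by (rule pair.Fubini') measurable
  also have "\<dots> = (\<integral>\<^sup>+x. \<integral>\<^sup>+y. ennreal (norm x * norm (of_real (\<rho>\<^sup>2) * x + of_real (sqrt (1 - (\<rho>\<^sup>2)\<^sup>2)) * y)) \<partial>\<gamma> \<partial>\<gamma>)"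
  proof (rule nn_integral_cong)
    fix x
    \<comment> \<open>The independent part has variance \<sigma>^2 + \<rho>^2 \<sigma>^2 = 1 -
      \<rho>^4, as correlation \<rho>^2 demands.\<close>
    have *: "sqrt (\<sigma>\<^sup>2 + (norm (of_real (- \<rho> * \<sigma>) :: 'a))\<^sup>2) = sqrt (1 - (\<rho>\<^sup>2)\<^sup>2)"
    proof -
      have "\<sigma>\<^sup>2 + (norm (of_real (- \<rho> * \<sigma>) :: 'a))\<^sup>2 = \<sigma>\<^sup>2 * (1 + \<rho>\<^sup>2)"
        by (simp only: norm_of_real power2_abs) (simp add: power_mult_distrib algebra_simps)
      also have "\<dots> = (1 - \<rho>\<^sup>2) * (1 + \<rho>\<^sup>2)" using \<sigma> by simp
      also have "(1 - \<rho>\<^sup>2) * (1 + \<rho>\<^sup>2) = 1 - (\<rho>\<^sup>2)\<^sup>2" by (simp add: algebra_simps power2_eq_square)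
      finally show ?thesis by (rule arg_cong)
    qed
    show "(\<integral>\<^sup>+z. \<integral>\<^sup>+y. ennreal (norm x) * ennreal (norm (of_real \<rho> * (of_real \<rho> * x - of_real \<sigma> * y) + of_real \<sigma> * z)) \<partial>\<gamma> \<partial>\<gamma>) =
      (\<integral>\<^sup>+y. ennreal (norm x * norm (of_real (\<rho>\<^sup>2) * x + of_real (sqrt (1 - (\<rho>\<^sup>2)\<^sup>2)) * y)) \<partial>\<gamma>)"
      using nn_integral_add_scaled[OF _ \<sigma>(1), of "\<lambda>h. ennreal (norm x) * ennreal (norm (of_real (\<rho>\<^sup>2) * x + h))" "of_real (- \<rho> * \<sigma>)"]
      unfolding * by (simp add: ennreal_mult algebra_simps power2_eq_square)
  qed
  also have "\<dots> = ennreal (norm_corr (\<rho>\<^sup>2))"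
    by (rule ennreal_norm_corr[OF \<rho>2, symmetric])
  finally show "(\<integral>\<^sup>+x. ennreal ((smoothed \<rho> x)\<^sup>2) \<partial>\<gamma>) = ennreal (norm_corr (\<rho>\<^sup>2))" .
  show "0 \<le> norm_corr (\<rho>\<^sup>2)" by (simp add: norm_corr_def)
qed auto

text \<open>Cauchy-Schwarz for the covariance of \<open>norm\<close> and
  \<open>smoothed \<rho>\<close>, whose variances are 1 - \<kappa> and, by the semigroup property,
  \<open>norm_corr (\<rho>\<^sup>2) - \<kappa>\<close>.\<close>

lemma norm_corr_square:
  assumes \<rho>: "0 \<le> \<rho>" "\<rho> \<le> 1"
  shows "(norm_corr \<rho> - \<kappa>)\<^sup>2 \<le> (1 - \<kappa>) * (norm_corr (\<rho>\<^sup>2) - \<kappa>)"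
proof -
  \<comment> \<open>\<open>t\<close> is the regression coefficient, covariance over variance; it
    minimises the expected square below.\<close>
  define m t where "m = sqrt \<kappa>" and "t = (norm_corr \<rho> - \<kappa>) / (1 - \<kappa>)"
  have m: "m\<^sup>2 = \<kappa>" using \<kappa>_pos by (simp add: m_def)
  have *: "(t * (norm x - m) - (smoothed \<rho> x - m))\<^sup>2 =
    t\<^sup>2 * (norm x)\<^sup>2 - 2 * t * (norm x * smoothed \<rho> x) + (smoothed \<rho> x)\<^sup>2 + (2 * t * m * (1 - t)) * norm x
      - (2 * m * (1 - t)) * smoothed \<rho> x + m\<^sup>2 * (1 - t)\<^sup>2" for x
    by (simp add: power2_eq_square algebra_simps)
  have "has_bochner_integral \<gamma> (\<lambda>x. (t * (norm x - m) - (smoothed \<rho> x - m))\<^sup>2)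
    (t\<^sup>2 * 1 - 2 * t * norm_corr \<rho> + norm_corr (\<rho>\<^sup>2) + (2 * t * m * (1 - t)) * sqrt \<kappa>
      - (2 * m * (1 - t)) * sqrt \<kappa> + m\<^sup>2 * (1 - t)\<^sup>2)"
    unfolding *
    by (intro has_bochner_integral_add has_bochner_integral_diff has_bochner_integral_mult_right
        second_moment mean_norm has_mean_smoothed[OF \<rho>] has_integral_smoothed_sq[OF \<rho>])
       (auto simp: has_bochner_integral_iff integrable_norm_smoothed[OF \<rho>] norm_corr_def prob_space)
  then have "0 \<le> t\<^sup>2 - 2 * t * norm_corr \<rho> + norm_corr (\<rho>\<^sup>2) + 2 * t * m * (1 - t) * m - 2 * m * (1 - t) * m + m\<^sup>2 * (1 - t)\<^sup>2"
    using Bochner_Integration.integral_nonneg[where M = \<gamma> and f = "\<lambda>x. (t * (norm x - m) - (smoothed \<rho> x - m))\<^sup>2"]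
    by (simp add: has_bochner_integral_iff m_def)
  also have "\<dots> = t\<^sup>2 * (1 - m\<^sup>2) - 2 * t * (norm_corr \<rho> - m\<^sup>2) + (norm_corr (\<rho>\<^sup>2) - m\<^sup>2)"
    by (simp add: power2_eq_square algebra_simps)
  also have "\<dots> = t * (t * (1 - \<kappa>)) - 2 * t * (norm_corr \<rho> - \<kappa>) + (norm_corr (\<rho>\<^sup>2) - \<kappa>)"
    by (simp add: m) (simp add: power2_eq_square)
  also have "t * (1 - \<kappa>) = norm_corr \<rho> - \<kappa>" using \<kappa>_pos by (simp add: t_def)
  finally have "t * (norm_corr \<rho> - \<kappa>) \<le> norm_corr (\<rho>\<^sup>2) - \<kappa>" by simp
  then show ?thesis using \<kappa>_pos
    by (simp add: t_def field_simps power2_eq_square)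
qed

text \<open>By \<open>norm_corr_square\<close> the ratio \<open>D \<rho> = (norm_corr \<rho> - \<kappa>) / ((1 - \<kappa>) * \<rho>)\<close> satisfies
  \<open>(D \<rho>)\<^sup>2 \<le> D (\<rho>\<^sup>2)\<close>; being bounded, it cannot exceed 1.\<close>

lemma norm_corr_le:
  assumes \<rho>: "0 \<le> \<rho>" "\<rho> \<le> 1"
  shows "norm_corr \<rho> \<le> \<kappa> + (1 - \<kappa>) * \<rho>"
proof (cases "\<rho> = 0")
  case True then show ?thesis using norm_corr_le_add[OF \<rho>] by simp
next
  case False
  with \<rho> have \<rho>: "0 < \<rho>" "\<rho> \<le> 1" by auto
  define D where "D r = (norm_corr r - \<kappa>) / ((1 - \<kappa>) * r)" for r
  have D_bound: "D r \<le> 1 / (1 - \<kappa>)" if "0 < r" "r \<le> 1" for r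
  proof -
    have "(norm_corr r - \<kappa>) / r \<le> 1" using norm_corr_le_add[of r] that by simp
    then have "(norm_corr r - \<kappa>) / r / (1 - \<kappa>) \<le> 1 / (1 - \<kappa>)"
      using \<kappa>_pos by (intro divide_right_mono) auto
    then show ?thesis by (simp add: D_def mult.commute)
  qed
  have D_sq: "(D r)\<^sup>2 \<le> D (r\<^sup>2)" if "0 < r" "r \<le> 1" for r
  proof -
    have "(D r)\<^sup>2 = (norm_corr r - \<kappa>)\<^sup>2 / ((1 - \<kappa>) * r)\<^sup>2"
      by (simp add: D_def power_divide)
    also have "\<dots> \<le> (1 - \<kappa>) * (norm_corr (r\<^sup>2) - \<kappa>) / ((1 - \<kappa>) * r)\<^sup>2"
      using that by (intro divide_right_mono norm_corr_square) auto
    also have "\<dots> = D (r\<^sup>2)" using that \<kappa>_pos by (simp add: D_def power2_eq_square)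
    finally show ?thesis .
  qed
  have "D \<rho> \<le> 1"
  proof (rule ccontr)
    assume "\<not> D \<rho> \<le> 1"
    then have D: "D \<rho> > 1" by simp
    have iter: "D \<rho> ^ (2 ^ n) \<le> D (\<rho> ^ (2 ^ n))" for n :: nat
    proof (induction n)
      case (Suc n)
      have "D \<rho> ^ (2 ^ Suc n) = (D \<rho> ^ (2 ^ n))\<^sup>2" by (simp add: power_mult[symmetric] mult.commute)
      also have "\<dots> \<le> (D (\<rho> ^ (2 ^ n)))\<^sup>2" using Suc D by (intro power_mono) auto
      also have "\<dots> \<le> D ((\<rho> ^ (2 ^ n))\<^sup>2)" using \<rho> by (intro D_sq) (auto simp: power_le_one)
      also have "(\<rho> ^ (2 ^ n))\<^sup>2 = \<rho> ^ (2 ^ Suc n)" by (simp add: power_mult[symmetric] mult.commute)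
      finally show ?case .
    qed simp
    obtain n where n: "1 / (1 - \<kappa>) < D \<rho> ^ n" using real_arch_pow[OF D] by blast
    have "D \<rho> ^ n \<le> D \<rho> ^ (2 ^ n)" using D by (intro power_increasing) (auto simp: less_imp_le)
    also have "\<dots> \<le> D (\<rho> ^ (2 ^ n))" by (rule iter)
    also have "\<dots> \<le> 1 / (1 - \<kappa>)" using \<rho> by (intro D_bound) (auto simp: power_le_one)
    finally show False using n by simp
  qed
  then show ?thesis using \<rho> \<kappa>_pos by (simp add: D_def field_simps)
qed

end

subsection \<open>Amplitudes far out along a ray\<close>

text \<open>For every \<open>r \<ge> R\<close>, \<open>norm (q + r b) - r norm b\<close> lies between its limit \<open>(q \<bullet> b) / norm b\<close> and its value
  at \<open>R\<close>; this is the lower bound on its modulus that results.\<close>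

definition limit_gap :: "real \<Rightarrow> 'a::real_inner \<Rightarrow> 'a \<Rightarrow> real" where
  "limit_gap R b q = max 0 (max (q \<bullet> b / norm b) (R * norm b - norm (q + R *\<^sub>R b)))"

context
  fixes b q :: "'a::real_inner" and R :: real
  assumes R: "0 \<le> R"
begin

lemma projection_le_gap: "q \<bullet> b / norm b \<le> norm (q + r *\<^sub>R b) - r * norm b"
proof (cases "b = 0")
  case False
  have "(q + r *\<^sub>R b) \<bullet> b \<le> norm (q + r *\<^sub>R b) * norm b" by (rule norm_cauchy_schwarz)
  then have "q \<bullet> b + r * norm b * norm b \<le> norm (q + r *\<^sub>R b) * norm b"
    by (simp add: inner_add_left power2_norm_eq_inner[symmetric] power2_eq_square)
  then show ?thesis using False by (simp add: field_simps)
qed simp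

lemma gap_antimono:
  assumes "R \<le> r"
  shows "norm (q + r *\<^sub>R b) - r * norm b \<le> norm (q + R *\<^sub>R b) - R * norm b"
proof -
  have "norm (q + r *\<^sub>R b) = norm ((q + R *\<^sub>R b) + (r - R) *\<^sub>R b)" by (simp add: algebra_simps)
  also have "\<dots> \<le> norm (q + R *\<^sub>R b) + (r - R) * norm b"
    using assms by (intro norm_triangle_le) simp
  finally show ?thesis by (simp add: algebra_simps)
qed

lemma limit_gap_le:
  assumes "R \<le> r"
  shows "limit_gap R b q \<le> \<bar>norm (q + r *\<^sub>R b) - r * norm b\<bar>"
  using projection_le_gap[of r] gap_antimono[OF assms] by (auto simp: limit_gap_def)

lemma projection_abs_le: "\<bar>q \<bullet> b / norm b\<bar> \<le> norm q"
  using Cauchy_Schwarz_ineq2[of q b] by (cases "b = 0") (auto simp: field_simps)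

lemma gap_abs_le: "0 \<le> r \<Longrightarrow> \<bar>norm (q + r *\<^sub>R b) - r * norm b\<bar> \<le> norm q"
  using norm_triangle_ineq3[of "q + r *\<^sub>R b" "r *\<^sub>R b"] by simp

text \<open>With \<open>F\<close> the limit and \<open>G\<close> the value at \<open>R\<close>, the
  loss against \<open>F\<close> squared is of order \<open>G - F\<close>, by the signs: for
  \<open>F \<ge> 0\<close> nothing is lost; if 0 lies between them, the modulus of \<open>F\<close>
  is itself at most \<open>G - F\<close>; if both are negative, the difference of squares
  factors.\<close>

lemma limit_gap_sq_ge:
  "(q \<bullet> b / norm b)\<^sup>2 - 2 * norm q * (norm (q + R *\<^sub>R b) - R * norm b - q \<bullet> b / norm b) \<le> (limit_gap R b q)\<^sup>2"
proof -
  define F G where "F = q \<bullet> b / norm b" and "G = norm (q + R *\<^sub>R b) - R * norm b"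
  have FG: "F \<le> G" "\<bar>F\<bar> \<le> norm q" "\<bar>G\<bar> \<le> norm q"
    using projection_le_gap projection_abs_le gap_abs_le R by (auto simp: F_def G_def)
  have L: "limit_gap R b q = max 0 (max F (- G))" by (simp add: limit_gap_def F_def G_def)
  consider "0 \<le> F" | "F < 0" "0 < G" | "F < 0" "G \<le> 0" by linarith
  then have "F\<^sup>2 - 2 * norm q * (G - F) \<le> (max 0 (max F (- G)))\<^sup>2"
  proof cases
    case 1
    then have "max 0 (max F (- G)) = F" using FG by auto
    then show ?thesis using FG by simp
  next
    case 2
    have "F\<^sup>2 = \<bar>F\<bar> * \<bar>F\<bar>" by (simp add: power2_eq_square)
    also have "\<dots> \<le> norm q * (G - F)" using FG 2 by (intro mult_mono) auto
    also have "\<dots> \<le> 2 * norm q * (G - F)" using FG by simp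
    finally show ?thesis using 2 by (simp add: max_def)
  next
    case 3
    have "F\<^sup>2 - G\<^sup>2 = (- F - G) * (G - F)" by (simp add: power2_eq_square algebra_simps)
    also have "\<dots> \<le> (2 * norm q) * (G - F)" using FG by (intro mult_right_mono) auto
    finally show ?thesis using 3 by (simp add: max_def)
  qed
  then show ?thesis by (simp only: L) (simp add: F_def G_def)
qed

lemma gap_minus_projection_le:
  "norm (q + R *\<^sub>R b) - R * norm b - q \<bullet> b / norm b \<le> 2 * norm q"
  using projection_abs_le gap_abs_le[OF R] by linarith

text \<open>The rate at which the gap approaches its limit. With \<open>X\<close>, \<open>s\<close>,
  \<open>F\<close> as in the proof, X^2 - (s + F)^2 = |q|^2 - F^2, and division by X + s + F gives a
  decay like 1/s.\<close>

lemma gap_minus_projection_le':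
  assumes b: "b \<noteq> 0" and R': "0 < R"
  shows "norm (q + R *\<^sub>R b) - R * norm b - q \<bullet> b / norm b \<le> 4 * (norm q)\<^sup>2 / (R * norm b)"
proof -
  define s F X where "s = R * norm b" and "F = q \<bullet> b / norm b" and "X = norm (q + R *\<^sub>R b)"
  have s: "0 < s" using b R' by (simp add: s_def)
  have F: "F * norm b = q \<bullet> b" using b by (simp add: F_def)
  have XF: "s + F \<le> X" using projection_le_gap[of R] by (simp add: s_def F_def X_def)
  have Fq: "\<bar>F\<bar> \<le> norm q" using projection_abs_le by (simp add: F_def)
  \<comment> \<open>For \<open>s > 2 * norm q\<close> the divisor X + s + F exceeds
    \<open>s\<close>; for smaller \<open>s\<close> the crude bound \<open>2 * norm q\<close> is
    already good enough.\<close>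
  have "(X - s - F) * s \<le> 4 * (norm q)\<^sup>2"
  proof (cases "s \<le> 2 * norm q")
    case True
    have "(X - s - F) * s \<le> (2 * norm q) * (2 * norm q)"
      using gap_minus_projection_le True s by (intro mult_mono) (auto simp: X_def s_def F_def)
    then show ?thesis by (simp add: power2_eq_square)
  next
    case False
    have "X\<^sup>2 = (norm q)\<^sup>2 + 2 * s * F + s\<^sup>2"
      using F unfolding X_def s_def
      by (simp add: power2_norm_eq_inner inner_add_left inner_add_right inner_commute power_mult_distrib)
         (simp add: algebra_simps power2_eq_square)
    then have "(X - s - F) * (X + (s + F)) \<le> (norm q)\<^sup>2"
      by (simp add: algebra_simps power2_eq_square)
    moreover have "(X - s - F) * s \<le> (X - s - F) * (X + (s + F))"
      using XF Fq False by (intro mult_left_mono) auto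
    ultimately show ?thesis by (smt (verit) zero_le_power2)
  qed
  then have "X - s - F \<le> 4 * (norm q)\<^sup>2 / s" using s by (simp add: pos_le_divide_eq)
  then show ?thesis by (simp only: s_def X_def F_def)
qed

end

lemma limit_gap_nonneg [simp]: "0 \<le> limit_gap R b q"
  by (simp add: limit_gap_def)

text \<open>A maximum of functions that are 1-Lipschitz in \<open>q\<close>. This is what carries
  the bound from a net of directions to all of them.\<close>

lemma limit_gap_diff: "\<bar>limit_gap R b q - limit_gap R b q'\<bar> \<le> norm (q - q')"
proof -
  have "\<bar>q \<bullet> b / norm b - q' \<bullet> b / norm b\<bar> \<le> norm (q - q')"
    using projection_abs_le[of 0 "q - q'" b] by (simp add: inner_diff_left diff_divide_distrib)
  moreover have "\<bar>norm (q + R *\<^sub>R b) - norm (q' + R *\<^sub>R b)\<bar> \<le> norm (q - q')"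
    using norm_triangle_ineq3[of "q + R *\<^sub>R b" "q' + R *\<^sub>R b"] by simp
  ultimately show ?thesis unfolding limit_gap_def by linarith
qed

lemma limit_gap_zero [simp]: "0 \<le> R \<Longrightarrow> limit_gap R b 0 = 0"
  by (simp add: limit_gap_def)

lemma limit_gap_abs_le: "0 \<le> R \<Longrightarrow> limit_gap R b q \<le> norm q"
  using limit_gap_diff[of R b q 0] by simp

lemma measurable_limit_gap [measurable]:
  assumes [measurable]: "f \<in> borel_measurable M" "g \<in> borel_measurable M"
  shows "(\<lambda>x. limit_gap R (f x) (g x :: 'a::euclidean_space)) \<in> borel_measurable M"
  unfolding limit_gap_def by measurable

subsection \<open>Moments of a Gaussian row\<close>

context gaussian_law
begin

lemma integrable_norm4: "integrable \<gamma> (\<lambda>x. (norm x) ^ 4)"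
  and integral_norm4: "(\<integral>x. (norm x) ^ 4 \<partial>\<gamma>) \<le> 64"
proof -
  \<comment> \<open>The quadratic Taylor term of exp(t^2/4) is t^4/32; with
    \<open>exp_moment\<close> this gives 32 * 2 = 64.\<close>
  have le: "t ^ 4 \<le> 32 * exp (t\<^sup>2 / 4)" for t :: real
  proof -
    have "1 + t\<^sup>2 / 4 + (t\<^sup>2 / 4)\<^sup>2 / 2 \<le> exp (t\<^sup>2 / 4)"
      by (rule exp_lower_Taylor_quadratic) simp
    moreover have "0 \<le> t\<^sup>2 / 4" by simp
    moreover have "(t\<^sup>2 / 4)\<^sup>2 / 2 = t ^ 4 / 32" by (simp add: power_divide)
    ultimately show ?thesis by linarith
  qed
  have "(\<integral>\<^sup>+x. ennreal ((norm x) ^ 4) \<partial>\<gamma>) \<le> (\<integral>\<^sup>+x. ennreal 32 * ennreal (exp ((norm x)\<^sup>2 / 4)) \<partial>\<gamma>)"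
    using le by (intro nn_integral_mono) (simp add: ennreal_mult[symmetric] del: ennreal_numeral)
  also have "\<dots> = 32 * (\<integral>\<^sup>+x. ennreal (exp ((norm x)\<^sup>2 / 4)) \<partial>\<gamma>)"
    by (simp add: nn_integral_cmult)
  also have "\<dots> \<le> 32 * 2" by (intro mult_left_mono exp_moment) simp
  also have "\<dots> = ennreal 64" by simp
  finally have *: "(\<integral>\<^sup>+x. ennreal ((norm x) ^ 4) \<partial>\<gamma>) \<le> ennreal 64" .
  then show "integrable \<gamma> (\<lambda>x. (norm x) ^ 4)"
    by (intro integrableI_nonneg) (auto intro: le_less_trans)
  then show "(\<integral>x. (norm x) ^ 4 \<partial>\<gamma>) \<le> 64"
    using * nn_integral_eq_integral[of \<gamma> "\<lambda>x. (norm x) ^ 4"] by (simp del: ennreal_numeral)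
qed

lemma nn_integral_scaled_sq: "(\<integral>\<^sup>+x. ennreal ((norm (of_real r * x))\<^sup>2) \<partial>\<gamma>) = ennreal (r\<^sup>2)"
  using nn_second_moment
  by (simp add: norm_mult power_mult_distrib ennreal_mult nn_integral_cmult)

lemma pair_second_moment:
  assumes "0 \<le> a"
  shows "has_bochner_integral pairs (\<lambda>(x, y). (norm (of_real a * x + of_real b * y))\<^sup>2) (a\<^sup>2 + b\<^sup>2)"
proof (rule has_bochner_integral_nn_integral)
  have "(\<integral>\<^sup>+z. ennreal (case z of (x, y) \<Rightarrow> (norm (of_real a * x + of_real b * y))\<^sup>2) \<partial>pairs) =
    (\<integral>\<^sup>+x. \<integral>\<^sup>+y. ennreal ((norm (of_real a * x + of_real b * y))\<^sup>2) \<partial>\<gamma> \<partial>\<gamma>)"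
    by (subst nn_integral_fst[symmetric]) auto
  also have "\<dots> = ennreal (a\<^sup>2 + b\<^sup>2)"
    using nn_integral_add_scaled[OF _ assms, of "\<lambda>x. ennreal ((norm x)\<^sup>2)" "of_real b"] nn_integral_scaled_sq
    by simp
  finally show "(\<integral>\<^sup>+z. ennreal (case z of (x, y) \<Rightarrow> (norm (of_real a * x + of_real b * y))\<^sup>2) \<partial>pairs) = ennreal (a\<^sup>2 + b\<^sup>2)" .
qed auto

lemma pair_norm_corr:
  assumes a: "0 \<le> a" and b: "0 \<le> b"
  shows "integrable pairs (\<lambda>(x, y). norm x * norm (of_real a * x + of_real b * y))"
    and "(\<integral>(x, y). norm x * norm (of_real a * x + of_real b * y) \<partial>pairs) \<le>
      \<kappa> * sqrt (a\<^sup>2 + b\<^sup>2) + (1 - \<kappa>) * a"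
proof -
  define n where "n = sqrt (a\<^sup>2 + b\<^sup>2)"
  \<comment> \<open>If \<open>n = 0\<close> then \<open>a = b = 0\<close>, and the convention
    \<open>a / 0 = 0\<close> keeps \<open>n * \<rho> = a\<close> true.\<close>
  define \<rho> where "\<rho> = a / n"
  have n: "0 \<le> n" "n\<^sup>2 = a\<^sup>2 + b\<^sup>2" "a \<le> n" by (auto simp: n_def)
  have \<rho>: "0 \<le> \<rho>" "\<rho> \<le> 1" using a n by (auto simp: \<rho>_def divide_le_eq_1)
  have an: "n * \<rho> = a" using a b n(2) by (auto simp: \<rho>_def)
  have "(n * sqrt (1 - \<rho>\<^sup>2))\<^sup>2 = n\<^sup>2 * (1 - \<rho>\<^sup>2)"
    using sqrt_bounds[OF \<rho>] by (simp add: power_mult_distrib)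
  also have "\<dots> = n\<^sup>2 - (n * \<rho>)\<^sup>2" by (simp add: power_mult_distrib algebra_simps)
  also have "\<dots> = b\<^sup>2" using n an by simp
  finally have bn: "n * sqrt (1 - \<rho>\<^sup>2) = b"
    using n b sqrt_bounds[OF \<rho>] by (simp add: power2_eq_iff_nonneg)
  have split: "norm x * norm (of_real a * x + of_real b * y) =
    n * (norm x * norm (of_real \<rho> * x + of_real (sqrt (1 - \<rho>\<^sup>2)) * y))" for x y :: 'a
  proof -
    have "of_real a * x + of_real b * y = of_real n * (of_real \<rho> * x + of_real (sqrt (1 - \<rho>\<^sup>2)) * y)"
      unfolding an[symmetric] bn[symmetric] by (simp add: algebra_simps)
    then show ?thesis using n by (simp add: norm_mult)
  qed
  have nonneg: "0 \<le> norm_corr \<rho>" by (simp add: norm_corr_def)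
  have "has_bochner_integral pairs (\<lambda>(x, y). norm x * norm (of_real a * x + of_real b * y)) (n * norm_corr \<rho>)"
  proof (rule has_bochner_integral_nn_integral)
    have "(\<integral>\<^sup>+z. ennreal (case z of (x, y) \<Rightarrow> norm x * norm (of_real a * x + of_real b * y)) \<partial>pairs) =
      (\<integral>\<^sup>+x. \<integral>\<^sup>+y. ennreal (norm x * norm (of_real a * x + of_real b * y)) \<partial>\<gamma> \<partial>\<gamma>)"
      by (subst nn_integral_fst[symmetric]) auto
    also have "\<dots> = ennreal (n * norm_corr \<rho>)"
      using n nonneg unfolding split
      by (simp add: ennreal_mult[of n] ennreal_norm_corr[OF \<rho>] nn_integral_cmult)
    finally show "(\<integral>\<^sup>+z. ennreal (case z of (x, y) \<Rightarrow> norm x * norm (of_real a * x + of_real b * y)) \<partial>pairs) =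
      ennreal (n * norm_corr \<rho>)" .
  qed (use n nonneg in auto)
  then show "integrable pairs (\<lambda>(x, y). norm x * norm (of_real a * x + of_real b * y))"
    and "(\<integral>(x, y). norm x * norm (of_real a * x + of_real b * y) \<partial>pairs) \<le>
      \<kappa> * sqrt (a\<^sup>2 + b\<^sup>2) + (1 - \<kappa>) * a"
    using mult_left_mono[OF norm_corr_le[OF \<rho>] n(1)] an
    by (auto simp: has_bochner_integral_iff n_def[symmetric] algebra_simps)
qed

text \<open>Expanding the square leaves the mixed term \<open>K\<close>, bounded by
  \<open>norm_corr_le\<close>; alignment, \<open>0 \<le> \<alpha> + r\<close>, makes its correlation
  nonnegative. What remains splits into \<kappa> (n - r)^2 \<ge> 0 and (1 - \<kappa>) (n^2 + r^2 - 2
  r \<tau>), where the last bracket is the squared norm of \<open>v\<close>, that is 1.\<close>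

lemma pair_amplitude_moment:
  assumes r: "0 \<le> r" and \<alpha>: "0 \<le> \<alpha> + r" and \<beta>: "0 \<le> \<beta>" and 1: "\<alpha>\<^sup>2 + \<beta>\<^sup>2 = 1"
  shows "1 - \<kappa> \<le> (\<integral>(x, y). (norm (of_real \<alpha> * x + of_real \<beta> * y + of_real r * x) - r * norm x)\<^sup>2 \<partial>pairs)"
proof -
  define \<tau> n where "\<tau> = \<alpha> + r" and "n = sqrt (\<tau>\<^sup>2 + \<beta>\<^sup>2)"
  have n: "n\<^sup>2 = \<tau>\<^sup>2 + \<beta>\<^sup>2" by (simp add: n_def)
  have \<tau>: "0 \<le> \<tau>" using \<alpha> by (simp add: \<tau>_def)
  define P where "P = pairs"
  define K where "K = (\<integral>(x, y). norm x * norm (of_real \<tau> * x + of_real \<beta> * y) \<partial>P)"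
  have eq: "(norm (of_real \<alpha> * x + of_real \<beta> * y + of_real r * x) - r * norm x)\<^sup>2 =
     (norm (of_real \<tau> * x + of_real \<beta> * y))\<^sup>2 + r\<^sup>2 * (norm (of_real 1 * x + of_real 0 * y))\<^sup>2 -
     2 * r * (norm x * norm (of_real \<tau> * x + of_real \<beta> * y))" for x y :: 'a
  proof -
    have "of_real \<alpha> * x + of_real \<beta> * y + of_real r * x = of_real \<tau> * x + of_real \<beta> * y"
      by (simp add: \<tau>_def algebra_simps)
    then show ?thesis by (simp only:) (simp add: power2_eq_square algebra_simps)
  qed
  have "has_bochner_integral P (\<lambda>z. (case z of (x, y) \<Rightarrow> (norm (of_real \<tau> * x + of_real \<beta> * y))\<^sup>2)
      + r\<^sup>2 * (case z of (x, y) \<Rightarrow> (norm (of_real 1 * x + of_real 0 * y))\<^sup>2)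
      - 2 * r * (case z of (x, y) \<Rightarrow> norm x * norm (of_real \<tau> * x + of_real \<beta> * y)))
      (\<tau>\<^sup>2 + \<beta>\<^sup>2 + r\<^sup>2 * (1\<^sup>2 + 0\<^sup>2) - 2 * r * K)"
    unfolding P_def
    by (intro has_bochner_integral_add has_bochner_integral_diff has_bochner_integral_mult_right
        pair_second_moment \<tau>)
       (auto simp: has_bochner_integral_iff pair_norm_corr[OF \<tau> \<beta>] K_def P_def)
  then have E: "(\<integral>(x, y). (norm (of_real \<alpha> * x + of_real \<beta> * y + of_real r * x) - r * norm x)\<^sup>2 \<partial>P) = n\<^sup>2 + r\<^sup>2 - 2 * r * K"
    by (simp add: has_bochner_integral_iff eq n case_prod_unfold)
  have "K \<le> \<kappa> * n + (1 - \<kappa>) * \<tau>"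
    using pair_norm_corr(2)[OF \<tau> \<beta>] by (simp add: K_def P_def n_def)
  then have "2 * r * K \<le> 2 * r * (\<kappa> * n + (1 - \<kappa>) * \<tau>)" using r by (intro mult_left_mono) auto
  moreover have "0 \<le> \<kappa> * (n - r)\<^sup>2" using \<kappa>_pos by simp
  moreover have "n\<^sup>2 + r\<^sup>2 - 2 * r * (\<kappa> * n + (1 - \<kappa>) * \<tau>) = \<kappa> * (n - r)\<^sup>2 + (1 - \<kappa>) * (n\<^sup>2 + r\<^sup>2 - 2 * r * \<tau>)"
    by (simp add: power2_eq_square algebra_simps)
  moreover have "n\<^sup>2 + r\<^sup>2 - 2 * r * \<tau> = 1" unfolding n using 1 by (simp add: \<tau>_def power2_eq_square algebra_simps)
  ultimately show ?thesis unfolding E[unfolded P_def] by simp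
qed

text \<open>Symmetry of the law under negation comes from the quarter turn \<open>c = 0\<close>,
  \<open>s = 1\<close>, which sends (x, y) to (y, -x).\<close>

lemma integral_inner_eq_0: "(\<integral>y. y \<bullet> w \<partial>\<gamma>) = 0"
proof -
  have "distr \<gamma> borel (\<lambda>x. - x) = distr \<gamma> borel (\<lambda>x. x)"
  proof (rule distr_eqI_nn_integral)
    fix f :: "'a \<Rightarrow> ennreal" assume [measurable]: "f \<in> borel_measurable borel"
    show "(\<integral>\<^sup>+x. f (- x) \<partial>\<gamma>) = (\<integral>\<^sup>+x. f x \<partial>\<gamma>)"
      using rotation[of "\<lambda>(x, y). f y" 0 1] cj_of_real[of 1] by simp
  qed measurable
  then have "(\<integral>x. x \<bullet> w \<partial>distr \<gamma> borel (\<lambda>x. - x)) = (\<integral>x. x \<bullet> w \<partial>distr \<gamma> borel (\<lambda>x. x))" by simp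
  then show ?thesis by (simp add: integral_distr)
qed

lemma integrable_inner: "integrable \<gamma> (\<lambda>y. y \<bullet> w)"
  by (rule Bochner_Integration.integrable_bound[of _ "\<lambda>y. norm y * norm w"])
     (auto simp: Cauchy_Schwarz_ineq2)

lemma integrable_inner_sq: "integrable \<gamma> (\<lambda>y. (y \<bullet> w)\<^sup>2)"
proof (rule Bochner_Integration.integrable_bound[of _ "\<lambda>y. (norm y)\<^sup>2 * (norm w)\<^sup>2"])
  have "(y \<bullet> w)\<^sup>2 \<le> (norm y)\<^sup>2 * (norm w)\<^sup>2" for y
    using abs_le_square_iff[of "y \<bullet> w" "norm y * norm w"] Cauchy_Schwarz_ineq2[of y w]
    by (simp add: power_mult_distrib)
  then show "AE y in \<gamma>. norm ((y \<bullet> w)\<^sup>2) \<le> norm ((norm y)\<^sup>2 * (norm w)\<^sup>2)" by simp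
qed auto

lemma AE_nonzero: "AE x in \<gamma>. x \<noteq> 0"
  using no_atom by (intro AE_I[of _ _ "{0}"]) auto

lemma integrable_pair_fst:
  fixes f :: "'a \<Rightarrow> real"
  assumes "integrable \<gamma> f"
  shows "integrable pairs (\<lambda>z. f (fst z))" "integrable pairs (\<lambda>z. f (snd z))"
proof -
  show 1: "integrable pairs (\<lambda>z. f (fst z))"
    using assms integrable_distr[of fst "pairs" \<gamma> f] by (simp add: distr_pair_fst)
  show "integrable pairs (\<lambda>z. f (snd z))"
    using pair.integrable_product_swap[OF 1] by (simp add: case_prod_unfold)
qed

end

text \<open>Only a seminorm on functions, as the coordinates from \<open>d\<close> on are
  free.\<close>

definition vnorm :: "nat \<Rightarrow> (nat \<Rightarrow> 'a::real_normed_vector) \<Rightarrow> real" where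
  "vnorm d x = L2_set (\<lambda>j. norm (x j)) {..<d}"

lemma vnorm_sq: "(vnorm d x)\<^sup>2 = (\<Sum>j<d. (norm (x j))\<^sup>2)"
  by (simp add: vnorm_def L2_set_def sum_nonneg)

lemma vnorm_nonneg [simp]: "0 \<le> vnorm d x"
  by (simp add: vnorm_def)

section \<open>Second moments along a row, for bounded and for large \<open>r\<close>\<close>

context gaussian_law
begin


lemma prob_space_rows: "prob_space (rows d)"
  by (intro prob_space_PiM prob_space_axioms)

lemma AE_fst_nonzero: "AE z in pairs. fst z \<noteq> 0"
proof -
  have "AE x in distr pairs \<gamma> fst. x \<noteq> 0"
    using AE_nonzero by (subst distr_pair_fst)
  then show ?thesis by (rule AE_distrD[rotated]) simp
qed

lemma integrable_sum_norm_sq: "integrable pairs (\<lambda>z. (norm (fst z) + norm (snd z))\<^sup>2)"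
proof (rule Bochner_Integration.integrable_bound)
  show "integrable pairs (\<lambda>z. 2 * (norm (fst z))\<^sup>2 + 2 * (norm (snd z))\<^sup>2)"
    using integrable_pair_fst[of "\<lambda>x. (norm x)\<^sup>2"] by simp
  have "(s + t)\<^sup>2 \<le> 2 * s\<^sup>2 + 2 * t\<^sup>2" for s t :: real
    using zero_le_power2[of "s - t"] by (simp add: power2_eq_square algebra_simps)
  then show "AE z in pairs. norm ((norm (fst z) + norm (snd z))\<^sup>2) \<le> norm (2 * (norm (fst z))\<^sup>2 + 2 * (norm (snd z))\<^sup>2)"
    by simp
qed measurable

text \<open>Given \<open>x\<close>, the projection is \<alpha> |x| + \<beta> (y . w) with w = x/|x|.
  The cross term has mean 0, so the second moment is at least \<alpha>^2 + \<beta>^2/2.\<close>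

lemma projection_moment:
  assumes 1: "\<alpha>\<^sup>2 + \<beta>\<^sup>2 = 1"
    and int: "integrable pairs (\<lambda>(x, y). ((of_real \<alpha> * x + of_real \<beta> * y) \<bullet> x / norm x)\<^sup>2)"
  shows "1 / 2 \<le> (\<integral>(x, y). ((of_real \<alpha> * x + of_real \<beta> * y) \<bullet> x / norm x)\<^sup>2 \<partial>pairs)"
proof -
  let ?F = "\<lambda>x y. ((of_real \<alpha> * x + of_real \<beta> * y) \<bullet> x / norm x)\<^sup>2"
  have "\<beta>\<^sup>2 \<le> 1" "\<alpha>\<^sup>2 = 1 - \<beta>\<^sup>2" using 1 zero_le_power2[of \<alpha>] by linarith+
  then have "1 / 2 \<le> \<alpha>\<^sup>2 + \<beta>\<^sup>2 / 2" by simp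
  also have "\<dots> = (\<integral>x. \<alpha>\<^sup>2 * (norm x)\<^sup>2 + \<beta>\<^sup>2 / 2 \<partial>\<gamma>)" by simp
  also have "\<dots> \<le> (\<integral>x. \<integral>y. ?F x y \<partial>\<gamma> \<partial>\<gamma>)"
  proof (rule integral_mono_AE)
    show "integrable \<gamma> (\<lambda>x. \<integral>y. ?F x y \<partial>\<gamma>)"
      using pair.integrable_fst'[OF int] by simp
    show "AE x in \<gamma>. \<alpha>\<^sup>2 * (norm x)\<^sup>2 + \<beta>\<^sup>2 / 2 \<le> (\<integral>y. ?F x y \<partial>\<gamma>)"
      using AE_nonzero
    proof eventually_elim
      fix x :: 'a assume x: "x \<noteq> 0"
      define w where "w = x /\<^sub>R norm x"
      have w: "norm w = 1" using x by (simp add: w_def)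
      have "(of_real \<alpha> * x + of_real \<beta> * y) \<bullet> x / norm x = \<alpha> * norm x + \<beta> * (y \<bullet> w)" for y
      proof -
        have "of_real \<alpha> * x + of_real \<beta> * y = \<alpha> *\<^sub>R x + \<beta> *\<^sub>R y" by (simp only: scaleR_conv_of_real)
        moreover have "x \<bullet> x / norm x = norm x"
          using x by (simp add: dot_square_norm power2_eq_square)
        moreover have "y \<bullet> w = y \<bullet> x / norm x" by (simp add: w_def divide_inverse mult.commute)
        ultimately show ?thesis
          by (simp add: inner_add_left add_divide_distrib flip: times_divide_eq_right)
      qed
      then have F: "?F x y = \<alpha>\<^sup>2 * (norm x)\<^sup>2 + 2 * \<alpha> * norm x * \<beta> * (y \<bullet> w) + \<beta>\<^sup>2 * (y \<bullet> w)\<^sup>2" for y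
        by (simp only:) (simp add: power2_eq_square algebra_simps)
      have "(\<integral>y. ?F x y \<partial>\<gamma>) = \<alpha>\<^sup>2 * (norm x)\<^sup>2 + \<beta>\<^sup>2 * (\<integral>y. (y \<bullet> w)\<^sup>2 \<partial>\<gamma>)"
        unfolding F by (simp add: integrable_inner integrable_inner_sq integral_inner_eq_0)
      then show "\<alpha>\<^sup>2 * (norm x)\<^sup>2 + \<beta>\<^sup>2 / 2 \<le> (\<integral>y. ?F x y \<partial>\<gamma>)"
        using mult_left_mono[OF directional_moment[OF w], of "\<beta>\<^sup>2"] by simp
    qed
  qed simp
  also have "\<dots> = (\<integral>(x, y). ?F x y \<partial>pairs)"
    using pair.integral_fst'[OF int] by simp
  finally show ?thesis .
qed

text \<open>A single \<open>R\<close> has to serve all \<alpha>, \<beta>. Hence the error between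
  the limit and its value at \<open>R\<close> is dominated by a function \<open>G R\<close> free of
  \<alpha> and \<beta>, and dominated convergence pushes its integral below \<kappa> - 1/2, the
  margin between 1/2 and 1 - \<kappa>.\<close>

lemma limit_gap_moment:
  obtains R where "0 < R"
    "\<forall>\<alpha> \<beta>. \<alpha>\<^sup>2 + \<beta>\<^sup>2 = 1 \<longrightarrow>
      1 - \<kappa> \<le> (\<integral>(x, y). (limit_gap R x (of_real \<alpha> * x + of_real \<beta> * y))\<^sup>2 \<partial>pairs)"
proof -
  define P where "P = pairs"
  define B :: "'a \<times> 'a \<Rightarrow> real" where "B z = norm (fst z) + norm (snd z)" for z
  \<comment> \<open>The second entry of the minimum tends to 0 as \<open>R\<close> grows but is
    singular where \<open>fst z\<close> vanishes; the first one supplies the integrable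
    majorant.\<close>
  define G where "G R z = 2 * B z * min (2 * B z) (4 * (B z)\<^sup>2 / (R * norm (fst z)))" for R z
  have [measurable]: "B \<in> borel_measurable P" "G R \<in> borel_measurable P" for R
    unfolding B_def[abs_def] G_def[abs_def] P_def by measurable
  have B: "0 \<le> B z" for z by (simp add: B_def)
  have intB: "integrable P (\<lambda>z. (B z)\<^sup>2)"
    unfolding P_def B_def by (rule integrable_sum_norm_sq)
  have G_bound: "\<bar>G R z\<bar> \<le> 4 * (B z)\<^sup>2" if "0 \<le> R" for R z
  proof -
    have "\<bar>min (2 * B z) (4 * (B z)\<^sup>2 / (R * norm (fst z)))\<bar> \<le> 2 * B z"
      using B[of z] that by (auto simp: min_def)
    then have "2 * B z * \<bar>min (2 * B z) (4 * (B z)\<^sup>2 / (R * norm (fst z)))\<bar> \<le> 2 * B z * (2 * B z)"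
      using B[of z] by (intro mult_left_mono) auto
    then show ?thesis using B[of z] by (simp add: G_def abs_mult power2_eq_square)
  qed
  have "(\<lambda>n. \<integral>z. G (real n) z \<partial>P) \<longlonglongrightarrow> (\<integral>z. 0 \<partial>P)"
  proof (rule integral_dominated_convergence[where w = "\<lambda>z. 4 * (B z)\<^sup>2"])
    show "AE z in P. (\<lambda>n. G (real n) z) \<longlonglongrightarrow> 0"
      using AE_fst_nonzero unfolding P_def[symmetric]
    proof eventually_elim
      fix z :: "'a \<times> 'a" assume z: "fst z \<noteq> 0"
      have "(\<lambda>n. 4 * (B z)\<^sup>2 / norm (fst z) * inverse (real n)) \<longlonglongrightarrow> 4 * (B z)\<^sup>2 / norm (fst z) * 0"
        by (intro tendsto_mult tendsto_const lim_inverse_n)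
      then have "(\<lambda>n. 4 * (B z)\<^sup>2 / (real n * norm (fst z))) \<longlonglongrightarrow> 0"
        by (simp add: divide_inverse mult_ac)
      then have "(\<lambda>n. G (real n) z) \<longlonglongrightarrow> 2 * B z * min (2 * B z) 0"
        unfolding G_def by (intro tendsto_mult tendsto_const tendsto_min)
      then show "(\<lambda>n. G (real n) z) \<longlonglongrightarrow> 0" using B[of z] by (simp add: min_absorb2)
    qed
    show "AE z in P. norm (G (real n) z) \<le> 4 * (B z)\<^sup>2" for n using G_bound by simp
  qed (use intB in auto)
  then have "eventually (\<lambda>n. (\<integral>z. G (real n) z \<partial>P) < \<kappa> - 1 / 2) sequentially"
    using \<kappa>_bounds by (intro order_tendstoD(2)) auto
  from eventually_happens'[OF sequentially_bot eventually_conj[OF this eventually_gt_at_top[of 0]]]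
  obtain n where n: "0 < n" "(\<integral>z. G (real n) z \<partial>P) < \<kappa> - 1 / 2"
    by blast
  define R where "R = real n"
  have R: "0 < R" using n by (simp add: R_def)
  have intG: "integrable P (G R)"
    using R G_bound by (intro Bochner_Integration.integrable_bound[OF integrable_mult_right[OF intB, of 4]]) auto
  have "1 - \<kappa> \<le> (\<integral>(x, y). (limit_gap R x (of_real \<alpha> * x + of_real \<beta> * y))\<^sup>2 \<partial>P)" if ab: "\<alpha>\<^sup>2 + \<beta>\<^sup>2 = 1" for \<alpha> \<beta>
  proof -
    define q where "q z = of_real \<alpha> * fst z + of_real \<beta> * snd z" for z :: "'a \<times> 'a"
    have [measurable]: "q \<in> borel_measurable P" unfolding q_def[abs_def] P_def by measurable
    have [measurable]: "fst \<in> borel_measurable P" unfolding P_def by measurable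
    have "\<alpha>\<^sup>2 \<le> 1" "\<beta>\<^sup>2 \<le> 1" using ab zero_le_power2[of \<alpha>] zero_le_power2[of \<beta>] by linarith+
    then have "\<bar>\<alpha>\<bar> \<le> 1" "\<bar>\<beta>\<bar> \<le> 1" by (simp_all only: abs_square_le_1)
    then have qB: "norm (q z) \<le> B z" for z
      unfolding q_def B_def
      by (intro norm_triangle_mono) (auto simp: norm_mult mult_left_le_one_le)
    define F where "F z = (q z \<bullet> fst z / norm (fst z))\<^sup>2" for z
    have FB: "F z \<le> (B z)\<^sup>2" for z
      using order_trans[OF projection_abs_le[of 0 "q z" "fst z"] qB] B[of z]
      by (simp add: F_def abs_le_square_iff[symmetric])
    have [measurable]: "F \<in> borel_measurable P"
      unfolding F_def[abs_def] by measurable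
    have intF: "integrable P F"
      by (rule Bochner_Integration.integrable_bound[OF intB]) (use FB in \<open>auto simp: F_def\<close>)
    have LB: "(limit_gap R (fst z) (q z))\<^sup>2 \<le> (B z)\<^sup>2" for z
      using order_trans[OF limit_gap_abs_le qB] R by (intro power_mono) auto
    have intL: "integrable P (\<lambda>z. (limit_gap R (fst z) (q z))\<^sup>2)"
      by (rule Bochner_Integration.integrable_bound[OF intB]) (use LB in auto)
    have "1 / 2 \<le> (\<integral>z. F z \<partial>P)"
    proof -
      have F: "F = (\<lambda>(x, y). ((of_real \<alpha> * x + of_real \<beta> * y) \<bullet> x / norm x)\<^sup>2)"
        by (auto simp: F_def q_def fun_eq_iff)
      show ?thesis unfolding F P_def
        by (rule projection_moment[OF ab intF[unfolded F P_def]])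
    qed
    then have "1 - \<kappa> \<le> (\<integral>z. F z \<partial>P) - (\<integral>z. G R z \<partial>P)" using n by (simp add: R_def)
    also have "\<dots> = (\<integral>z. F z - G R z \<partial>P)" using intF intG by simp
    also have "\<dots> \<le> (\<integral>z. (limit_gap R (fst z) (q z))\<^sup>2 \<partial>P)"
    proof (rule integral_mono_AE)
      show "AE z in P. F z - G R z \<le> (limit_gap R (fst z) (q z))\<^sup>2"
        using AE_fst_nonzero unfolding P_def[symmetric]
      proof eventually_elim
        fix z :: "'a \<times> 'a" assume z: "fst z \<noteq> 0"
        define D where "D = norm (q z + R *\<^sub>R fst z) - R * norm (fst z) - q z \<bullet> fst z / norm (fst z)"
        have D: "0 \<le> D" "D \<le> 2 * norm (q z)" "D \<le> 4 * (norm (q z))\<^sup>2 / (R * norm (fst z))"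
          using R z projection_le_gap[of R "q z" "fst z" R] gap_minus_projection_le[of R "q z" "fst z"]
            gap_minus_projection_le'[of R "fst z" "q z"] by (auto simp: D_def)
        have "4 * (norm (q z))\<^sup>2 / (R * norm (fst z)) \<le> 4 * (B z)\<^sup>2 / (R * norm (fst z))"
          using qB R by (intro divide_right_mono mult_left_mono power_mono) auto
        then have "D \<le> min (2 * B z) (4 * (B z)\<^sup>2 / (R * norm (fst z)))"
          using D qB[of z] by auto
        then have "2 * norm (q z) * D \<le> G R z"
          unfolding G_def using D(1) qB[of z] by (intro mult_mono) (auto simp: B)
        then show "F z - G R z \<le> (limit_gap R (fst z) (q z))\<^sup>2"
          using limit_gap_sq_ge[of R "q z" "fst z"] R by (simp add: F_def D_def)
      qed
    qed (use intF intG intL in auto)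
    finally show ?thesis by (simp add: q_def case_prod_unfold)
  qed
  then show ?thesis using that[OF R] by (simp add: P_def)
qed

lemma rows_transfer:
  assumes e: "vnorm d e = 1" and v: "vnorm d v = 1" and \<alpha>: "(\<Sum>j<d. v j * cj (e j)) = of_real \<alpha>"
  obtains \<beta> where "0 \<le> \<beta>" "\<alpha>\<^sup>2 + \<beta>\<^sup>2 = 1"
    "\<forall>f :: 'a \<times> 'a \<Rightarrow> real. f \<in> borel_measurable (borel \<Otimes>\<^sub>M borel) \<longrightarrow>
      (\<integral>a. f (dot d a e, dot d a v) \<partial>rows d) = (\<integral>(x, y). f (x, of_real \<alpha> * x + of_real \<beta> * y) \<partial>pairs)"
proof -
  have "(\<Sum>j<d. (norm (e j))\<^sup>2) = 1" "(\<Sum>j<d. (norm (v j))\<^sup>2) = 1"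
    by (simp_all only: e v power_one flip: vnorm_sq)
  note e' = this
  obtain \<beta> where \<beta>: "0 \<le> \<beta>" "\<alpha>\<^sup>2 + \<beta>\<^sup>2 = (\<Sum>j<d. (norm (v j))\<^sup>2)"
    and law: "distr (rows d) (borel \<Otimes>\<^sub>M borel) (\<lambda>a. (dot d a e, dot d a v)) =
     distr pairs (borel \<Otimes>\<^sub>M borel) (\<lambda>(x, y). (x, of_real \<alpha> * x + of_real \<beta> * y))"
    by (rule joint_law[OF e'(1) \<alpha>])
  show ?thesis
  proof (rule that[OF \<beta>(1) \<beta>(2)[unfolded e'(2)]], intro allI impI)
    fix f :: "'a \<times> 'a \<Rightarrow> real" assume [measurable]: "f \<in> borel_measurable (borel \<Otimes>\<^sub>M borel)"
    have "(\<integral>a. f (dot d a e, dot d a v) \<partial>rows d) =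
      integral\<^sup>L (distr (rows d) (borel \<Otimes>\<^sub>M borel) (\<lambda>a. (dot d a e, dot d a v))) f"
      by (rule integral_distr[symmetric]) measurable
    also have "\<dots> = (\<integral>(x, y). f (x, of_real \<alpha> * x + of_real \<beta> * y) \<partial>pairs)"
      unfolding law by (subst integral_distr) (measurable, simp add: case_prod_unfold)
    finally show "(\<integral>a. f (dot d a e, dot d a v) \<partial>rows d) =
      (\<integral>(x, y). f (x, of_real \<alpha> * x + of_real \<beta> * y) \<partial>pairs)" .
  qed
qed

lemma rows_amplitude_moment:
  assumes "vnorm d e = 1" "vnorm d v = 1" "(\<Sum>j<d. v j * cj (e j)) = of_real \<alpha>"
    and "0 \<le> r" "0 \<le> \<alpha> + r"
  shows "1 - \<kappa> \<le> (\<integral>a. (norm (dot d a v + of_real r * dot d a e) - r * norm (dot d a e))\<^sup>2 \<partial>rows d)"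
proof -
  obtain \<beta> where \<beta>: "0 \<le> \<beta>" "\<alpha>\<^sup>2 + \<beta>\<^sup>2 = 1"
    and tr: "\<forall>f :: 'a \<times> 'a \<Rightarrow> real. f \<in> borel_measurable (borel \<Otimes>\<^sub>M borel) \<longrightarrow>
      (\<integral>a. f (dot d a e, dot d a v) \<partial>rows d) = (\<integral>(x, y). f (x, of_real \<alpha> * x + of_real \<beta> * y) \<partial>pairs)"
    by (rule rows_transfer[OF assms(1-3)])
  show ?thesis
    using tr[rule_format, of "\<lambda>(b, q). (norm (q + of_real r * b) - r * norm b)\<^sup>2"]
      pair_amplitude_moment[OF assms(4,5) \<beta>] by simp
qed

lemma rows_limit_gap_moment:
  obtains R where "0 < R"
    "\<And>d e v \<alpha>. vnorm d e = 1 \<Longrightarrow> vnorm d v = 1 \<Longrightarrow> (\<Sum>j<d. v j * cj (e j)) = of_real \<alpha> \<Longrightarrow>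
      1 - \<kappa> \<le> (\<integral>a. (limit_gap R (dot d a e) (dot d a v))\<^sup>2 \<partial>rows d)"
proof -
  obtain R where R: "0 < R" "\<forall>\<alpha> \<beta>. \<alpha>\<^sup>2 + \<beta>\<^sup>2 = 1 \<longrightarrow>
      1 - \<kappa> \<le> (\<integral>(x, y). (limit_gap R x (of_real \<alpha> * x + of_real \<beta> * y))\<^sup>2 \<partial>pairs)"
    by (rule limit_gap_moment)
  show ?thesis
  proof (rule that[OF R(1)])
    fix d e v \<alpha>
    assume *: "vnorm d e = 1" "vnorm d v = 1" "(\<Sum>j<d. v j * cj (e j)) = of_real \<alpha>"
    obtain \<beta> where \<beta>: "0 \<le> \<beta>" "\<alpha>\<^sup>2 + \<beta>\<^sup>2 = 1"
      and tr: "\<forall>f :: 'a \<times> 'a \<Rightarrow> real. f \<in> borel_measurable (borel \<Otimes>\<^sub>M borel) \<longrightarrow>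
        (\<integral>a. f (dot d a e, dot d a v) \<partial>rows d) = (\<integral>(x, y). f (x, of_real \<alpha> * x + of_real \<beta> * y) \<partial>pairs)"
      by (rule rows_transfer[OF *])
    show "1 - \<kappa> \<le> (\<integral>a. (limit_gap R (dot d a e) (dot d a v))\<^sup>2 \<partial>rows d)"
      using tr[rule_format, of "\<lambda>(b, q). (limit_gap R b q)\<^sup>2"] R(2)[rule_format, OF \<beta>(2)] by simp
  qed
qed

lemma rows_exp_moment:
  assumes "vnorm d v \<le> 1"
  shows "(\<integral>\<^sup>+a. ennreal (exp ((norm (dot d a v))\<^sup>2 / 4)) \<partial>rows d) \<le> 2"
proof -
  have "(\<integral>\<^sup>+a. ennreal (exp ((norm (dot d a v))\<^sup>2 / 4)) \<partial>rows d) =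
    (\<integral>\<^sup>+x. ennreal (exp ((norm (of_real (vnorm d v) * x))\<^sup>2 / 4)) \<partial>\<gamma>)"
    using nn_integral_dot[of "\<lambda>x. ennreal (exp ((norm x)\<^sup>2 / 4))" d v] by (simp add: vnorm_def)
  also have "\<dots> \<le> (\<integral>\<^sup>+x. ennreal (exp ((norm x)\<^sup>2 / 4)) \<partial>\<gamma>)"
  proof (rule nn_integral_mono)
    fix x :: 'a
    have "norm (of_real (vnorm d v) * x) \<le> norm x"
      using assms by (simp add: norm_mult mult_left_le_one_le)
    then show "ennreal (exp ((norm (of_real (vnorm d v) * x))\<^sup>2 / 4)) \<le> ennreal (exp ((norm x)\<^sup>2 / 4))"
      by (auto intro!: ennreal_leI power_mono)
  qed
  also have "\<dots> \<le> 2" by (rule exp_moment)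
  finally show ?thesis .
qed

lemma rows_fourth_moment:
  assumes "vnorm d v \<le> 1"
  shows "integrable (rows d) (\<lambda>a. (norm (dot d a v)) ^ 4)"
    and "(\<integral>a. (norm (dot d a v)) ^ 4 \<partial>rows d) \<le> 64"
proof -
  have "(\<integral>\<^sup>+a. ennreal ((norm (dot d a v)) ^ 4) \<partial>rows d) =
    (\<integral>\<^sup>+x. ennreal ((norm (of_real (vnorm d v) * x)) ^ 4) \<partial>\<gamma>)"
    using nn_integral_dot[of "\<lambda>x. ennreal ((norm x) ^ 4)" d v] by (simp add: vnorm_def)
  also have "\<dots> \<le> (\<integral>\<^sup>+x. ennreal ((norm x) ^ 4) \<partial>\<gamma>)"
  proof (rule nn_integral_mono)
    fix x :: 'a
    have "norm (of_real (vnorm d v) * x) \<le> norm x"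
      using assms by (simp add: norm_mult mult_left_le_one_le)
    then show "ennreal ((norm (of_real (vnorm d v) * x)) ^ 4) \<le> ennreal ((norm x) ^ 4)"
      by (auto intro!: ennreal_leI power_mono)
  qed
  also have "\<dots> \<le> ennreal 64"
    using integral_norm4 integrable_norm4 by (subst nn_integral_eq_integral) (auto simp del: ennreal_numeral intro: ennreal_leI)
  finally have *: "(\<integral>\<^sup>+a. ennreal ((norm (dot d a v)) ^ 4) \<partial>rows d) \<le> ennreal 64" .
  then show 1: "integrable (rows d) (\<lambda>a. (norm (dot d a v)) ^ 4)"
    by (intro integrableI_nonneg) (auto intro: le_less_trans)
  show "(\<integral>a. (norm (dot d a v)) ^ 4 \<partial>rows d) \<le> 64"
    using * 1 by (subst (asm) nn_integral_eq_integral) (auto simp del: ennreal_numeral)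
qed

end

subsection \<open>Tail bounds and nets\<close>

text \<open>Exponential Markov inequality. The tilting parameter and the sign are absorbed into
  \<open>h\<close>, so that lower and upper tails are both instances.\<close>

lemma (in prob_space) chernoff_iid:
  assumes [measurable]: "h \<in> borel_measurable M" and B: "0 \<le> B"
    and exp: "(\<integral>\<^sup>+x. ennreal (exp (h x)) \<partial>M) \<le> ennreal B"
  shows "measure (Pi\<^sub>M {..<m} (\<lambda>_. M)) {\<omega> \<in> space (Pi\<^sub>M {..<m} (\<lambda>_. M)). t \<le> (\<Sum>i<m. h (\<omega> i))} \<le> exp (- t) * B ^ m"
proof -
  let ?P = "Pi\<^sub>M {..<m::nat} (\<lambda>_. M)"
  interpret Q: product_prob_space "\<lambda>_. M" "{..<m}" by unfold_locales
  let ?S = "{\<omega> \<in> space ?P. t \<le> (\<Sum>i<m. h (\<omega> i))}"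
  have [measurable]: "?S \<in> sets ?P" by measurable
  have "emeasure ?P ?S = (\<integral>\<^sup>+\<omega>. indicator ?S \<omega> \<partial>?P)" by simp
  also have "\<dots> \<le> (\<integral>\<^sup>+\<omega>. ennreal (exp (- t)) * (\<Prod>i<m. ennreal (exp (h (\<omega> i)))) \<partial>?P)"
  proof (rule nn_integral_mono)
    fix \<omega> assume "\<omega> \<in> space ?P"
    have "ennreal (exp (- t)) * (\<Prod>i<m. ennreal (exp (h (\<omega> i)))) = ennreal (exp ((\<Sum>i<m. h (\<omega> i)) - t))"
      by (simp add: prod_ennreal exp_sum[symmetric] ennreal_mult[symmetric] exp_add[symmetric] exp_diff exp_minus field_simps
            flip: exp_sum)
    then show "indicator ?S \<omega> \<le> ennreal (exp (- t)) * (\<Prod>i<m. ennreal (exp (h (\<omega> i))))"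
      by (auto simp: indicator_def one_ennreal_def[symmetric] intro!: ennreal_leI)
  qed
  also have "\<dots> = ennreal (exp (- t)) * (\<Prod>i<m. \<integral>\<^sup>+x. ennreal (exp (h x)) \<partial>M)"
    by (subst nn_integral_cmult) (auto simp: Q.product_nn_integral_prod[where f = "\<lambda>_ x. ennreal (exp (h x))"])
  also have "\<dots> \<le> ennreal (exp (- t)) * (\<Prod>i<m. ennreal B)"
    by (intro mult_left_mono prod_mono_ennreal exp) auto
  also have "\<dots> = ennreal (exp (- t) * B ^ m)"
    using B by (simp add: ennreal_mult ennreal_power)
  finally show ?thesis
    using B by (simp add: Q.P.emeasure_eq_measure)
qed

text \<open>Multiplying by the Taylor bound for exp x gives (1 - x + x^2/2) (1 + x + x^2/2) = 1 +
  x^4/4 \<ge> 1.\<close>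

lemma exp_minus_le_quadratic:
  assumes "0 \<le> x"
  shows "exp (- x) \<le> 1 - x + x\<^sup>2 / (2::real)"
proof -
  have "1 \<le> 1 + x ^ 4 / 4" by simp
  also have "1 + x ^ 4 / 4 = (1 - x + x\<^sup>2 / 2) * (1 + x + x\<^sup>2 / 2)"
    by (simp add: field_simps power2_eq_square power4_eq_xxxx)
  also have "\<dots> \<le> (1 - x + x\<^sup>2 / 2) * exp x"
  proof (rule mult_left_mono[OF exp_lower_Taylor_quadratic[OF assms]])
    have "0 \<le> (1 - x)\<^sup>2 + 1" by (rule add_nonneg_nonneg) auto
    then show "0 \<le> 1 - x + x\<^sup>2 / 2" by (simp add: power2_eq_square algebra_simps)
  qed
  finally have "1 * exp (- x) \<le> (1 - x + x\<^sup>2 / 2) * exp x * exp (- x)"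
    by (intro mult_right_mono) auto
  then show ?thesis by (simp add: mult.assoc exp_minus)
qed

text \<open>For \<open>f \<ge> 0\<close> the quadratic bound on exp(-l f) holds on the whole range,
  so two moments control the Laplace transform without any truncation. The parameter
  \<open>l\<close> is left to be optimised.\<close>

lemma (in prob_space) lower_tail_iid:
  assumes [measurable]: "f \<in> borel_measurable M" and nonneg: "\<And>x. 0 \<le> f x"
    and int: "integrable M f" "integrable M (\<lambda>x. (f x)\<^sup>2)"
    and s: "s \<le> (\<integral>x. f x \<partial>M)" and V: "(\<integral>x. (f x)\<^sup>2 \<partial>M) \<le> V" and l: "0 < l"
  shows "measure (Pi\<^sub>M {..<m} (\<lambda>_. M)) {\<omega> \<in> space (Pi\<^sub>M {..<m} (\<lambda>_. M)). (\<Sum>i<m. f (\<omega> i)) \<le> real m * (s - t)}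
    \<le> exp (- (real m * (l * t - l\<^sup>2 * V / 2)))"
proof -
  have "(\<integral>\<^sup>+x. ennreal (exp (- l * f x)) \<partial>M) \<le> (\<integral>\<^sup>+x. ennreal (1 - l * f x + (l * f x)\<^sup>2 / 2) \<partial>M)"
    using exp_minus_le_quadratic[of "l * f x" for x] nonneg l by (intro nn_integral_mono ennreal_leI) simp
  also have "\<dots> = ennreal (\<integral>x. 1 - l * f x + (l * f x)\<^sup>2 / 2 \<partial>M)"
  proof (rule nn_integral_eq_integral)
    show "integrable M (\<lambda>x. 1 - l * f x + (l * f x)\<^sup>2 / 2)"
      using int by (simp add: power_mult_distrib)
    have "0 \<le> 1 - l * f x + (l * f x)\<^sup>2 / 2" for x
      using exp_minus_le_quadratic[of "l * f x"] nonneg[of x] l order_trans[OF exp_ge_zero] by simp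
    then show "AE x in M. 0 \<le> 1 - l * f x + (l * f x)\<^sup>2 / 2" by simp
  qed
  also have "(\<integral>x. 1 - l * f x + (l * f x)\<^sup>2 / 2 \<partial>M) = 1 - l * (\<integral>x. f x \<partial>M) + l\<^sup>2 * (\<integral>x. (f x)\<^sup>2 \<partial>M) / 2"
    using int by (simp add: power_mult_distrib prob_space)
  also have "\<dots> \<le> 1 - l * s + l\<^sup>2 * V / 2"
    using s V l by (intro add_mono diff_mono divide_right_mono mult_left_mono) auto
  also have "\<dots> \<le> exp (- l * s + l\<^sup>2 * V / 2)"
    using exp_ge_add_one_self[of "- l * s + l\<^sup>2 * V / 2"] by linarith
  finally have "(\<integral>\<^sup>+x. ennreal (exp (- l * f x)) \<partial>M) \<le> ennreal (exp (- l * s + l\<^sup>2 * V / 2))"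
    by (simp add: ennreal_leI)
  have eq: "((\<Sum>i<m. f (\<omega> i)) \<le> real m * (s - t)) = (- l * (real m * (s - t)) \<le> (\<Sum>i<m. - l * f (\<omega> i)))" for \<omega>
    using l by (simp add: sum_negf sum_distrib_left[symmetric])
  note moment = \<open>(\<integral>\<^sup>+x. ennreal (exp (- l * f x)) \<partial>M) \<le> ennreal (exp (- l * s + l\<^sup>2 * V / 2))\<close>
  from chernoff_iid[OF _ _ moment, of m "- l * (real m * (s - t))"]
  have "measure (Pi\<^sub>M {..<m} (\<lambda>_. M)) {\<omega> \<in> space (Pi\<^sub>M {..<m} (\<lambda>_. M)). - l * (real m * (s - t)) \<le> (\<Sum>i<m. - l * f (\<omega> i))}
    \<le> exp (- (- l * (real m * (s - t)))) * exp (- l * s + l\<^sup>2 * V / 2) ^ m" by simp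
  also have "\<dots> = exp (- (real m * (l * t - l\<^sup>2 * V / 2)))"
    by (simp add: exp_of_nat_mult[symmetric] exp_add[symmetric] algebra_simps)
  finally show ?thesis unfolding eq .
qed

section \<open>Finite nets of volumetric size\<close>

lemma net_from_cells:
  assumes "finite (cell ` T)"
  obtains N where "N \<subseteq> T" "finite N" "card N \<le> card (cell ` T)" "\<And>t. t \<in> T \<Longrightarrow> \<exists>n\<in>N. cell n = cell t"
proof
  \<comment> \<open>One representative per occupied cell. The net thus stays inside
    \<open>T\<close>, so its points are again aligned unit vectors to which the moment bounds
    apply.\<close>
  show "inv_into T cell ` cell ` T \<subseteq> T" by (auto intro: inv_into_into)
  show "finite (inv_into T cell ` cell ` T)" "card (inv_into T cell ` cell ` T) \<le> card (cell ` T)"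
    using assms by (auto intro: card_image_le)
  show "\<exists>n\<in>inv_into T cell ` cell ` T. cell n = cell t" if "t \<in> T" for t
    by (rule bexI[of _ "inv_into T cell (cell t)"]) (use that in \<open>auto intro: f_inv_into_f\<close>)
qed

text \<open>Markov's inequality for the counting measure: weigh each integer point with
  \<open>exp (- \<epsilon> * (\<Sum>i\<in>I. \<bar>z i\<bar>))\<close>.\<close>

lemma card_integer_points_l1:
  fixes \<epsilon> :: real
  assumes I: "finite I" and \<epsilon>: "0 < \<epsilon>" "\<epsilon> \<le> 1"
    and Z: "Z \<subseteq> {z \<in> I \<rightarrow>\<^sub>E (UNIV :: int set). real_of_int (\<Sum>i\<in>I. \<bar>z i\<bar>) \<le> 2 * real (card I) / \<epsilon>}"
  shows "finite Z" "real (card Z) \<le> (32 / \<epsilon>) ^ card I"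
proof -
  define n where "n = card I"
  define K where "K = \<lceil>2 * real n / \<epsilon>\<rceil>"
  define q where "q = exp (- \<epsilon>)"
  have q: "0 < q" "q < 1" using \<epsilon> by (auto simp: q_def)
  have "Z \<subseteq> (I \<rightarrow>\<^sub>E {- K..K})"
  proof
    fix z assume "z \<in> Z"
    then have z: "z \<in> I \<rightarrow>\<^sub>E UNIV" "real_of_int (\<Sum>i\<in>I. \<bar>z i\<bar>) \<le> 2 * real n / \<epsilon>"
      using Z by (auto simp: n_def)
    have "z i \<in> {- K..K}" if "i \<in> I" for i
    proof -
      have "\<bar>z i\<bar> \<le> (\<Sum>i\<in>I. \<bar>z i\<bar>)" using that I by (intro member_le_sum) auto
      also have "\<dots> \<le> K" using z(2) unfolding K_def by linarith
      finally show ?thesis by auto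
    qed
    then show "z \<in> I \<rightarrow>\<^sub>E {- K..K}" using z(1) by (auto simp: PiE_iff)
  qed
  moreover have fin: "finite (I \<rightarrow>\<^sub>E {- K..K})" using I by (intro finite_PiE) auto
  ultimately show "finite Z" by (rule finite_subset)
  have geom: "(\<Sum>k\<in>{- K..K}. q ^ nat \<bar>k\<bar>) \<le> 2 / (1 - q)"
  proof -
    have g: "(\<Sum>k\<in>int ` {..nat K}. q ^ nat \<bar>k\<bar>) \<le> 1 / (1 - q)"
    proof -
      have "(\<Sum>k\<in>int ` {..nat K}. q ^ nat \<bar>k\<bar>) = (\<Sum>k\<le>nat K. q ^ k)"
        by (subst sum.reindex) auto
      also have "\<dots> \<le> (\<Sum>k. q ^ k)" using q by (intro sum_le_suminf) auto
      also have "\<dots> = 1 / (1 - q)" using q by (intro suminf_geometric) auto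
      finally show ?thesis .
    qed
    have neg: "(\<Sum>k\<in>uminus ` int ` {..nat K}. q ^ nat \<bar>k\<bar>) = (\<Sum>k\<in>int ` {..nat K}. q ^ nat \<bar>k\<bar>)"
      by (subst sum.reindex) auto
    have "{- K..K} \<subseteq> int ` {..nat K} \<union> uminus ` int ` {..nat K}"
    proof
      fix k assume k: "k \<in> {- K..K}"
      show "k \<in> int ` {..nat K} \<union> uminus ` int ` {..nat K}"
      proof (cases "0 \<le> k")
        case True
        then have "k = int (nat k)" "nat k \<le> nat K" using k by auto
        then show ?thesis by blast
      next
        case False
        then have "k = - int (nat (- k))" "nat (- k) \<le> nat K" using k by auto
        then show ?thesis by blast
      qed
    qed
    then have "(\<Sum>k\<in>{- K..K}. q ^ nat \<bar>k\<bar>) \<le> (\<Sum>k\<in>int ` {..nat K} \<union> uminus ` int ` {..nat K}. q ^ nat \<bar>k\<bar>)"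
      using q by (intro sum_mono2) auto
    also have "\<dots> \<le> (\<Sum>k\<in>int ` {..nat K}. q ^ nat \<bar>k\<bar>) + (\<Sum>k\<in>uminus ` int ` {..nat K}. q ^ nat \<bar>k\<bar>)"
      using q by (subst sum_Un) (auto intro!: sum_nonneg)
    finally show ?thesis using g neg by simp
  qed
  have weight: "exp (- 2 * real n) \<le> (\<Prod>i\<in>I. q ^ nat \<bar>z i\<bar>)" if "z \<in> Z" for z
  proof -
    have "\<epsilon> * real_of_int (\<Sum>i\<in>I. \<bar>z i\<bar>) \<le> 2 * real n" using Z that \<epsilon> by (auto simp: n_def field_simps)
    moreover have "(\<Prod>i\<in>I. q ^ nat \<bar>z i\<bar>) = exp (- (\<epsilon> * real_of_int (\<Sum>i\<in>I. \<bar>z i\<bar>)))"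
      using I by (simp add: q_def exp_of_nat_mult[symmetric] exp_sum[symmetric] sum_distrib_left sum_negf mult.commute)
    ultimately show ?thesis by simp
  qed
  have "real (card Z) * exp (- 2 * real n) = (\<Sum>z\<in>Z. exp (- 2 * real n))" by simp
  also have "\<dots> \<le> (\<Sum>z\<in>Z. \<Prod>i\<in>I. q ^ nat \<bar>z i\<bar>)" by (intro sum_mono weight)
  also have "\<dots> \<le> (\<Sum>z\<in>I \<rightarrow>\<^sub>E {- K..K}. \<Prod>i\<in>I. q ^ nat \<bar>z i\<bar>)"
    using fin \<open>Z \<subseteq> (I \<rightarrow>\<^sub>E {- K..K})\<close> q by (intro sum_mono2) (auto intro!: prod_nonneg)
  also have "\<dots> = (\<Prod>i\<in>I. \<Sum>k\<in>{- K..K}. q ^ nat \<bar>k\<bar>)"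
    using I by (intro prod_sum_PiE[symmetric]) auto
  also have "\<dots> \<le> (\<Prod>i\<in>I. 2 / (1 - q))" using geom q by (intro prod_mono) (auto intro!: sum_nonneg)
  also have "\<dots> = (2 / (1 - q)) ^ n" by (simp add: n_def)
  \<comment> \<open>For \<epsilon> \<le> 1 one has 1 - exp(-\<epsilon>) \<ge> \<epsilon>/2. Undoing
    the weight costs a further factor exp 2 < 8 per coordinate, hence 32.\<close>
  also have "\<dots> \<le> (4 / \<epsilon>) ^ n"
  proof (intro power_mono)
    have "q \<le> 1 - \<epsilon> + \<epsilon>\<^sup>2 / 2" unfolding q_def using \<epsilon> by (intro exp_minus_le_quadratic) simp
    moreover have "\<epsilon>\<^sup>2 \<le> \<epsilon>" using \<epsilon> mult_left_mono[of \<epsilon> 1 \<epsilon>] by (simp add: power2_eq_square)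
    ultimately have "q \<le> 1 - \<epsilon> / 2" by linarith
    then show "2 / (1 - q) \<le> 4 / \<epsilon>" using \<epsilon> q by (simp add: field_simps)
  qed (use q in auto)
  finally have "real (card Z) * exp (- 2 * real n) * exp (2 * real n) \<le> (4 / \<epsilon>) ^ n * exp (2 * real n)"
    by (intro mult_right_mono) auto
  then have "real (card Z) \<le> (4 / \<epsilon>) ^ n * exp (2 * real n)"
    by (simp add: mult.assoc exp_add[symmetric])
  also have "exp (2 * real n) = exp 2 ^ n" by (simp add: exp_of_nat_mult[symmetric] mult.commute)
  also have "(4 / \<epsilon>) ^ n * exp 2 ^ n = (4 / \<epsilon> * exp 2) ^ n" by (rule power_mult_distrib[symmetric])
  also have "\<dots> \<le> (32 / \<epsilon>) ^ n"
  proof (intro power_mono)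
    have "exp 2 = exp 1 * exp (1::real)" by (simp add: exp_add[symmetric])
    also have "\<dots> \<le> 2.72 * 2.72" using e_less_272 by (intro mult_mono) auto
    finally have "exp 2 \<le> (8::real)" by simp
    then show "4 / \<epsilon> * exp 2 \<le> 32 / \<epsilon>" using \<epsilon> by (simp add: field_simps)
  qed (use \<epsilon> in auto)
  finally show "real (card Z) \<le> (32 / \<epsilon>) ^ card I" by (simp add: n_def)
qed

text \<open>Index of the cell of a grid with side \<epsilon>/sqrt n, where n is the real dimension,
  so that a cell has Euclidean diameter at most \<epsilon>. The restriction makes indices
  extensional and thereby countable by \<open>PiE\<close>.\<close>

definition vcell :: "nat \<Rightarrow> real \<Rightarrow> (nat \<Rightarrow> 'a::euclidean_space) \<Rightarrow> nat \<times> 'a \<Rightarrow> int" where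
  "vcell d \<epsilon> v = restrict (\<lambda>(j, b). \<lfloor>sqrt (real (d * DIM('a))) / \<epsilon> * (v j \<bullet> b)\<rfloor>) ({..<d} \<times> Basis)"

lemma vnorm_sq_Basis:
  "(vnorm d (v :: nat \<Rightarrow> 'a::euclidean_space))\<^sup>2 = (\<Sum>(j, b)\<in>{..<d} \<times> Basis. (v j \<bullet> b)\<^sup>2)"
proof -
  have "(norm (x :: 'a))\<^sup>2 = (\<Sum>b\<in>Basis. (x \<bullet> b)\<^sup>2)" for x
    using euclidean_inner[of x x] unfolding power2_norm_eq_inner by (simp add: power2_eq_square)
  then show ?thesis by (simp add: vnorm_sq sum.cartesian_product[symmetric])
qed

lemma vcell_eqD:
  fixes v w :: "nat \<Rightarrow> 'a::euclidean_space"
  assumes eq: "vcell d \<epsilon> v = vcell d \<epsilon> w" and \<epsilon>: "0 < \<epsilon>" and d: "1 \<le> d"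
  shows "vnorm d (\<lambda>j. v j - w j) \<le> \<epsilon>"
proof -
  define n where "n = d * DIM('a)"
  define h where "h = sqrt (real n) / \<epsilon>"
  have n: "0 < n" using d by (simp add: n_def)
  then have h: "0 < h" using \<epsilon> by (simp add: h_def)
  have "((v j - w j) \<bullet> b)\<^sup>2 \<le> (1 / h)\<^sup>2" if "j < d" "b \<in> Basis" for j b
  proof -
    have "\<lfloor>h * (v j \<bullet> b)\<rfloor> = \<lfloor>h * (w j \<bullet> b)\<rfloor>"
      using fun_cong[OF eq, of "(j, b)"] that by (simp add: vcell_def h_def n_def)
    then have "\<bar>h * (v j \<bullet> b) - h * (w j \<bullet> b)\<bar> \<le> 1" by linarith
    then have "\<bar>h * ((v j - w j) \<bullet> b)\<bar> \<le> 1" by (simp add: inner_diff_left algebra_simps)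
    then have "\<bar>(v j - w j) \<bullet> b\<bar> \<le> 1 / h" using h by (simp add: abs_mult field_simps)
    then show ?thesis using h by (simp add: abs_le_square_iff[symmetric])
  qed
  then have "(vnorm d (\<lambda>j. v j - w j))\<^sup>2 \<le> (\<Sum>(j, b)\<in>{..<d} \<times> (Basis :: 'a set). (1 / h)\<^sup>2)"
    unfolding vnorm_sq_Basis by (intro sum_mono) auto
  also have "\<dots> = real n * (1 / h)\<^sup>2" by (simp add: n_def card_cartesian_product)
  also have "\<dots> = \<epsilon>\<^sup>2" using n \<epsilon> by (simp add: h_def power_divide)
  finally show ?thesis using \<epsilon> by (simp add: abs_le_square_iff[symmetric])
qed

text \<open>Counting cells in a cube would leave a factor sqrt n in the base of the power. Instead
  Cauchy-Schwarz bounds the l1 norm on the unit ball by sqrt n, so the integer index has l1 norm at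
  most n + n/\<epsilon> \<le> 2 n/\<epsilon>, and few integer points satisfy that.\<close>

lemma card_vcells:
  fixes T :: "(nat \<Rightarrow> 'a::euclidean_space) set"
  assumes T: "\<And>v. v \<in> T \<Longrightarrow> vnorm d v \<le> 1" and \<epsilon>: "0 < \<epsilon>" "\<epsilon> \<le> 1" and d: "1 \<le> d"
  shows "finite (vcell d \<epsilon> ` T)" "real (card (vcell d \<epsilon> ` T)) \<le> (32 / \<epsilon>) ^ (d * DIM('a))"
proof -
  define I where "I = {..<d} \<times> (Basis :: 'a set)"
  define n where "n = d * DIM('a)"
  define h where "h = sqrt (real n) / \<epsilon>"
  have I: "finite I" "card I = n" by (auto simp: I_def n_def card_cartesian_product)
  have h: "0 \<le> h" using \<epsilon> by (simp add: h_def)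
  have "vcell d \<epsilon> ` T \<subseteq> {z \<in> I \<rightarrow>\<^sub>E UNIV. real_of_int (\<Sum>i\<in>I. \<bar>z i\<bar>) \<le> 2 * real (card I) / \<epsilon>}"
  proof (rule image_subsetI, rule CollectI, rule conjI)
    fix v assume "v \<in> T"
    define x where "x = (\<lambda>(j, b). v j \<bullet> b)"
    have cell: "vcell d \<epsilon> v i = \<lfloor>h * x i\<rfloor>" if "i \<in> I" for i
      using that by (auto simp: vcell_def I_def h_def n_def x_def)
    show "vcell d \<epsilon> v \<in> I \<rightarrow>\<^sub>E UNIV" by (auto simp: vcell_def I_def)
    have "(\<Sum>i\<in>I. \<bar>x i\<bar>)\<^sup>2 = (\<Sum>i\<in>I. 1 * \<bar>x i\<bar>)\<^sup>2" by simp
    also have "\<dots> \<le> (\<Sum>i\<in>I. 1\<^sup>2) * (\<Sum>i\<in>I. \<bar>x i\<bar>\<^sup>2)" by (rule Cauchy_Schwarz_ineq_sum)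
    also have "(\<Sum>i\<in>I. \<bar>x i\<bar>\<^sup>2) = (vnorm d v)\<^sup>2"
      unfolding vnorm_sq_Basis by (simp add: I_def x_def case_prod_unfold)
    also have "(\<Sum>i\<in>I. 1\<^sup>2) * (vnorm d v)\<^sup>2 \<le> real n * 1"
      using T[OF \<open>v \<in> T\<close>] I by (intro mult_mono) (auto simp: power_le_one)
    finally have "(\<Sum>i\<in>I. \<bar>x i\<bar>)\<^sup>2 \<le> (sqrt (real n))\<^sup>2" by simp
    then have l1: "(\<Sum>i\<in>I. \<bar>x i\<bar>) \<le> sqrt (real n)" by (rule power2_le_imp_le) simp
    have "real_of_int (\<Sum>i\<in>I. \<bar>vcell d \<epsilon> v i\<bar>) = (\<Sum>i\<in>I. \<bar>real_of_int \<lfloor>h * x i\<rfloor>\<bar>)" using cell by simp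
    also have "\<dots> \<le> (\<Sum>i\<in>I. 1 + h * \<bar>x i\<bar>)"
    proof (rule sum_mono)
      fix i
      have "\<bar>real_of_int \<lfloor>h * x i\<rfloor>\<bar> \<le> 1 + \<bar>h * x i\<bar>" by linarith
      then show "\<bar>real_of_int \<lfloor>h * x i\<rfloor>\<bar> \<le> 1 + h * \<bar>x i\<bar>" using h by (simp add: abs_mult)
    qed
    also have "\<dots> = real n + h * (\<Sum>i\<in>I. \<bar>x i\<bar>)" using I by (simp add: sum.distrib sum_distrib_left)
    also have "\<dots> \<le> real n + h * sqrt (real n)" using l1 h by (intro add_left_mono mult_left_mono)
    also have "h * sqrt (real n) = real n / \<epsilon>" by (simp add: h_def)
    also have "real n + real n / \<epsilon> \<le> 2 * real n / \<epsilon>"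
    proof -
      have "real n * 1 \<le> real n * (1 / \<epsilon>)" using \<epsilon> by (intro mult_left_mono) auto
      then show ?thesis by simp
    qed
    finally show "real_of_int (\<Sum>i\<in>I. \<bar>vcell d \<epsilon> v i\<bar>) \<le> 2 * real (card I) / \<epsilon>" by (simp add: I)
  qed
  from card_integer_points_l1[OF I(1) \<epsilon> this]
  show "finite (vcell d \<epsilon> ` T)" "real (card (vcell d \<epsilon> ` T)) \<le> (32 / \<epsilon>) ^ (d * DIM('a))"
    by (auto simp: I n_def)
qed

lemma vector_net:
  fixes T :: "(nat \<Rightarrow> 'a::euclidean_space) set"
  assumes T: "\<And>v. v \<in> T \<Longrightarrow> vnorm d v \<le> 1" and \<epsilon>: "0 < \<epsilon>" "\<epsilon> \<le> 1" and d: "1 \<le> d"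
  obtains N where "N \<subseteq> T" "finite N" "real (card N) \<le> (32 / \<epsilon>) ^ (d * DIM('a))"
    "\<forall>t\<in>T. \<exists>n\<in>N. vnorm d (\<lambda>j. t j - n j) \<le> \<epsilon>"
proof -
  note c = card_vcells[of T, OF T \<epsilon> d]
  obtain N where N: "N \<subseteq> T" "finite N" "card N \<le> card (vcell d \<epsilon> ` T)"
    "\<And>t. t \<in> T \<Longrightarrow> \<exists>n\<in>N. vcell d \<epsilon> n = vcell d \<epsilon> t"
    using net_from_cells[OF c(1)] by blast
  show ?thesis
  proof (rule that[OF N(1,2)])
    show "real (card N) \<le> (32 / \<epsilon>) ^ (d * DIM('a))" using N(3) c(2) by linarith
    show "\<forall>t\<in>T. \<exists>n\<in>N. vnorm d (\<lambda>j. t j - n j) \<le> \<epsilon>"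
    proof
      fix t assume "t \<in> T"
      then obtain n where n: "n \<in> N" "vcell d \<epsilon> n = vcell d \<epsilon> t" using N(4) by blast
      then show "\<exists>n\<in>N. vnorm d (\<lambda>j. t j - n j) \<le> \<epsilon>"
        using vcell_eqD[OF n(2)[symmetric] \<epsilon>(1) d] by blast
    qed
  qed
qed

lemma vector_scalar_net:
  fixes T :: "((nat \<Rightarrow> 'a::euclidean_space) \<times> real) set"
  assumes T: "\<And>v r. (v, r) \<in> T \<Longrightarrow> vnorm d v \<le> 1 \<and> 0 \<le> r \<and> r \<le> R"
    and \<epsilon>: "0 < \<epsilon>" "\<epsilon> \<le> 1" and d: "1 \<le> d" and R: "0 \<le> R"
  obtains N where "N \<subseteq> T" "finite N" "real (card N) \<le> (32 / \<epsilon>) ^ (d * DIM('a)) * (R / \<epsilon> + 1)"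
    "\<forall>(v, r)\<in>T. \<exists>(w, s)\<in>N. vnorm d (\<lambda>j. v j - w j) \<le> \<epsilon> \<and> \<bar>r - s\<bar> \<le> \<epsilon>"
proof -
  define cell where "cell = (\<lambda>(v :: nat \<Rightarrow> 'a, r :: real). (vcell d \<epsilon> v, \<lfloor>r / \<epsilon>\<rfloor>))"
  have "vnorm d v \<le> 1" if "v \<in> fst ` T" for v using T that by auto
  note c = card_vcells[of "fst ` T", OF this \<epsilon> d]
  define K where "K = \<lfloor>R / \<epsilon>\<rfloor>"
  have K: "0 \<le> K" "real_of_int K \<le> R / \<epsilon>" using R \<epsilon> by (auto simp: K_def)
  have sub: "cell ` T \<subseteq> (vcell d \<epsilon> ` fst ` T) \<times> {0..K}"
  proof
    fix x assume "x \<in> cell ` T"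
    then obtain v r where vr: "(v, r) \<in> T" "x = (vcell d \<epsilon> v, \<lfloor>r / \<epsilon>\<rfloor>)" by (auto simp: cell_def)
    have "v \<in> fst ` T" using vr(1) by (rule image_eqI[rotated]) simp
    moreover have "0 \<le> \<lfloor>r / \<epsilon>\<rfloor>" "\<lfloor>r / \<epsilon>\<rfloor> \<le> K"
      using T[OF vr(1)] \<epsilon> by (auto simp: K_def intro!: floor_mono divide_right_mono)
    ultimately show "x \<in> (vcell d \<epsilon> ` fst ` T) \<times> {0..K}" using vr(2) by simp
  qed
  then have fin: "finite (cell ` T)" by (rule finite_subset) (use c in auto)
  have "card (cell ` T) \<le> card ((vcell d \<epsilon> ` fst ` T) \<times> {0..K})"
    using sub c by (intro card_mono) auto
  then have "real (card (cell ` T)) \<le> real (card ((vcell d \<epsilon> ` fst ` T) \<times> {0..K}))" by (rule of_nat_mono)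
  also have "\<dots> = real (card (vcell d \<epsilon> ` fst ` T)) * (real_of_int K + 1)"
    using K by (simp add: card_cartesian_product)
  also have "\<dots> \<le> (32 / \<epsilon>) ^ (d * DIM('a)) * (R / \<epsilon> + 1)"
    using c K \<epsilon> by (intro mult_mono) auto
  finally have card: "real (card (cell ` T)) \<le> (32 / \<epsilon>) ^ (d * DIM('a)) * (R / \<epsilon> + 1)" .
  obtain N where N: "N \<subseteq> T" "finite N" "card N \<le> card (cell ` T)" "\<And>t. t \<in> T \<Longrightarrow> \<exists>n\<in>N. cell n = cell t"
    using net_from_cells[OF fin] by blast
  show ?thesis
  proof (rule that[OF N(1,2)])
    show "real (card N) \<le> (32 / \<epsilon>) ^ (d * DIM('a)) * (R / \<epsilon> + 1)" using N(3) card by linarith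
    show "\<forall>(v, r)\<in>T. \<exists>(w, s)\<in>N. vnorm d (\<lambda>j. v j - w j) \<le> \<epsilon> \<and> \<bar>r - s\<bar> \<le> \<epsilon>"
    proof (clarify)
      fix v r assume "(v, r) \<in> T"
      then obtain w s where ws: "(w, s) \<in> N" "vcell d \<epsilon> v = vcell d \<epsilon> w" "\<lfloor>r / \<epsilon>\<rfloor> = \<lfloor>s / \<epsilon>\<rfloor>"
        using N(4)[of "(v, r)"] by (auto simp: cell_def split: prod.splits)
      have "\<bar>r / \<epsilon> - s / \<epsilon>\<bar> \<le> 1" using ws(3) by linarith
      then have "\<bar>r - s\<bar> \<le> \<epsilon>" using \<epsilon> by (simp add: diff_divide_distrib[symmetric] abs_divide)
      then show "\<exists>(w, s)\<in>N. vnorm d (\<lambda>j. v j - w j) \<le> \<epsilon> \<and> \<bar>r - s\<bar> \<le> \<epsilon>"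
        using ws vcell_eqD[OF ws(2) \<epsilon>(1) d] by auto
    qed
  qed
qed

section \<open>Operator norm from a coarse net\<close>

lemma dot_diff: "dot d a (\<lambda>j. v j - w j) = dot d a v - dot d a w"
  by (simp add: dot_def algebra_simps sum_subtractf)

lemma dot_scale: "dot d a (\<lambda>j. c * v j) = c * dot d a v"
  by (simp add: dot_def sum_distrib_left algebra_simps)

lemma norm_le_vnorm: "j < d \<Longrightarrow> norm (v j) \<le> vnorm d v"
  unfolding vnorm_def by (rule member_le_L2_set) auto

lemma vnorm_scale: "vnorm d (\<lambda>j. c * v j) = norm c * vnorm d (v :: nat \<Rightarrow> 'a::real_normed_field)"
  by (simp add: vnorm_def norm_mult L2_set_right_distrib)

text \<open>The supremum \<open>S\<close> over the unit ball satisfies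
  \<open>S \<le> B + S / 2\<close>, since any vector is a net point plus a remainder of norm at most
  1/2.\<close>

lemma operator_norm_from_net:
  fixes a :: "nat \<Rightarrow> nat \<Rightarrow> 'a::real_normed_field"
  assumes net: "\<forall>v\<in>{v. vnorm d v \<le> 1}. \<exists>n\<in>N. vnorm d (\<lambda>j. v j - n j) \<le> 1 / 2"
    and N: "\<And>n. n \<in> N \<Longrightarrow> L2_set (\<lambda>i. norm (dot d (a i) n)) {..<m} \<le> B"
  shows "L2_set (\<lambda>i. norm (dot d (a i) v)) {..<m} \<le> 2 * B * vnorm d v"
proof -
  define f where "f v = L2_set (\<lambda>i. norm (dot d (a i) v)) {..<m}" for v
  have f_scale: "f (\<lambda>j. c * v j) = norm c * f v" for c v
    by (simp add: f_def dot_scale norm_mult L2_set_right_distrib)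
  have f_diff: "f v \<le> f w + f (\<lambda>j. v j - w j)" for v w
  proof -
    have "norm (dot d (a i) v) \<le> norm (dot d (a i) w) + norm (dot d (a i) (\<lambda>j. v j - w j))" for i
      using norm_triangle_sub[of "dot d (a i) v" "dot d (a i) w"] by (simp add: dot_diff)
    then have "f v \<le> L2_set (\<lambda>i. norm (dot d (a i) w) + norm (dot d (a i) (\<lambda>j. v j - w j))) {..<m}"
      unfolding f_def by (intro L2_set_mono) auto
    also have "\<dots> \<le> f w + f (\<lambda>j. v j - w j)"
      unfolding f_def by (rule L2_set_triangle_ineq)
    finally show ?thesis .
  qed
  have f_scaled: "f v \<le> norm c * K" if "\<And>w. vnorm d w \<le> 1 \<Longrightarrow> f w \<le> K" "vnorm d v \<le> norm c" "c \<noteq> 0" for c :: 'a and v K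
  proof -
    have "vnorm d (\<lambda>j. inverse c * v j) \<le> 1"
      unfolding vnorm_scale norm_inverse using that by (simp add: field_simps)
    then have "f (\<lambda>j. inverse c * v j) \<le> K" by (rule that(1))
    then have "inverse (norm c) * f v \<le> K" by (simp only: f_scale norm_inverse)
    then show ?thesis using that(3) by (simp add: inverse_eq_divide pos_divide_le_eq mult.commute)
  qed
  define U where "U = {v :: nat \<Rightarrow> 'a. vnorm d v \<le> 1}"
  have U0: "(\<lambda>_. 0) \<in> U" by (simp add: U_def vnorm_def L2_set_def)
  \<comment> \<open>A crude bound, to know that \<open>S\<close> is a genuine supremum before the
    inequality for it is solved.\<close>
  have "f v \<le> L2_set (\<lambda>i. \<Sum>j<d. norm (a i j)) {..<m}" if "v \<in> U" for v
  proof -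
    have "norm (dot d (a i) v) \<le> (\<Sum>j<d. norm (a i j))" for i
    proof -
      have "norm (dot d (a i) v) \<le> (\<Sum>j<d. norm (a i j * v j))" unfolding dot_def by (rule norm_sum)
      also have "\<dots> \<le> (\<Sum>j<d. norm (a i j) * 1)"
        unfolding norm_mult using that norm_le_vnorm[of _ d v]
        by (intro sum_mono mult_left_mono) (auto simp: U_def intro: order_trans)
      finally show ?thesis by simp
    qed
    then show ?thesis unfolding f_def by (intro L2_set_mono) auto
  qed
  then have bdd: "bdd_above (f ` U)" by (auto simp: bdd_above_def)
  define S where "S = (SUP v\<in>U. f v)"
  have S: "f v \<le> S" if "vnorm d v \<le> 1" for v
    unfolding S_def using bdd that by (intro cSUP_upper) (auto simp: U_def)
  have "S \<le> B + S / 2"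
  proof -
    have "f v \<le> B + S / 2" if v: "v \<in> U" for v
    proof -
      obtain n where n: "n \<in> N" "vnorm d (\<lambda>j. v j - n j) \<le> 1 / 2" using net v by (auto simp: U_def)
      have "f (\<lambda>j. v j - n j) \<le> norm (1 / 2 :: 'a) * S"
        using n S by (intro f_scaled) (auto simp: norm_divide)
      then show ?thesis using f_diff[of v n] N[OF n(1)] by (simp add: f_def[symmetric] norm_divide)
    qed
    then have "(SUP v\<in>U. f v) \<le> B + S / 2" using U0 by (intro cSUP_least) auto
    then show ?thesis by (simp add: S_def)
  qed
  then have SB: "S \<le> 2 * B" by simp
  show ?thesis
  proof (cases "vnorm d v = 0")
    case True
    \<comment> \<open>A vector of seminorm 0 cannot be normalised, so it is scaled by every
      \<open>t > 0\<close> and \<open>t\<close> tends to 0.\<close>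
    then have "f v \<le> norm (of_real t :: 'a) * S" if "t > 0" for t :: real
      using S that by (intro f_scaled) auto
    then have le: "f v \<le> t * S" if "t > 0" for t :: real using that by simp
    have S0: "0 \<le> S" using S[of "\<lambda>_. 0"] by (simp add: f_def vnorm_def dot_def L2_set_def)
    have "f v \<le> 0"
    proof (rule field_le_epsilon)
      fix e :: real assume "0 < e"
      then have "f v \<le> e / (S + 1) * S" using S0 by (intro le) auto
      also have "\<dots> \<le> 0 + e" using S0 \<open>0 < e\<close> by (simp add: field_simps)
      finally show "f v \<le> 0 + e" .
    qed
    then show ?thesis using True by (simp add: f_def)
  next
    case False
    then have "f v \<le> norm (of_real (vnorm d v) :: 'a) * S"
      using S by (intro f_scaled) auto
    also have "\<dots> \<le> 2 * B * vnorm d v" using mult_right_mono[OF SB vnorm_nonneg[of d v]] by (simp add: mult.commute)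
    finally show ?thesis by (simp add: f_def)
  qed
qed

subsection \<open>Uniform lower bound\<close>

lemma L2_set_le_add:
  assumes "\<And>i. i \<in> I \<Longrightarrow> 0 \<le> x i" "\<And>i. i \<in> I \<Longrightarrow> x i \<le> y i + z i"
  shows "L2_set x I \<le> L2_set y I + L2_set z I"
proof -
  have "L2_set x I \<le> L2_set (\<lambda>i. y i + z i) I" using assms by (intro L2_set_mono)
  also have "\<dots> \<le> L2_set y I + L2_set z I" by (rule L2_set_triangle_ineq)
  finally show ?thesis .
qed

lemma (in prob_space) prob_UN_le:
  assumes "finite I" "\<And>i. i \<in> I \<Longrightarrow> A i \<in> events" "\<And>i. i \<in> I \<Longrightarrow> prob (A i) \<le> p"
  shows "prob (\<Union>i\<in>I. A i) \<le> real (card I) * p"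
proof -
  have "prob (\<Union>i\<in>I. A i) \<le> (\<Sum>i\<in>I. prob (A i))"
    using assms by (intro finite_measure_subadditive_finite) auto
  also have "\<dots> \<le> (\<Sum>i\<in>I. p)" by (intro sum_mono assms)
  finally show ?thesis by simp
qed

context gaussian_law
begin

abbreviation matrices :: "nat \<Rightarrow> nat \<Rightarrow> (nat \<Rightarrow> nat \<Rightarrow> 'a) measure" where
  "matrices m d \<equiv> Pi\<^sub>M {..<m} (\<lambda>_. rows d)"

text \<open>Stated for a general \<open>L\<close> to cover both \<open>amplitude_gap\<close> and
  \<open>limit_gap\<close>. Domination by a Gaussian modulus bounds the variance of the square of
  \<open>L\<close> through a fourth moment that does not depend on \<open>d\<close>.\<close>

lemma lower_tail_rows:
  assumes [measurable]: "L \<in> borel_measurable (rows d)" and L: "\<And>a. 0 \<le> L a" "\<And>a. L a \<le> norm (dot d a v)"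
    and v: "vnorm d v \<le> 1" and E: "1 - \<kappa> \<le> (\<integral>a. (L a)\<^sup>2 \<partial>rows d)" and \<delta>: "0 < \<delta>"
  shows "measure (matrices m d)
      {\<omega> \<in> space (matrices m d). (\<Sum>i<m. (L (\<omega> i))\<^sup>2) \<le> real m * ((1 - \<kappa>) * (1 - \<delta> / 2))}
    \<le> exp (- (real m * \<delta>\<^sup>2 / 12800))"
proof -
  interpret R: prob_space "rows d" by (rule prob_space_rows)
  define s where "s = 1 - \<kappa>"
  have s: "1 / 5 \<le> s" using \<kappa>_bounds by (simp add: s_def)
  have L4: "(L a) ^ 4 \<le> (norm (dot d a v)) ^ 4" for a using L by (intro power_mono)
  have int4: "integrable (rows d) (\<lambda>a. (L a) ^ 4)"
    by (rule Bochner_Integration.integrable_bound[OF rows_fourth_moment(1)[OF v]]) (use L4 in auto)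
  have int2: "integrable (rows d) (\<lambda>a. (L a)\<^sup>2)"
  proof (rule Bochner_Integration.integrable_bound)
    show "integrable (rows d) (\<lambda>a. 1 + (L a) ^ 4)" using int4 by simp
    have "t\<^sup>2 \<le> 1 + t ^ 4" for t :: real
    proof -
      have "0 \<le> (1 - t\<^sup>2)\<^sup>2 + t\<^sup>2" by simp
      then show ?thesis by (simp add: power2_eq_square power4_eq_xxxx algebra_simps)
    qed
    then show "AE a in rows d. norm ((L a)\<^sup>2) \<le> norm (1 + (L a) ^ 4)" by simp
  qed simp
  have "(\<integral>a. (L a) ^ 4 \<partial>rows d) \<le> (\<integral>a. (norm (dot d a v)) ^ 4 \<partial>rows d)"
    by (intro integral_mono int4 rows_fourth_moment(1)[OF v] L4)
  also have "\<dots> \<le> 64" by (rule rows_fourth_moment(2)[OF v])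
  finally have E4: "(\<integral>a. ((L a)\<^sup>2)\<^sup>2 \<partial>rows d) \<le> 64" by simp
  \<comment> \<open>With deviation t = s \<delta>/2 and V = 64 the exponent l t - l^2 V/2 is largest
    at l = t/V = s \<delta>/128, with value s^2 \<delta>^2/512; then s \<ge> 1/5 yields
    12800.\<close>
  have "measure (matrices m d)
      {\<omega> \<in> space (matrices m d). (\<Sum>i<m. (L (\<omega> i))\<^sup>2) \<le> real m * (s - s * \<delta> / 2)}
    \<le> exp (- (real m * ((s * \<delta> / 128) * (s * \<delta> / 2) - (s * \<delta> / 128)\<^sup>2 * 64 / 2)))"
    using E E4 int2 int4 s \<delta> by (intro R.lower_tail_iid) (auto simp: s_def)
  also have "\<dots> \<le> exp (- (real m * \<delta>\<^sup>2 / 12800))"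
  proof -
    have "(s * \<delta> / 128) * (s * \<delta> / 2) - (s * \<delta> / 128)\<^sup>2 * 64 / 2 = s\<^sup>2 * (\<delta>\<^sup>2 / 512)"
      by (simp add: power2_eq_square)
    moreover have "(1 / 5)\<^sup>2 * (\<delta>\<^sup>2 / 512) \<le> s\<^sup>2 * (\<delta>\<^sup>2 / 512)"
      using s by (intro mult_right_mono power_mono) auto
    moreover have "(1 / 5)\<^sup>2 * (\<delta>\<^sup>2 / 512) = \<delta>\<^sup>2 / 12800" by (simp add: power2_eq_square)
    ultimately have "\<delta>\<^sup>2 / 12800 \<le> (s * \<delta> / 128) * (s * \<delta> / 2) - (s * \<delta> / 128)\<^sup>2 * 64 / 2"
      by linarith
    from mult_left_mono[OF this, of "real m"] show ?thesis by simp
  qed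
  finally show ?thesis by (simp add: s_def algebra_simps)
qed

lemma upper_tail_rows:
  assumes v: "vnorm d v \<le> 1"
  shows "measure (matrices m d)
      {\<omega> \<in> space (matrices m d). 4 * real m \<le> (\<Sum>i<m. (norm (dot d (\<omega> i) v))\<^sup>2 / 4)}
    \<le> exp (- 3 * real m)"
proof -
  interpret R: prob_space "rows d" by (rule prob_space_rows)
  have "measure (matrices m d)
      {\<omega> \<in> space (matrices m d). 4 * real m \<le> (\<Sum>i<m. (norm (dot d (\<omega> i) v))\<^sup>2 / 4)}
    \<le> exp (- (4 * real m)) * 2 ^ m"
    using rows_exp_moment[OF v] by (intro R.chernoff_iid) auto
  also have "\<dots> \<le> exp (- (4 * real m)) * exp 1 ^ m"
    using exp_ge_add_one_self[of "1::real"] by (intro mult_left_mono power_mono) auto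
  also have "\<dots> = exp (- 3 * real m)"
    by (simp add: exp_of_nat_mult[symmetric] exp_add[symmetric])
  finally show ?thesis .
qed

definition amplitude_gap :: "nat \<Rightarrow> (nat \<Rightarrow> 'a) \<Rightarrow> (nat \<Rightarrow> 'a) \<Rightarrow> real \<Rightarrow> (nat \<Rightarrow> 'a) \<Rightarrow> real" where
  "amplitude_gap d e v r a = \<bar>norm (dot d a v + of_real r * dot d a e) - r * norm (dot d a e)\<bar>"

text \<open>For a unit vector \<open>e\<close>, the inner product of v + r e with \<open>e\<close>
  is \<alpha> + r; so this says that \<open>x\<close> and \<open>x0\<close> have a nonnegative real
  inner product.\<close>

definition aligned :: "nat \<Rightarrow> (nat \<Rightarrow> 'a) \<Rightarrow> (nat \<Rightarrow> 'a) \<Rightarrow> real \<Rightarrow> bool" where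
  "aligned d e v r \<longleftrightarrow> (\<exists>\<alpha>. (\<Sum>j<d. v j * cj (e j)) = of_real \<alpha> \<and> 0 \<le> \<alpha> + r)"

definition bounded_below :: "nat \<Rightarrow> nat \<Rightarrow> (nat \<Rightarrow> 'a) \<Rightarrow> real \<Rightarrow> (nat \<Rightarrow> nat \<Rightarrow> 'a) \<Rightarrow> bool" where
  "bounded_below m d e \<delta> \<omega> \<longleftrightarrow> (\<forall>v r. vnorm d v = 1 \<and> 0 \<le> r \<and> aligned d e v r \<longrightarrow>
    sqrt (real m) * (sqrt (1 - \<kappa>) * (1 - \<delta>)) \<le> L2_set (\<lambda>i. amplitude_gap d e v r (\<omega> i)) {..<m})"

lemma measurable_amplitude_gap [measurable]: "amplitude_gap d e v r \<in> borel_measurable (rows d)"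
  unfolding amplitude_gap_def[abs_def] by measurable

lemma amplitude_gap_bounds:
  assumes "0 \<le> r"
  shows "0 \<le> amplitude_gap d e v r a" "amplitude_gap d e v r a \<le> norm (dot d a v)"
  using assms norm_triangle_ineq3[of "dot d a v + of_real r * dot d a e" "of_real r * dot d a e"]
  by (auto simp: amplitude_gap_def norm_mult)

text \<open>The factor 2 arises because \<open>r\<close> enters both amplitudes.\<close>

lemma amplitude_gap_diff:
  "amplitude_gap d e w s a \<le> amplitude_gap d e v r a + (norm (dot d a (\<lambda>j. v j - w j)) + 2 * \<bar>r - s\<bar> * norm (dot d a e))"
proof -
  have "\<bar>norm (dot d a v + of_real r * dot d a e) - norm (dot d a w + of_real s * dot d a e)\<bar> \<le>
    norm (dot d a (\<lambda>j. v j - w j) + of_real (r - s) * dot d a e)"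
    using norm_triangle_ineq3[of "dot d a v + of_real r * dot d a e" "dot d a w + of_real s * dot d a e"]
    by (simp add: dot_diff algebra_simps)
  also have "\<dots> \<le> norm (dot d a (\<lambda>j. v j - w j)) + \<bar>r - s\<bar> * norm (dot d a e)"
    by (intro norm_triangle_le) (simp add: norm_mult flip: of_real_diff)
  finally have 1: "\<bar>norm (dot d a v + of_real r * dot d a e) - norm (dot d a w + of_real s * dot d a e)\<bar>
    \<le> norm (dot d a (\<lambda>j. v j - w j)) + \<bar>r - s\<bar> * norm (dot d a e)" .
  have 2: "\<bar>r * norm (dot d a e) - s * norm (dot d a e)\<bar> = \<bar>r - s\<bar> * norm (dot d a e)"
    by (simp add: abs_mult flip: left_diff_distrib)
  have "\<bar>B - S\<bar> \<le> \<bar>A - T\<bar> + (X + 2 * Y)" if "\<bar>A - B\<bar> \<le> X + Y" "\<bar>T - S\<bar> = Y" for A B T S X Y :: real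
    using that by linarith
  from this[OF 1 2] show ?thesis by (simp add: amplitude_gap_def mult.assoc)
qed

text \<open>The deterministic half of the argument: whatever the law, net bounds at level 1 -
  \<delta>/2 and an operator norm bound imply the bound at level 1 - \<delta> everywhere.\<close>

lemma good_event:
  fixes R \<delta> :: real and \<omega> :: "nat \<Rightarrow> nat \<Rightarrow> 'a"
  assumes \<delta>: "0 < \<delta>" "\<delta> < 1 / 20" and R: "0 < R" and e: "vnorm d e = 1"
    and N0: "\<forall>v\<in>{v. vnorm d v \<le> 1}. \<exists>n\<in>N0. vnorm d (\<lambda>j. v j - n j) \<le> 1 / 2"
    and NA: "\<And>v r. vnorm d v = 1 \<Longrightarrow> 0 \<le> r \<Longrightarrow> r \<le> R \<Longrightarrow> aligned d e v r \<Longrightarrow>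
      \<exists>(w, s)\<in>NA. vnorm d (\<lambda>j. v j - w j) \<le> \<delta> / 200 \<and> \<bar>r - s\<bar> \<le> \<delta> / 200"
    and NB: "\<And>v r. vnorm d v = 1 \<Longrightarrow> aligned d e v r \<Longrightarrow> \<exists>w\<in>NB. vnorm d (\<lambda>j. v j - w j) \<le> \<delta> / 200"
    and G0: "\<And>n. n \<in> N0 \<Longrightarrow> (\<Sum>i<m. (norm (dot d (\<omega> i) n))\<^sup>2 / 4) < 4 * real m"
    and GA: "\<And>w s. (w, s) \<in> NA \<Longrightarrow> real m * ((1 - \<kappa>) * (1 - \<delta> / 2)) < (\<Sum>i<m. (amplitude_gap d e w s (\<omega> i))\<^sup>2)"
    and GB: "\<And>w. w \<in> NB \<Longrightarrow> real m * ((1 - \<kappa>) * (1 - \<delta> / 2)) < (\<Sum>i<m. (limit_gap R (dot d (\<omega> i) e) (dot d (\<omega> i) w))\<^sup>2)"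
    and v: "vnorm d v = 1" and r: "0 \<le> r" and al: "aligned d e v r"
  shows "sqrt (real m) * (sqrt (1 - \<kappa>) * (1 - \<delta>)) \<le> L2_set (\<lambda>i. amplitude_gap d e v r (\<omega> i)) {..<m}"
proof -
  define M where "M = sqrt (real m)"
  define q where "q = sqrt (1 - \<kappa>)"
  have M: "0 \<le> M" by (simp add: M_def)
  \<comment> \<open>A rational lower bound for \<open>q\<close>: 0.44^2 = 0.1936 and 1 - \<kappa>
    \<ge> 1/5.\<close>
  have "(0.44::real)\<^sup>2 \<le> 1 - \<kappa>" using \<kappa>_bounds by (simp add: power2_eq_square)
  then have q: "0.44 \<le> q" unfolding q_def by (rule real_le_rsqrt)
  \<comment> \<open>The sums over \<open>N0\<close> give norm at most 4 sqrt m on the net; passing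
    to all vectors doubles it.\<close>
  have op: "L2_set (\<lambda>i. norm (dot d (\<omega> i) w)) {..<m} \<le> 8 * M * vnorm d w" for w
  proof -
    have "L2_set (\<lambda>i. norm (dot d (\<omega> i) n)) {..<m} \<le> 4 * M" if "n \<in> N0" for n
    proof -
      have "(\<Sum>i<m. (norm (dot d (\<omega> i) n))\<^sup>2) \<le> 16 * real m"
        using G0[OF that] by (simp add: sum_divide_distrib[symmetric])
      then have "L2_set (\<lambda>i. norm (dot d (\<omega> i) n)) {..<m} \<le> sqrt (16 * real m)"
        unfolding L2_set_def by (rule real_sqrt_le_mono)
      also have "\<dots> = 4 * M" by (simp add: real_sqrt_mult M_def)
      finally show ?thesis .
    qed
    from operator_norm_from_net[OF N0 this] show ?thesis by simp
  qed
  have root: "M * (q * (1 - \<delta> / 2)) \<le> L2_set f {..<m}"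
    if "real m * ((1 - \<kappa>) * (1 - \<delta> / 2)) < (\<Sum>i<m. (f i)\<^sup>2)" for f :: "nat \<Rightarrow> real"
  proof -
    have "(1 - \<delta> / 2)\<^sup>2 \<le> 1 - \<delta> / 2" using \<delta> by (simp add: power2_eq_square mult_left_le)
    then have "(M * (q * (1 - \<delta> / 2)))\<^sup>2 \<le> real m * ((1 - \<kappa>) * (1 - \<delta> / 2))"
      using \<kappa>_pos by (simp add: power_mult_distrib M_def q_def mult_left_mono)
    then show ?thesis unfolding L2_set_def using that by (intro real_le_rsqrt) linarith
  qed
  \<comment> \<open>The worst error, for \<open>r \<le> R\<close>, is 8 M from \<open>v\<close> plus
    16 M from \<open>r\<close>, each times the mesh \<delta>/200. This totals 0.12 M \<delta>,
    within the allowance q M \<delta>/2 \<ge> 0.22 M \<delta>.\<close>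
  have slack: "M * (q * (1 - \<delta>)) \<le> x" if "M * (q * (1 - \<delta> / 2)) \<le> x + 24 * M * (\<delta> / 200)" for x
  proof -
    have "\<delta> * 0.44 \<le> \<delta> * q" using q \<delta> by (intro mult_left_mono) auto
    then have "24 * (\<delta> / 200) \<le> q * (\<delta> / 2)" using \<delta> by (simp add: field_simps)
    then have "M * (24 * (\<delta> / 200)) \<le> M * (q * (\<delta> / 2))" using M by (rule mult_left_mono)
    moreover have "M * (q * (1 - \<delta>)) = M * (q * (1 - \<delta> / 2)) - M * (q * (\<delta> / 2))"
      by (simp add: algebra_simps)
    ultimately show ?thesis using that by (simp add: mult_ac)
  qed
  have "M * (q * (1 - \<delta>)) \<le> L2_set (\<lambda>i. amplitude_gap d e v r (\<omega> i)) {..<m}"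
  proof (cases "r \<le> R")
    case True
    obtain w s where ws: "(w, s) \<in> NA" "vnorm d (\<lambda>j. v j - w j) \<le> \<delta> / 200" "\<bar>r - s\<bar> \<le> \<delta> / 200"
      using NA[OF v r True al] by auto
    have "M * (q * (1 - \<delta> / 2)) \<le> L2_set (\<lambda>i. amplitude_gap d e w s (\<omega> i)) {..<m}"
      by (rule root[OF GA[OF ws(1)]])
    also have "\<dots> \<le> L2_set (\<lambda>i. amplitude_gap d e v r (\<omega> i)) {..<m} +
        L2_set (\<lambda>i. norm (dot d (\<omega> i) (\<lambda>j. v j - w j)) + 2 * \<bar>r - s\<bar> * norm (dot d (\<omega> i) e)) {..<m}"
      by (rule L2_set_le_add[OF _ amplitude_gap_diff]) (simp add: amplitude_gap_def)
    also have "L2_set (\<lambda>i. norm (dot d (\<omega> i) (\<lambda>j. v j - w j)) + 2 * \<bar>r - s\<bar> * norm (dot d (\<omega> i) e)) {..<m} \<le>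
        L2_set (\<lambda>i. norm (dot d (\<omega> i) (\<lambda>j. v j - w j))) {..<m} + L2_set (\<lambda>i. 2 * \<bar>r - s\<bar> * norm (dot d (\<omega> i) e)) {..<m}"
      by (rule L2_set_triangle_ineq)
    also have "L2_set (\<lambda>i. 2 * \<bar>r - s\<bar> * norm (dot d (\<omega> i) e)) {..<m} = 2 * \<bar>r - s\<bar> * L2_set (\<lambda>i. norm (dot d (\<omega> i) e)) {..<m}"
      by (simp add: L2_set_right_distrib)
    also have "L2_set (\<lambda>i. norm (dot d (\<omega> i) (\<lambda>j. v j - w j))) {..<m} \<le> 8 * M * (\<delta> / 200)"
      using op[of "\<lambda>j. v j - w j"] ws(2) M by (meson mult_left_mono mult_nonneg_nonneg order_trans zero_le_numeral)
    also have "2 * \<bar>r - s\<bar> * L2_set (\<lambda>i. norm (dot d (\<omega> i) e)) {..<m} \<le> (2 * (\<delta> / 200)) * (8 * M)"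
      using op[of e] ws(3) \<delta> by (intro mult_mono) (auto simp: e)
    finally show ?thesis by (intro slack) (simp add: algebra_simps)
  next
    case False
    obtain w where w: "w \<in> NB" "vnorm d (\<lambda>j. v j - w j) \<le> \<delta> / 200"
      using NB[OF v al] by auto
    have "M * (q * (1 - \<delta> / 2)) \<le> L2_set (\<lambda>i. limit_gap R (dot d (\<omega> i) e) (dot d (\<omega> i) w)) {..<m}"
      by (rule root[OF GB[OF w(1)]])
    also have "\<dots> \<le> L2_set (\<lambda>i. amplitude_gap d e v r (\<omega> i)) {..<m} + L2_set (\<lambda>i. norm (dot d (\<omega> i) (\<lambda>j. v j - w j))) {..<m}"
    proof (rule L2_set_le_add)
      fix i
      have "limit_gap R (dot d (\<omega> i) e) (dot d (\<omega> i) v) \<le> amplitude_gap d e v r (\<omega> i)"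
        using limit_gap_le[of R r "dot d (\<omega> i) e" "dot d (\<omega> i) v"] False R
        by (simp add: amplitude_gap_def scaleR_conv_of_real)
      then show "limit_gap R (dot d (\<omega> i) e) (dot d (\<omega> i) w) \<le>
        amplitude_gap d e v r (\<omega> i) + norm (dot d (\<omega> i) (\<lambda>j. v j - w j))"
        using limit_gap_diff[of R "dot d (\<omega> i) e" "dot d (\<omega> i) v" "dot d (\<omega> i) w"]
        by (simp add: dot_diff)
    qed simp
    also have "L2_set (\<lambda>i. norm (dot d (\<omega> i) (\<lambda>j. v j - w j))) {..<m} \<le> 8 * M * (\<delta> / 200)"
      using op[of "\<lambda>j. v j - w j"] w(2) M by (meson mult_left_mono mult_nonneg_nonneg order_trans zero_le_numeral)
    finally have "M * (q * (1 - \<delta> / 2)) \<le> L2_set (\<lambda>i. amplitude_gap d e v r (\<omega> i)) {..<m} + 8 * M * (\<delta> / 200)" by simp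
    moreover have "8 * M * (\<delta> / 200) \<le> 24 * M * (\<delta> / 200)"
      using M \<delta> by (intro mult_right_mono) auto
    ultimately show ?thesis by (intro slack) linarith
  qed
  then show ?thesis by (simp add: M_def q_def)
qed

text \<open>A union bound over three nets: pairs (\<open>v\<close>, \<open>r\<close>) with
  \<open>r \<le> R\<close>, directions alone for larger \<open>r\<close>, and the coarse net for the
  operator norm. As \<open>bounded_below\<close> ranges over uncountably many vectors, its failure
  is enclosed in a measurable set \<open>Bad\<close> rather than measured itself.\<close>

theorem amplitude_lower_bound:
  obtains C c where "0 < C" "0 < c"
    "\<forall>(m::nat) d \<delta> e. 1 \<le> d \<and> 0 < \<delta> \<and> \<delta> < 1 / 20 \<and> vnorm d e = 1 \<and>
        C * ln (1 / \<delta>) * (1 / \<delta>\<^sup>2) * real d \<le> real m \<longrightarrow>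
      (\<exists>Bad \<in> sets (matrices m d).
        measure (matrices m d) Bad \<le> 2 * exp (- c * \<delta>\<^sup>2 * real m) \<and>
        (\<forall>\<omega> \<in> space (matrices m d) - Bad. bounded_below m d e \<delta> \<omega>))"
proof -
  obtain R where R: "0 < R" and gap: "\<And>d e v \<alpha>. vnorm d e = 1 \<Longrightarrow> vnorm d v = 1 \<Longrightarrow>
      (\<Sum>j<d. v j * cj (e j)) = of_real \<alpha> \<Longrightarrow> 1 - \<kappa> \<le> (\<integral>a. (limit_gap R (dot d a e) (dot d a v))\<^sup>2 \<partial>rows d)"
    using rows_limit_gap_moment by blast
  \<comment> \<open>The logarithm of the total net size per unit of ln(1/\<delta>) d. Here 6400 = 32
    * 200 stems from the mesh \<delta>/200, and 200 R + 3 from the R/\<epsilon> + 1 values of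
    \<open>r\<close> plus one unit for each of the other nets.\<close>
  define K where "K = real DIM('a) * (ln 6400 + 1) + ln (200 * R + 3) + 1"
  have K: "0 < K" using R by (auto simp: K_def intro!: add_nonneg_pos)
  \<comment> \<open>Half of the exponent \<delta>^2 m/12800 pays for the union bound; the other half
    remains as the rate.\<close>
  show ?thesis
  proof (rule that[of "25600 * K" "1 / 25600"], goal_cases)
    case 1 then show ?case using K by simp
  next
    case 2 show ?case by simp
  next
    case 3
    show ?case
    proof (intro allI impI, elim conjE)
      fix m d :: nat and \<delta> :: real and e :: "nat \<Rightarrow> 'a"
      assume d: "1 \<le> d" and \<delta>: "0 < \<delta>" "\<delta> < 1 / 20" and e: "vnorm d e = 1"
        and m: "25600 * K * ln (1 / \<delta>) * (1 / \<delta>\<^sup>2) * real d \<le> real m"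
      define P where "P = matrices m d"
      interpret P: prob_space P unfolding P_def by (intro prob_space_PiM prob_space_rows)
      define n where "n = d * DIM('a)"
      define \<epsilon> where "\<epsilon> = \<delta> / 200"
      have \<epsilon>: "0 < \<epsilon>" "\<epsilon> \<le> 1" "32 / \<epsilon> = 6400 / \<delta>" "R / \<epsilon> = 200 * R / \<delta>" using \<delta> by (auto simp: \<epsilon>_def)
      define p where "p = exp (- (real m * \<delta>\<^sup>2 / 12800))"
      obtain NA where NA: "NA \<subseteq> {(v, r). vnorm d v = 1 \<and> 0 \<le> r \<and> r \<le> R \<and> aligned d e v r}" "finite NA"
        "real (card NA) \<le> (6400 / \<delta>) ^ n * (200 * R / \<delta> + 1)"
        "\<forall>(v, r)\<in>{(v, r). vnorm d v = 1 \<and> 0 \<le> r \<and> r \<le> R \<and> aligned d e v r}.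
          \<exists>(w, s)\<in>NA. vnorm d (\<lambda>j. v j - w j) \<le> \<epsilon> \<and> \<bar>r - s\<bar> \<le> \<epsilon>"
        by (rule vector_scalar_net[of "{(v, r). vnorm d v = 1 \<and> 0 \<le> r \<and> r \<le> R \<and> aligned d e v r}" d R \<epsilon>])
           (use \<epsilon> R d in \<open>auto simp: n_def\<close>)
      obtain NB where NB: "NB \<subseteq> {v. vnorm d v = 1 \<and> (\<exists>r. aligned d e v r)}" "finite NB"
        "real (card NB) \<le> (6400 / \<delta>) ^ n"
        "\<forall>v\<in>{v. vnorm d v = 1 \<and> (\<exists>r. aligned d e v r)}. \<exists>w\<in>NB. vnorm d (\<lambda>j. v j - w j) \<le> \<epsilon>"
        by (rule vector_net[of "{v. vnorm d v = 1 \<and> (\<exists>r. aligned d e v r)}" d \<epsilon>])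
           (use \<epsilon> d in \<open>auto simp: n_def\<close>)
      obtain N0 :: "(nat \<Rightarrow> 'a) set" where N0: "N0 \<subseteq> {v. vnorm d v \<le> 1}" "finite N0"
        "real (card N0) \<le> 64 ^ n"
        "\<forall>v\<in>{v. vnorm d v \<le> 1}. \<exists>w\<in>N0. vnorm d (\<lambda>j. v j - w j) \<le> 1 / 2"
        by (rule vector_net[of "{v. vnorm d v \<le> 1}" d "1 / 2"]) (use d in \<open>auto simp: n_def\<close>)
      define EA where "EA = (\<lambda>(w, s). {\<omega> \<in> space P. (\<Sum>i<m. (amplitude_gap d e w s (\<omega> i))\<^sup>2) \<le> real m * ((1 - \<kappa>) * (1 - \<delta> / 2))})"
      define EB where "EB w = {\<omega> \<in> space P. (\<Sum>i<m. (limit_gap R (dot d (\<omega> i) e) (dot d (\<omega> i) w))\<^sup>2) \<le> real m * ((1 - \<kappa>) * (1 - \<delta> / 2))}" for w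
      define E0 where "E0 w = {\<omega> \<in> space P. 4 * real m \<le> (\<Sum>i<m. (norm (dot d (\<omega> i) w))\<^sup>2 / 4)}" for w
      have meas: "EA x \<in> sets P" "EB w \<in> sets P" "E0 w \<in> sets P" for x w
        unfolding EA_def EB_def E0_def P_def by (auto split: prod.split)
      define Bad where "Bad = (\<Union>x\<in>NA. EA x) \<union> (\<Union>w\<in>NB. EB w) \<union> (\<Union>w\<in>N0. E0 w)"
      have A: "P.prob (\<Union>x\<in>NA. EA x) \<le> real (card NA) * p"
      proof (rule P.prob_UN_le[OF NA(2) meas(1)])
        fix x assume "x \<in> NA"
        then obtain w s \<alpha> where ws: "x = (w, s)" "vnorm d w = 1" "0 \<le> s" "(\<Sum>j<d. w j * cj (e j)) = of_real \<alpha>" "0 \<le> \<alpha> + s"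
          using NA(1) by (auto simp: aligned_def)
        have "1 - \<kappa> \<le> (\<integral>a. (amplitude_gap d e w s a)\<^sup>2 \<partial>rows d)"
          using rows_amplitude_moment[OF e ws(2,4,3,5)] by (simp add: amplitude_gap_def)
        then show "P.prob (EA x) \<le> p"
          unfolding EA_def P_def p_def ws(1) prod.case using amplitude_gap_bounds[OF ws(3)] ws(2) \<delta>
          by (intro lower_tail_rows[where v = w]) auto
      qed
      have B: "P.prob (\<Union>w\<in>NB. EB w) \<le> real (card NB) * p"
      proof (rule P.prob_UN_le[OF NB(2) meas(2)])
        fix w assume "w \<in> NB"
        then obtain \<alpha> where w: "vnorm d w = 1" "(\<Sum>j<d. w j * cj (e j)) = of_real \<alpha>"
          using NB(1) by (auto simp: aligned_def)
        then show "P.prob (EB w) \<le> p"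
          unfolding EB_def P_def p_def using gap[OF e w] limit_gap_abs_le[of R] R \<delta>
          by (intro lower_tail_rows[where v = w]) auto
      qed
      have 0: "P.prob (\<Union>w\<in>N0. E0 w) \<le> real (card N0) * p"
      proof (rule P.prob_UN_le[OF N0(2) meas(3)])
        fix w assume "w \<in> N0"
        then have "P.prob (E0 w) \<le> exp (- 3 * real m)"
          unfolding E0_def P_def using N0(1) by (intro upper_tail_rows) auto
        also have "\<dots> \<le> p"
        proof -
          have "\<delta>\<^sup>2 \<le> 1" using \<delta> by (simp add: power_le_one)
          then have "real m * \<delta>\<^sup>2 \<le> real m * 1" by (intro mult_left_mono) auto
          then show ?thesis by (simp add: p_def)
        qed
        finally show "P.prob (E0 w) \<le> p" .
      qed
      have Bad: "Bad \<in> sets P"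
        unfolding Bad_def by (intro sets.Un sets.finite_UN meas NA(2) NB(2) N0(2))
      have "P.prob Bad \<le> P.prob ((\<Union>x\<in>NA. EA x) \<union> (\<Union>w\<in>NB. EB w)) + P.prob (\<Union>w\<in>N0. E0 w)"
        unfolding Bad_def by (intro measure_Un_le sets.Un sets.finite_UN meas NA(2) NB(2) N0(2))
      also have "P.prob ((\<Union>x\<in>NA. EA x) \<union> (\<Union>w\<in>NB. EB w)) \<le> P.prob (\<Union>x\<in>NA. EA x) + P.prob (\<Union>w\<in>NB. EB w)"
        by (intro measure_Un_le sets.Un sets.finite_UN meas NA(2) NB(2) N0(2))
      finally have "P.prob Bad \<le> (real (card NA) + real (card NB) + real (card N0)) * p"
        using A B 0 by (simp add: distrib_right)
      also have "\<dots> \<le> ((6400 / \<delta>) ^ n * ((200 * R + 3) / \<delta>)) * p"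
      proof (rule mult_right_mono)
        have "(64 :: real) ^ n \<le> (6400 / \<delta>) ^ n" using \<delta> by (intro power_mono) (auto simp: field_simps)
        then have "real (card NA) + real (card NB) + real (card N0) \<le> (6400 / \<delta>) ^ n * (200 * R / \<delta> + 3)"
        proof -
          have "(6400 / \<delta>) ^ n * (200 * R / \<delta> + 3) = (6400 / \<delta>) ^ n * (200 * R / \<delta> + 1) + 2 * (6400 / \<delta>) ^ n"
            by (simp add: algebra_simps)
          then show ?thesis using NA(3) NB(3) order_trans[OF N0(3) \<open>64 ^ n \<le> (6400 / \<delta>) ^ n\<close>] by linarith
        qed
        also have "\<dots> \<le> (6400 / \<delta>) ^ n * ((200 * R + 3) / \<delta>)"
          using \<delta> by (intro mult_left_mono) (auto simp: field_simps)
        finally show "real (card NA) + real (card NB) + real (card N0) \<le> (6400 / \<delta>) ^ n * ((200 * R + 3) / \<delta>)" .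
      qed (simp add: p_def)
      also have "\<dots> \<le> exp (- (1 / 25600) * \<delta>\<^sup>2 * real m)"
      proof -
        define l where "l = ln (1 / \<delta>)"
        \<comment> \<open>As 1/\<delta> exceeds e, \<open>l \<ge> 1\<close>, which absorbs additive
          constants: k + l \<le> (k + 1) l for k \<ge> 0.\<close>
        have "20 \<le> 1 / \<delta>" using \<delta> by (simp add: field_simps)
        then have "exp 1 \<le> 1 / \<delta>" using e_less_272 by linarith
        then have l: "1 \<le> l" using \<delta> by (simp add: l_def ln_ge_iff)
        have "(6400 / \<delta>) ^ n = exp (real n * ln (6400 * (1 / \<delta>)))"
          using \<delta> by (simp add: exp_of_nat_mult)
        also have "ln (6400 * (1 / \<delta>)) = ln 6400 + l" using \<delta> by (simp add: l_def ln_mult ln_div)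
        finally have 1: "(6400 / \<delta>) ^ n = exp (real n * (ln 6400 + l))" .
        have "ln ((200 * R + 3) / \<delta>) = ln (200 * R + 3) + l" using \<delta> R by (simp add: l_def ln_div)
        then have 2: "(200 * R + 3) / \<delta> = exp (ln (200 * R + 3) + l)"
          using \<delta> R by (subst exp_ln[symmetric]) auto
        have "ln 6400 + l \<le> (ln 6400 + 1) * l" using l mult_left_mono[of 1 l "ln 6400"] by (simp add: algebra_simps)
        then have "real n * (ln 6400 + l) \<le> real n * ((ln 6400 + 1) * l)" by (intro mult_left_mono) auto
        moreover have "ln (200 * R + 3) + l \<le> real d * ((ln (200 * R + 3) + 1) * l)"
        proof -
          have nn: "0 \<le> ln (200 * R + 3)" using R by simp
          have "ln (200 * R + 3) + l \<le> (ln (200 * R + 3) + 1) * l"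
            using l nn mult_left_mono[of 1 l "ln (200 * R + 3)"] by (simp add: algebra_simps)
          also have "\<dots> \<le> real d * ((ln (200 * R + 3) + 1) * l)"
            using d l nn mult_right_mono[of 1 "real d" "(ln (200 * R + 3) + 1) * l"] by simp
          finally show ?thesis .
        qed
        ultimately have "real n * (ln 6400 + l) + (ln (200 * R + 3) + l) \<le> K * l * real d"
          by (simp add: K_def n_def algebra_simps)
        also have "K * l * real d \<le> real m * \<delta>\<^sup>2 / 25600"
        proof -
          have "25600 * (K * l * real d) / \<delta>\<^sup>2 \<le> real m" using m by (simp add: l_def mult_ac)
          then show ?thesis using \<delta> by (simp add: field_simps)
        qed
        finally have "real n * (ln 6400 + l) + (ln (200 * R + 3) + l) + - (real m * \<delta>\<^sup>2 / 12800) \<le> - (1 / 25600) * \<delta>\<^sup>2 * real m"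
          by (simp add: algebra_simps)
        then show ?thesis unfolding 1 2 p_def by (simp only: exp_add[symmetric] exp_le_cancel_iff)
      qed
      finally have "P.prob Bad \<le> 2 * exp (- (1 / 25600) * \<delta>\<^sup>2 * real m)" by (smt (verit) exp_ge_zero)
      moreover have "sqrt (real m) * (sqrt (1 - \<kappa>) * (1 - \<delta>)) \<le> L2_set (\<lambda>i. amplitude_gap d e v r (\<omega> i)) {..<m}"
        if "\<omega> \<in> space P - Bad" "vnorm d v = 1" "0 \<le> r" "aligned d e v r" for \<omega> v r
      proof (rule good_event[OF \<delta> R e N0(4), of NA NB])
        show "\<exists>(w, s)\<in>NA. vnorm d (\<lambda>j. v j - w j) \<le> \<delta> / 200 \<and> \<bar>r - s\<bar> \<le> \<delta> / 200"
          if "vnorm d v = 1" "0 \<le> r" "r \<le> R" "aligned d e v r" for v r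
          using NA(4)[unfolded \<epsilon>_def] that by auto
        show "\<exists>w\<in>NB. vnorm d (\<lambda>j. v j - w j) \<le> \<delta> / 200" if "vnorm d v = 1" "aligned d e v r" for v r
          using NB(4)[unfolded \<epsilon>_def] that by auto
      qed (use that in \<open>auto simp: Bad_def EA_def EB_def E0_def not_le\<close>)
      ultimately show "\<exists>Bad \<in> sets (matrices m d).
        measure (matrices m d) Bad \<le> 2 * exp (- (1 / 25600) * \<delta>\<^sup>2 * real m) \<and>
        (\<forall>\<omega> \<in> space (matrices m d) - Bad. bounded_below m d e \<delta> \<omega>)"
        using Bad unfolding P_def bounded_below_def by blast
    qed
  qed
qed

end

subsection \<open>Measurability of the recovery event\<close>

lemma dense_approx_min:
  fixes g :: "'v::topological_space \<Rightarrow> real"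
  assumes "continuous_on A g" "Q \<subseteq> A" "A \<subseteq> closure Q" "x \<in> A" "0 < e"
  shows "\<exists>q\<in>Q. g q < g x + e"
proof -
  obtain U where U: "open U" "U \<inter> A = g -` {..<g x + e} \<inter> A"
    using assms(1)[unfolded continuous_on_open_invariant, rule_format, OF open_lessThan[of "g x + e"]] by blast
  have "x \<in> U" using U(2) assms(4,5) by auto
  then have "U \<inter> Q \<noteq> {}" using open_Int_closure_eq_empty[OF U(1), of Q] assms(3,4) by auto
  then show ?thesis using U(2) assms(2) by auto
qed

text \<open>Whether a compact set contains a minimiser is a projection along an uncountable set; compactness
  and continuity reduce it to countably many comparisons.\<close>

lemma minimiser_in_compact_measurable:
  fixes f :: "'w \<Rightarrow> 'v::{metric_space,second_countable_topology} \<Rightarrow> real"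
  assumes C: "compact C" "C \<subseteq> S"
    and cont: "\<And>w. w \<in> space M \<Longrightarrow> continuous_on S (f w)"
    and meas [measurable]: "\<And>x. (\<lambda>w. f w x) \<in> borel_measurable M"
  shows "{w \<in> space M. \<exists>x\<in>C. \<forall>y\<in>S. f w x \<le> f w y} \<in> sets M"
proof -
  obtain Q where Q: "countable Q" "Q \<subseteq> C" "C \<subseteq> closure Q" using separable by blast
  obtain Q' where Q': "countable Q'" "Q' \<subseteq> S" "S \<subseteq> closure Q'" using separable by blast
  have "{w \<in> space M. \<exists>x\<in>C. \<forall>y\<in>S. f w x \<le> f w y} =
    {w \<in> space M. \<forall>j::nat. \<exists>x\<in>Q. \<forall>y\<in>Q'. f w x \<le> f w y + 1 / real (Suc j)}"
  proof (rule Collect_cong, rule conj_cong[OF refl])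
    fix w assume w: "w \<in> space M"
    note cS = cont[OF w]
    have cC: "continuous_on C (f w)" using cS C(2) by (rule continuous_on_subset)
    show "(\<exists>x\<in>C. \<forall>y\<in>S. f w x \<le> f w y) = (\<forall>j::nat. \<exists>x\<in>Q. \<forall>y\<in>Q'. f w x \<le> f w y + 1 / real (Suc j))"
    proof
      assume "\<exists>x\<in>C. \<forall>y\<in>S. f w x \<le> f w y"
      then obtain x where x: "x \<in> C" "\<And>y. y \<in> S \<Longrightarrow> f w x \<le> f w y" by blast
      show "\<forall>j::nat. \<exists>x\<in>Q. \<forall>y\<in>Q'. f w x \<le> f w y + 1 / real (Suc j)"
      proof
        fix j :: nat
        obtain q where q: "q \<in> Q" "f w q < f w x + 1 / real (Suc j)"
          using dense_approx_min[OF cC Q(2,3) x(1), of "1 / real (Suc j)"] by auto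
        have "f w q \<le> f w y + 1 / real (Suc j)" if "y \<in> Q'" for y
          using q(2) x(2)[of y] that Q'(2) by auto
        then show "\<exists>x\<in>Q. \<forall>y\<in>Q'. f w x \<le> f w y + 1 / real (Suc j)" using q(1) by blast
      qed
    next
      assume *: "\<forall>j::nat. \<exists>x\<in>Q. \<forall>y\<in>Q'. f w x \<le> f w y + 1 / real (Suc j)"
      \<comment> \<open>The minimum over the compact \<open>C\<close> is attained and lies below
        every near-minimiser in \<open>Q\<close>; hence it is at most each value on
        \<open>Q'\<close>, and by density each value on \<open>S\<close>.\<close>
      then have "C \<noteq> {}" using Q(2) by blast
      then obtain x where x: "x \<in> C" "\<And>z. z \<in> C \<Longrightarrow> f w x \<le> f w z"
        using continuous_attains_inf[OF C(1) _ cC] by blast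
      have le: "f w x \<le> f w y" if y: "y \<in> Q'" for y
      proof (rule field_le_epsilon)
        fix e :: real assume "0 < e"
        then obtain j :: nat where j: "1 / real (Suc j) < e" using nat_approx_posE by metis
        obtain z where "z \<in> Q" "f w z \<le> f w y + 1 / real (Suc j)" using * y by blast
        then show "f w x \<le> f w y + e" using x(2)[of z] Q(2) j by force
      qed
      have "f w x \<le> f w y" if y: "y \<in> S" for y
      proof (rule field_le_epsilon)
        fix e :: real assume "0 < e"
        then obtain q where "q \<in> Q'" "f w q < f w y + e"
          using dense_approx_min[OF cS Q'(2,3) y] by blast
        then show "f w x \<le> f w y + e" using le[of q] by linarith
      qed
      then show "\<exists>x\<in>C. \<forall>y\<in>S. f w x \<le> f w y" using x(1) by blast
    qed
  qed
  also have "\<dots> \<in> sets M"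
    using Q(1) Q'(1) by (intro sets.sets_Collect_countable_All sets.sets_Collect_countable_Ex' sets.sets_Collect_countable_All' borel_measurable_le) auto
  finally show ?thesis .
qed

text \<open>The complement says that some minimiser has \<open>D x > b\<close>. This region of
  \<open>S\<close> is a countable union of compact sets, each handled by
  \<open>minimiser_in_compact_measurable\<close>.\<close>

lemma minimisers_below_measurable:
  fixes f :: "'w \<Rightarrow> 'v::{metric_space,second_countable_topology} \<Rightarrow> real" and K :: "nat \<Rightarrow> 'v set"
  assumes K: "\<And>n. compact (K n)" and S: "S = (\<Union>n. K n)"
    and D: "\<And>t. closed {x. t \<le> D x}"
    and cont: "\<And>w. w \<in> space M \<Longrightarrow> continuous_on S (f w)"
    and meas: "\<And>x. (\<lambda>w. f w x) \<in> borel_measurable M"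
  shows "{w \<in> space M. \<forall>x\<in>S. (\<forall>y\<in>S. f w x \<le> f w y) \<longrightarrow> D x \<le> (b::real)} \<in> sets M"
proof -
  \<comment> \<open>The strict inequality is exhausted by closed conditions with slack 1/(k+1),
    which keeps the pieces compact.\<close>
  define C where "C n k = K n \<inter> {x. b + 1 / real (Suc k) \<le> D x}" for n k :: nat
  have "compact (C n k)" for n k unfolding C_def using K D by (rule compact_Int_closed)
  moreover have "C n k \<subseteq> S" for n k using S by (auto simp: C_def)
  ultimately have "{w \<in> space M. \<exists>x\<in>C n k. \<forall>y\<in>S. f w x \<le> f w y} \<in> sets M" for n k
    by (rule minimiser_in_compact_measurable[OF _ _ cont meas])
  then have "space M - (\<Union>n. \<Union>k. {w \<in> space M. \<exists>x\<in>C n k. \<forall>y\<in>S. f w x \<le> f w y}) \<in> sets M"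
    by (intro sets.Diff sets.top sets.countable_UN image_subsetI)
  also have "space M - (\<Union>n. \<Union>k. {w \<in> space M. \<exists>x\<in>C n k. \<forall>y\<in>S. f w x \<le> f w y}) =
    {w \<in> space M. \<forall>x\<in>S. (\<forall>y\<in>S. f w x \<le> f w y) \<longrightarrow> D x \<le> b}"
  proof -
    have "(\<exists>n k. x \<in> C n k) \<longleftrightarrow> x \<in> S \<and> \<not> D x \<le> b" for x
    proof
      assume "\<exists>n k. x \<in> C n k"
      then obtain n k where "x \<in> K n" "b + 1 / real (Suc k) \<le> D x" by (auto simp: C_def)
      moreover have "0 < 1 / real (Suc k)" by simp
      ultimately have "x \<in> K n" "\<not> D x \<le> b" by linarith+
      then show "x \<in> S \<and> \<not> D x \<le> b" unfolding S by blast
    next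
      assume x: "x \<in> S \<and> \<not> D x \<le> b"
      then obtain n where "x \<in> K n" using S by auto
      moreover obtain k where "1 / real (Suc k) < D x - b" using x nat_approx_posE[of "D x - b"] by auto
      ultimately have "x \<in> C n k" by (auto simp: C_def)
      then show "\<exists>n k. x \<in> C n k" by blast
    qed
    then have eq: "(\<exists>n k. \<exists>x\<in>C n k. \<forall>y\<in>S. f w x \<le> f w y) \<longleftrightarrow>
      \<not> (\<forall>x\<in>S. (\<forall>y\<in>S. f w x \<le> f w y) \<longrightarrow> D x \<le> b)" for w
      by metis
    have "space M - (\<Union>n. \<Union>k. {w \<in> space M. P n k w}) = {w \<in> space M. \<not> (\<exists>n k. P n k w)}"
      for P :: "nat \<Rightarrow> nat \<Rightarrow> 'w \<Rightarrow> bool" by blast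
    then show ?thesis by (simp only: eq not_not)
  qed
  finally show ?thesis .
qed

text \<open>Vectors are represented by functions vanishing from \<open>d\<close> on, which places
  them in a product topology where boxes are compact by Tychonoff; forcing 0 outside makes the
  representation unique.\<close>

definition coordinate_box :: "nat \<Rightarrow> nat \<Rightarrow> (nat \<Rightarrow> 'a::euclidean_space) set" where
  "coordinate_box d n = (\<Pi>\<^sub>E j\<in>UNIV. if j < d then cball 0 (real n) else {0})"

lemma compact_coordinate_box: "compact (coordinate_box d n)"
proof -
  have "compactin (product_topology (\<lambda>_. euclidean) UNIV) (coordinate_box d n :: (nat \<Rightarrow> 'a) set)"
    unfolding coordinate_box_def by (subst compactin_PiE) auto
  then show ?thesis by (simp add: euclidean_product_topology)
qed

lemma Union_coordinate_box: "(\<Union>n. coordinate_box d n) = {x. \<forall>j\<ge>d. x j = 0}"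
proof
  show "(\<Union>n. coordinate_box d n) \<subseteq> {x. \<forall>j\<ge>d. x j = (0::'a)}"
  proof clarify
    fix n :: nat and x :: "nat \<Rightarrow> 'a" and j assume "x \<in> coordinate_box d n" "d \<le> j"
    then have "x j \<in> (if j < d then cball 0 (real n) else {0})"
      unfolding coordinate_box_def by (elim PiE_mem) simp
    then show "x j = 0" using \<open>d \<le> j\<close> by simp
  qed
  show "{x. \<forall>j\<ge>d. x j = (0::'a)} \<subseteq> (\<Union>n. coordinate_box d n)"
  proof
    fix x :: "nat \<Rightarrow> 'a" assume x: "x \<in> {x. \<forall>j\<ge>d. x j = 0}"
    obtain n where "vnorm d x \<le> real n" using real_arch_simple by blast
    then have "norm (x j) \<le> real n" if "j < d" for j
      using norm_le_vnorm[OF that, of x] by linarith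
    then have "x \<in> coordinate_box d n" using x by (auto simp: coordinate_box_def PiE_iff not_less)
    then show "x \<in> (\<Union>n. coordinate_box d n)" by blast
  qed
qed

subsection \<open>Recovery\<close>

text \<open>A superlevel set of an infimum is the intersection of the superlevel sets of its
  members, here continuous functions of \<open>x\<close>, one for each phase.\<close>

lemma closed_phase_dist_ge:
  fixes x0 :: "'a::{real_normed_field,euclidean_space} Matrix.vec"
  assumes x0: "x0 \<in> carrier_vec d"
  shows "closed {x. t \<le> phase_dist (vec d x) x0}"
proof -
  have norm2: "norm2 (vec d x - c \<cdot>\<^sub>v x0) = L2_set (\<lambda>i. norm (x i - c * x0 $ i)) {..<d}" for x c
    using x0 by (auto simp: norm2_def intro!: L2_set_cong)
  have "{x. t \<le> phase_dist (vec d x) x0} =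
      (\<Inter>c\<in>{c. norm c = 1}. {x. t \<le> L2_set (\<lambda>i. norm (x i - c * x0 $ i)) {..<d}})"
  proof -
    have "t \<le> phase_dist (vec d x) x0 \<longleftrightarrow> (\<forall>c\<in>{c. norm c = 1}. t \<le> norm2 (vec d x - c \<cdot>\<^sub>v x0))" for x
      unfolding phase_dist_def
      by (rule le_cINF_iff) (auto intro!: exI[of _ 1] bdd_belowI[of _ 0] simp: norm2_def)
    then show ?thesis by (auto simp: norm2)
  qed
  moreover have "closed {x. t \<le> L2_set (\<lambda>i. norm (x i - c * x0 $ i)) {..<d}}" for c
    unfolding L2_set_def by (intro closed_Collect_le continuous_intros) simp_all
  ultimately show ?thesis by auto
qed

lemma phase_dist_le:
  assumes "norm c = 1"
  shows "phase_dist x y \<le> norm2 (x - c \<cdot>\<^sub>v y)"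
  unfolding phase_dist_def
  by (rule cINF_lower) (use assms in \<open>auto intro!: bdd_belowI[of _ 0] simp: norm2_def\<close>)

lemma mult_mat_vec_eq_dot:
  assumes "x \<in> carrier_vec d" "i < m"
  shows "(matrix_of m d \<omega> *\<^sub>v x) $ i = dot d (\<omega> i) (\<lambda>j. x $ j)"
  using assms by (auto simp: matrix_of_def scalar_prod_def dot_def atLeast0LessThan intro!: sum.cong)

lemma amplitude_loss_eq:
  fixes x x0 :: "'a::real_normed_field Matrix.vec"
  assumes "x \<in> carrier_vec d" "x0 \<in> carrier_vec d" "\<eta> \<in> carrier_vec m"
  shows "amplitude_loss (matrix_of m d \<omega>) x0 \<eta> x =
    L2_set (\<lambda>i. \<bar>norm (dot d (\<omega> i) (\<lambda>j. x $ j)) - norm (dot d (\<omega> i) (\<lambda>j. x0 $ j)) - \<eta> $ i\<bar>) {..<m}"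
proof -
  have dim: "dim_row (matrix_of m d \<omega>) = m" by (simp add: matrix_of_def)
  have "amplitude_loss (matrix_of m d \<omega>) x0 \<eta> x =
    L2_set (\<lambda>i. norm ((map_vec norm (matrix_of m d \<omega> *\<^sub>v x) - map_vec norm (matrix_of m d \<omega> *\<^sub>v x0) - \<eta>) $ i)) {..<m}"
    using assms(3) by (simp add: amplitude_loss_def norm2_def)
  also have "\<dots> = L2_set (\<lambda>i. \<bar>norm (dot d (\<omega> i) (\<lambda>j. x $ j)) - norm (dot d (\<omega> i) (\<lambda>j. x0 $ j)) - \<eta> $ i\<bar>) {..<m}"
    using assms by (intro L2_set_cong refl) (simp add: dim mult_mat_vec_eq_dot[symmetric])
  finally show ?thesis .
qed

text \<open>The loss is continuous in \<open>x\<close> and measurable in the matrix; transported to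
  functions vanishing from \<open>d\<close> on, the event is an instance of
  \<open>minimisers_below_measurable\<close>.\<close>

lemma recovery_event_measurable:
  fixes \<gamma> :: "'a::{real_normed_field,euclidean_space} measure"
  assumes \<gamma> [measurable_cong]: "sets \<gamma> = sets borel"
    and x0: "x0 \<in> carrier_vec d" and \<eta>: "\<eta> \<in> carrier_vec m"
  shows "{\<omega> \<in> space (iid_rows \<gamma> m d).
      \<forall>xh. is_arg_min (amplitude_loss (matrix_of m d \<omega>) x0 \<eta>) (\<lambda>x. x \<in> carrier_vec d) xh \<longrightarrow>
        phase_dist xh x0 \<le> b} \<in> sets (iid_rows \<gamma> m d)"
proof -
  define S where "S = {x :: nat \<Rightarrow> 'a. \<forall>j\<ge>d. x j = 0}"
  define f where "f \<omega> x = L2_set (\<lambda>i. \<bar>norm (dot d (\<omega> i) x) - norm (dot d (\<omega> i) (\<lambda>j. x0 $ j)) - \<eta> $ i\<bar>) {..<m}"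
    for \<omega> :: "nat \<Rightarrow> nat \<Rightarrow> 'a" and x
  define D where "D x = phase_dist (vec d x) x0" for x
  have loss: "amplitude_loss (matrix_of m d \<omega>) x0 \<eta> (vec d x) = f \<omega> x" for \<omega> x
  proof -
    have "dot d a (\<lambda>j. vec d x $ j) = dot d a x" for a by (simp add: dot_def)
    then show ?thesis by (simp add: amplitude_loss_eq[OF _ x0 \<eta>] f_def)
  qed
  have carrier: "carrier_vec d = vec d ` S"
  proof
    show "carrier_vec d \<subseteq> vec d ` S"
    proof
      fix v :: "'a Matrix.vec" assume "v \<in> carrier_vec d"
      then have "v = vec d (\<lambda>j. if j < d then v $ j else 0)" by auto
      then show "v \<in> vec d ` S"
        by (intro image_eqI[of v "vec d" "\<lambda>j. if j < d then v $ j else 0" S]) (auto simp: S_def)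
    qed
  qed auto
  have event: "(\<forall>xh. is_arg_min (amplitude_loss (matrix_of m d \<omega>) x0 \<eta>) (\<lambda>x. x \<in> carrier_vec d) xh \<longrightarrow>
      phase_dist xh x0 \<le> b) \<longleftrightarrow> (\<forall>x\<in>S. (\<forall>y\<in>S. f \<omega> x \<le> f \<omega> y) \<longrightarrow> D x \<le> b)" for \<omega>
    unfolding is_arg_min_def carrier by (auto simp: loss D_def not_less)
  have "continuous_on S (f \<omega>)" for \<omega>
    unfolding f_def L2_set_def dot_def
    by (intro continuous_intros continuous_on_subset[OF continuous_on_product_coordinates]) auto
  moreover have "(\<lambda>\<omega>. f \<omega> x) \<in> borel_measurable (iid_rows \<gamma> m d)" for x
    unfolding f_def L2_set_def iid_rows_def by measurable
  ultimately show ?thesis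
    unfolding event
    by (intro minimisers_below_measurable[of "coordinate_box d"])
       (auto simp: compact_coordinate_box Union_coordinate_box S_def D_def[abs_def] closed_phase_dist_ge[OF x0])
qed

text \<open>Keeping \<open>C\<close> and \<open>c\<close> as parameters lets the constants of the
  two scalar fields be reconciled afterwards.\<close>

definition recovers :: "'a::real_normed_field measure \<Rightarrow> real \<Rightarrow> real \<Rightarrow> real \<Rightarrow> bool" where
  "recovers \<gamma> \<beta> C c \<longleftrightarrow> (\<forall>(m::nat) (d::nat) (\<delta>::real) (x0 :: 'a Matrix.vec) (\<eta> :: real Matrix.vec).
      m \<ge> 1 \<and> d \<ge> 1 \<and> 0 < \<delta> \<and> \<delta> < 0.05 \<and> x0 \<in> carrier_vec d \<and> \<eta> \<in> carrier_vec m \<and>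
      real m \<ge> C * ln (1 / \<delta>) * (1 / \<delta>\<^sup>2) * real d \<longrightarrow>
      \<P>(\<omega> in iid_rows \<gamma> m d.
          \<forall>xh. is_arg_min (amplitude_loss (matrix_of m d \<omega>) x0 \<eta>) (\<lambda>x. x \<in> carrier_vec d) xh \<longrightarrow>
            phase_dist xh x0 \<le> 2 * \<beta> / (1 - \<delta>) * (norm2 \<eta> / sqrt (real m)))
        \<ge> 1 - 2 * exp (- c * \<delta>\<^sup>2 * real m))"

text \<open>A larger \<open>C\<close> strengthens the assumption on \<open>m\<close>, as \<delta> <
  1 makes the logarithm positive; a smaller \<open>c\<close> weakens the claimed
  probability.\<close>

lemma recovers_mono:
  fixes \<gamma> :: "'a::real_normed_field measure"
  assumes rec: "recovers \<gamma> \<beta> C' c'" and C: "C' \<le> C" and c: "c \<le> c'"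
  shows "recovers \<gamma> \<beta> C c"
  unfolding recovers_def
proof (intro allI impI, elim conjE)
  fix m d :: nat and \<delta> :: real and x0 :: "'a Matrix.vec" and \<eta> :: "real Matrix.vec"
  assume *: "1 \<le> m" "1 \<le> d" "0 < \<delta>" "\<delta> < 0.05" "x0 \<in> carrier_vec d" "\<eta> \<in> carrier_vec m"
    and m: "C * ln (1 / \<delta>) * (1 / \<delta>\<^sup>2) * real d \<le> real m"
  have "C' * ln (1 / \<delta>) * (1 / \<delta>\<^sup>2) * real d \<le> C * ln (1 / \<delta>) * (1 / \<delta>\<^sup>2) * real d"
    using * C by (intro mult_right_mono) auto
  then have m': "C' * ln (1 / \<delta>) * (1 / \<delta>\<^sup>2) * real d \<le> real m" using m by linarith
  have "c * (\<delta>\<^sup>2 * real m) \<le> c' * (\<delta>\<^sup>2 * real m)" using c by (intro mult_right_mono) auto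
  then have "1 - 2 * exp (- c * \<delta>\<^sup>2 * real m) \<le> 1 - 2 * exp (- c' * \<delta>\<^sup>2 * real m)" by (simp add: mult.assoc)
  also have "\<dots> \<le> \<P>(\<omega> in iid_rows \<gamma> m d.
      \<forall>xh. is_arg_min (amplitude_loss (matrix_of m d \<omega>) x0 \<eta>) (\<lambda>x. x \<in> carrier_vec d) xh \<longrightarrow>
        phase_dist xh x0 \<le> 2 * \<beta> / (1 - \<delta>) * (norm2 \<eta> / sqrt (real m)))"
    using rec[unfolded recovers_def, rule_format, of m d \<delta> x0 \<eta>] * m' by blast
  finally show "1 - 2 * exp (- c * \<delta>\<^sup>2 * real m) \<le> \<P>(\<omega> in iid_rows \<gamma> m d.
      \<forall>xh. is_arg_min (amplitude_loss (matrix_of m d \<omega>) x0 \<eta>) (\<lambda>x. x \<in> carrier_vec d) xh \<longrightarrow>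
        phase_dist xh x0 \<le> 2 * \<beta> / (1 - \<delta>) * (norm2 \<eta> / sqrt (real m)))" .
qed

section \<open>From amplitudes to minimisers\<close>

context gaussian_law
begin

lemma aligning_phase:
  fixes x e :: "nat \<Rightarrow> 'a"
  obtains c where "norm c = 1" "(\<Sum>j<d. c * x j * cj (e j)) = of_real (norm (\<Sum>j<d. x j * cj (e j)))"
proof -
  define S where "S = (\<Sum>j<d. x j * cj (e j))"
  define c where "c = (if S = 0 then 1 else of_real (norm S) / S)"
  have "norm c = 1" by (simp add: c_def norm_divide)
  moreover have "(\<Sum>j<d. c * x j * cj (e j)) = c * S" by (simp add: S_def sum_distrib_left mult.assoc)
  moreover have "c * S = of_real (norm S)" by (simp add: c_def)
  ultimately show ?thesis using that by (simp add: S_def)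
qed

text \<open>Amplitudes ignore the phase \<open>c\<close> and scale with \<open>t\<close>, so the
  difference of amplitudes of \<open>x\<close> and \<open>x0\<close> is \<open>t\<close> times
  \<open>amplitude_gap\<close>. Since every phase bounds \<open>phase_dist\<close> from above, the
  aligning one may be used without proving it optimal.\<close>

lemma phase_dist_le_gap:
  fixes x x0 :: "'a Matrix.vec"
  assumes x: "x \<in> carrier_vec d" and x0: "x0 \<in> carrier_vec d"
    and e: "vnorm d e = 1" and x0_e: "\<forall>j<d. x0 $ j = of_real \<rho> * e j" and \<rho>: "0 \<le> \<rho>"
    and q: "0 \<le> q"
    and lower: "\<And>v r. vnorm d v = 1 \<Longrightarrow> 0 \<le> r \<Longrightarrow> aligned d e v r \<Longrightarrow> q \<le> L2_set (\<lambda>i. amplitude_gap d e v r (\<omega> i)) {..<m}"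
  shows "q * phase_dist x x0 \<le>
    L2_set (\<lambda>i. \<bar>norm (dot d (\<omega> i) (\<lambda>j. x $ j)) - norm (dot d (\<omega> i) (\<lambda>j. x0 $ j))\<bar>) {..<m}"
proof -
  obtain c where c: "norm c = 1"
    and cS: "(\<Sum>j<d. c * x $ j * cj (e j)) = of_real (norm (\<Sum>j<d. x $ j * cj (e j)))"
    by (rule aligning_phase[where d = d and x = "\<lambda>j. x $ j" and e = e])
  define s where "s = norm (\<Sum>j<d. x $ j * cj (e j))"
  define h where "h j = c * x $ j - of_real \<rho> * e j" for j
  define t where "t = vnorm d h"
  have c0: "c \<noteq> 0" using c by auto
  have "norm2 (x - inverse c \<cdot>\<^sub>v x0) = t"
  proof -
    have "norm (x $ j - inverse c * x0 $ j) = norm (h j)" if "j < d" for j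
    proof -
      have "c * (x $ j - inverse c * x0 $ j) = h j"
        using c0 x0_e that by (simp add: h_def algebra_simps)
      then show ?thesis using c by (metis mult_1 norm_mult)
    qed
    then show ?thesis using x x0 unfolding norm2_def t_def vnorm_def by (auto intro!: L2_set_cong)
  qed
  then have dist: "phase_dist x x0 \<le> t"
    using phase_dist_le[of "inverse c" x x0] c by (simp add: norm_inverse)
  show ?thesis
  proof (cases "t = 0")
    case True
    then have "q * phase_dist x x0 \<le> q * 0" using dist q by (intro mult_left_mono) auto
    then show ?thesis using L2_set_nonneg order_trans by fastforce
  next
    case False
    then have t: "0 < t" by (simp add: t_def less_le)
    define v where "v j = of_real (1 / t) * h j" for j
    define r where "r = \<rho> / t"
    have "vnorm d v = norm (of_real (1 / t) :: 'a) * t" unfolding v_def t_def by (rule vnorm_scale)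
    also have "\<dots> = 1" using t by (simp only: norm_of_real) simp
    finally have v1: "vnorm d v = 1" .
    have r0: "0 \<le> r" using \<rho> t by (simp add: r_def)
    have ee: "(\<Sum>j<d. e j * cj (e j)) = 1"
    proof -
      have "(\<Sum>j<d. e j * cj (e j)) = of_real ((vnorm d e)\<^sup>2)" by (simp add: mult_cj vnorm_sq)
      then show ?thesis using e by simp
    qed
    have "(\<Sum>j<d. v j * cj (e j)) = of_real (1 / t) * ((\<Sum>j<d. c * x $ j * cj (e j)) - of_real \<rho> * (\<Sum>j<d. e j * cj (e j)))"
      by (simp add: v_def h_def sum_distrib_left sum_subtractf algebra_simps)
    also have "\<dots> = of_real ((s - \<rho>) / t)" by (simp add: cS ee s_def)
    finally have "(\<Sum>j<d. v j * cj (e j)) = of_real ((s - \<rho>) / t)" .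
    \<comment> \<open>The two terms add up to \<open>s / t\<close>, and \<open>s\<close> is a
      modulus.\<close>
    moreover have "0 \<le> (s - \<rho>) / t + r"
      using t by (simp add: r_def add_divide_distrib[symmetric] s_def)
    ultimately have al: "aligned d e v r" unfolding aligned_def by blast
    have gap: "amplitude_gap d e v r a =
      1 / t * \<bar>norm (dot d a (\<lambda>j. x $ j)) - norm (dot d a (\<lambda>j. x0 $ j))\<bar>" for a
    proof -
      have e': "dot d a (\<lambda>j. x0 $ j) = of_real \<rho> * dot d a e"
        by (simp add: dot_def sum_distrib_left x0_e mult_ac)
      have "dot d a v + of_real r * dot d a e = of_real (1 / t) * (c * dot d a (\<lambda>j. x $ j))"
      proof -
        have "dot d a v = of_real (1 / t) * (c * dot d a (\<lambda>j. x $ j) - of_real \<rho> * dot d a e)"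
          unfolding v_def[abs_def] h_def[abs_def] by (simp only: dot_scale dot_diff)
        then show ?thesis by (simp add: r_def diff_divide_distrib)
      qed
      then have "norm (dot d a v + of_real r * dot d a e) = 1 / t * norm (dot d a (\<lambda>j. x $ j))"
        using c t by (simp add: norm_mult norm_divide)
      moreover have "r * norm (dot d a e) = 1 / t * norm (dot d a (\<lambda>j. x0 $ j))"
        using \<rho> by (simp add: e' norm_mult r_def)
      ultimately show ?thesis
        using t by (simp add: amplitude_gap_def diff_divide_distrib[symmetric] abs_divide)
    qed
    have "q \<le> L2_set (\<lambda>i. amplitude_gap d e v r (\<omega> i)) {..<m}" by (rule lower[OF v1 r0 al])
    also have "\<dots> = 1 / t * L2_set (\<lambda>i. \<bar>norm (dot d (\<omega> i) (\<lambda>j. x $ j)) - norm (dot d (\<omega> i) (\<lambda>j. x0 $ j))\<bar>) {..<m}"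
      unfolding gap using t by (subst L2_set_right_distrib) auto
    finally have "q * t \<le> L2_set (\<lambda>i. \<bar>norm (dot d (\<omega> i) (\<lambda>j. x $ j)) - norm (dot d (\<omega> i) (\<lambda>j. x0 $ j))\<bar>) {..<m}"
      using t by (simp add: field_simps)
    moreover have "q * phase_dist x x0 \<le> q * t" using dist q by (intro mult_left_mono)
    ultimately show ?thesis by linarith
  qed
qed

text \<open>The competitor \<open>x0\<close> has loss exactly \<open>norm2 \<eta>\<close>, and
  removing \<eta> from the residual costs as much again; hence the factor 2.\<close>

lemma arg_min_residual_le:
  fixes xh x0 :: "'a Matrix.vec"
  assumes min: "is_arg_min (amplitude_loss (matrix_of m d \<omega>) x0 \<eta>) (\<lambda>x. x \<in> carrier_vec d) xh"
    and x0: "x0 \<in> carrier_vec d" and \<eta>: "\<eta> \<in> carrier_vec m"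
  shows "L2_set (\<lambda>i. \<bar>norm (dot d (\<omega> i) (\<lambda>j. xh $ j)) - norm (dot d (\<omega> i) (\<lambda>j. x0 $ j))\<bar>) {..<m} \<le> 2 * norm2 \<eta>"
proof -
  have xh: "xh \<in> carrier_vec d" using min by (simp add: is_arg_min_def)
  have \<eta>': "norm2 \<eta> = L2_set (\<lambda>i. \<bar>\<eta> $ i\<bar>) {..<m}" using \<eta> by (simp add: norm2_def)
  have "L2_set (\<lambda>i. \<bar>norm (dot d (\<omega> i) (\<lambda>j. xh $ j)) - norm (dot d (\<omega> i) (\<lambda>j. x0 $ j))\<bar>) {..<m} \<le>
    amplitude_loss (matrix_of m d \<omega>) x0 \<eta> xh + norm2 \<eta>"
    unfolding amplitude_loss_eq[OF xh x0 \<eta>] \<eta>' by (rule L2_set_le_add) auto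
  also have "amplitude_loss (matrix_of m d \<omega>) x0 \<eta> xh \<le> amplitude_loss (matrix_of m d \<omega>) x0 \<eta> x0"
    using min x0 by (auto simp: is_arg_min_def not_less)
  also have "amplitude_loss (matrix_of m d \<omega>) x0 \<eta> x0 = norm2 \<eta>"
    unfolding amplitude_loss_eq[OF x0 x0 \<eta>] \<eta>' by simp
  finally show ?thesis by simp
qed

lemma unit_direction:
  fixes x0 :: "'a Matrix.vec"
  assumes "1 \<le> d"
  obtains e \<rho> where "vnorm d e = 1" "0 \<le> \<rho>" "\<forall>j<d. x0 $ j = of_real \<rho> * e j"
proof (cases "vnorm d (\<lambda>j. x0 $ j) = 0")
  case True
  \<comment> \<open>For \<open>x0 = 0\<close> any unit vector serves, with \<rho> = 0; a first
    coordinate exists because \<open>1 \<le> d\<close>.\<close>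
  define e :: "nat \<Rightarrow> 'a" where "e j = (if j = 0 then 1 else 0)" for j
  have "(vnorm d e)\<^sup>2 = 1\<^sup>2"
    using assms unfolding vnorm_sq by (subst sum.remove[of _ 0]) (auto simp: e_def)
  then have "vnorm d e = 1" by (rule power2_eq_imp_eq) auto
  moreover have "x0 $ j = of_real 0 * e j" if "j < d" for j
    using norm_le_vnorm[OF that, of "\<lambda>j. x0 $ j"] True by simp
  ultimately show ?thesis using that by blast
next
  case False
  define \<rho> where "\<rho> = vnorm d (\<lambda>j. x0 $ j)"
  have \<rho>: "0 < \<rho>" using False by (simp add: \<rho>_def less_le)
  have "vnorm d (\<lambda>j. of_real (1 / \<rho>) * x0 $ j) = norm (of_real (1 / \<rho>) :: 'a) * \<rho>"
    unfolding \<rho>_def by (rule vnorm_scale)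
  also have "\<dots> = 1" using \<rho> by (simp only: norm_of_real) simp
  finally have "vnorm d (\<lambda>j. of_real (1 / \<rho>) * x0 $ j) = 1" .
  moreover have "x0 $ j = of_real \<rho> * (of_real (1 / \<rho>) * x0 $ j)" for j
    using \<rho> by (simp add: mult.assoc[symmetric] flip: of_real_mult)
  ultimately show ?thesis using that \<rho> less_imp_le by blast
qed

theorem recovery:
  obtains C c where "0 < C" "0 < c"
    "recovers \<gamma> (sqrt (1 / (1 - \<kappa>))) C c"
proof -
  obtain C c where C: "0 < C" "0 < c" and main:
    "\<forall>(m::nat) d \<delta> e. 1 \<le> d \<and> 0 < \<delta> \<and> \<delta> < 1 / 20 \<and> vnorm d e = 1 \<and>
        C * ln (1 / \<delta>) * (1 / \<delta>\<^sup>2) * real d \<le> real m \<longrightarrow>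
      (\<exists>Bad \<in> sets (matrices m d).
        measure (matrices m d) Bad \<le> 2 * exp (- c * \<delta>\<^sup>2 * real m) \<and>
        (\<forall>\<omega> \<in> space (matrices m d) - Bad. bounded_below m d e \<delta> \<omega>))"
    by (rule amplitude_lower_bound)
  show ?thesis
  proof (rule that[OF C], unfold recovers_def, intro allI impI, elim conjE)
    fix m d :: nat and \<delta> :: real and x0 :: "'a Matrix.vec" and \<eta> :: "real Matrix.vec"
    assume m: "1 \<le> m" and d: "1 \<le> d" and \<delta>: "0 < \<delta>" "\<delta> < 0.05" and x0: "x0 \<in> carrier_vec d" and \<eta>: "\<eta> \<in> carrier_vec m"
      and mC: "C * ln (1 / \<delta>) * (1 / \<delta>\<^sup>2) * real d \<le> real m"
    obtain e \<rho> where e: "vnorm d e = 1" "0 \<le> \<rho>" "\<forall>j<d. x0 $ j = of_real \<rho> * e j"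
      by (rule unit_direction[OF d])
    define P where "P = iid_rows \<gamma> m d"
    interpret P: prob_space P unfolding P_def iid_rows_def by (intro prob_space_PiM prob_space_rows)
    define q where "q = sqrt (real m) * (sqrt (1 - \<kappa>) * (1 - \<delta>))"
    define b where "b = 2 * sqrt (1 / (1 - \<kappa>)) / (1 - \<delta>) * (norm2 \<eta> / sqrt (real m))"
    have q: "0 < q" using m \<delta> \<kappa>_pos by (simp add: q_def)
    have b: "b = 2 * norm2 \<eta> / q" by (simp add: b_def q_def real_sqrt_divide field_simps)
    obtain Bad where Bad: "Bad \<in> sets P" "P.prob Bad \<le> 2 * exp (- c * \<delta>\<^sup>2 * real m)"
      and good: "\<And>\<omega> v r. \<omega> \<in> space P - Bad \<Longrightarrow> vnorm d v = 1 \<Longrightarrow> 0 \<le> r \<Longrightarrow> aligned d e v r \<Longrightarrow>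
        q \<le> L2_set (\<lambda>i. amplitude_gap d e v r (\<omega> i)) {..<m}"
      using main[rule_format, of d \<delta> e m] d \<delta> e(1) mC unfolding P_def iid_rows_def q_def bounded_below_def by auto
    define E where "E = {\<omega> \<in> space P. \<forall>xh. is_arg_min (amplitude_loss (matrix_of m d \<omega>) x0 \<eta>) (\<lambda>x. x \<in> carrier_vec d) xh \<longrightarrow>
        phase_dist xh x0 \<le> b}"
    have "E \<in> sets P"
      unfolding E_def P_def by (rule recovery_event_measurable[OF sets_\<gamma> x0 \<eta>])
    moreover have "space P - Bad \<subseteq> E"
    proof
      fix \<omega> assume \<omega>: "\<omega> \<in> space P - Bad"
      have "phase_dist xh x0 \<le> b"
        if min: "is_arg_min (amplitude_loss (matrix_of m d \<omega>) x0 \<eta>) (\<lambda>x. x \<in> carrier_vec d) xh" for xh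
      proof -
        have "xh \<in> carrier_vec d" using min by (simp add: is_arg_min_def)
        then have "q * phase_dist xh x0 \<le> 2 * norm2 \<eta>"
          using phase_dist_le_gap[OF _ x0 e(1,3,2) less_imp_le[OF q] good[OF \<omega>]] arg_min_residual_le[OF min x0 \<eta>]
          by (meson order_trans)
        then show ?thesis using q by (simp add: b field_simps)
      qed
      then show "\<omega> \<in> E" using \<omega> by (simp add: E_def)
    qed
    ultimately have "P.prob (space P - Bad) \<le> P.prob E" by (intro P.finite_measure_mono)
    then have "1 - 2 * exp (- c * \<delta>\<^sup>2 * real m) \<le> P.prob E" using Bad by (simp add: P.prob_compl)
    then show "1 - 2 * exp (- c * \<delta>\<^sup>2 * real m) \<le> \<P>(\<omega> in iid_rows \<gamma> m d.
          \<forall>xh. is_arg_min (amplitude_loss (matrix_of m d \<omega>) x0 \<eta>) (\<lambda>x. x \<in> carrier_vec d) xh \<longrightarrow>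
            phase_dist xh x0 \<le> 2 * sqrt (1 / (1 - \<kappa>)) / (1 - \<delta>) * (norm2 \<eta> / sqrt (real m)))"
      unfolding E_def P_def b_def .
  qed
qed

end

subsection \<open>The real and the complex Gaussian law\<close>

text \<open>Two one-dimensional affine substitutions, with Jacobians 1/c and c that cancel, realise
  the rotation by Fubini alone. They divide by \<open>c\<close>, so the quarter turns are treated
  separately as a swap with signs.\<close>

lemma nn_integral_lborel_rotation:
  fixes F :: "real \<times> real \<Rightarrow> ennreal"
  assumes [measurable]: "F \<in> borel_measurable (borel \<Otimes>\<^sub>M borel)"
    and cs: "c\<^sup>2 + s\<^sup>2 = 1"
  shows "(\<integral>\<^sup>+x. \<integral>\<^sup>+y. F (c * x + s * y, c * y - s * x) \<partial>lborel \<partial>lborel) = (\<integral>\<^sup>+x. \<integral>\<^sup>+y. F (x, y) \<partial>lborel \<partial>lborel)"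
proof (cases "c = 0")
  case True
  then have s: "s \<noteq> 0" "\<bar>s\<bar> = 1" using cs by (auto simp: abs_square_eq_1)
  have "(\<integral>\<^sup>+x. \<integral>\<^sup>+y. F (c * x + s * y, c * y - s * x) \<partial>lborel \<partial>lborel)
     = (\<integral>\<^sup>+x. \<integral>\<^sup>+y. F (0 + s * y, - s * x) \<partial>lborel \<partial>lborel)" using True by simp
  also have "\<dots> = (\<integral>\<^sup>+x. \<integral>\<^sup>+y. F (y, - s * x) \<partial>lborel \<partial>lborel)"
  proof (rule nn_integral_cong)
    fix x
    show "(\<integral>\<^sup>+y. F (0 + s * y, - s * x) \<partial>lborel) = (\<integral>\<^sup>+y. F (y, - s * x) \<partial>lborel)"
      using s nn_integral_real_affine[of "\<lambda>y. F (y, - s * x)" s 0] by simp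
  qed
  also have "\<dots> = (\<integral>\<^sup>+y. \<integral>\<^sup>+x. F (y, 0 + (- s) * x) \<partial>lborel \<partial>lborel)"
    by (subst lborel_pair.Fubini') auto
  also have "\<dots> = (\<integral>\<^sup>+y. \<integral>\<^sup>+x. F (y, x) \<partial>lborel \<partial>lborel)"
  proof (rule nn_integral_cong)
    fix y
    show "(\<integral>\<^sup>+x. F (y, 0 + (- s) * x) \<partial>lborel) = (\<integral>\<^sup>+x. F (y, x) \<partial>lborel)"
      using s nn_integral_real_affine[of "\<lambda>x. F (y, x)" "- s" 0] by simp
  qed
  finally show ?thesis .
next
  case c: False
  have arg:  "s * (- s * x + c * y) / c + 1/c * x = c * x + s * y" for x y
  proof -
    have "s * (- s * x + c * y) + x = (c\<^sup>2 + s\<^sup>2 - s * s) * x + c * s * y"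
      using cs by (simp add: algebra_simps)
    also have "\<dots> = c * (c * x + s * y)" by (simp add: algebra_simps power2_eq_square)
    finally show ?thesis using c by (simp add: divide_simps)
  qed
  have "(\<integral>\<^sup>+x. \<integral>\<^sup>+y. F (x, y) \<partial>lborel \<partial>lborel) = (\<integral>\<^sup>+y. \<integral>\<^sup>+x. F (x, y) \<partial>lborel \<partial>lborel)"
    by (rule lborel_pair.Fubini'[symmetric]) auto
  also have "\<dots> = (\<integral>\<^sup>+y. ennreal \<bar>1/c\<bar> * (\<integral>\<^sup>+x. F (s * y / c + 1/c * x, y) \<partial>lborel) \<partial>lborel)"
    using c by (intro nn_integral_cong nn_integral_real_affine) auto
  also have "\<dots> = ennreal \<bar>1/c\<bar> * (\<integral>\<^sup>+y. \<integral>\<^sup>+x. F (s * y / c + 1/c * x, y) \<partial>lborel \<partial>lborel)"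
    by (rule nn_integral_cmult) auto
  also have "(\<integral>\<^sup>+y. \<integral>\<^sup>+x. F (s * y / c + 1/c * x, y) \<partial>lborel \<partial>lborel) =
     (\<integral>\<^sup>+x. \<integral>\<^sup>+y. F (s * y / c + 1/c * x, y) \<partial>lborel \<partial>lborel)"
    by (rule lborel_pair.Fubini') auto
  also have "\<dots> = (\<integral>\<^sup>+x. ennreal \<bar>c\<bar> * (\<integral>\<^sup>+y. F (s * (- s * x + c * y) / c + 1/c * x, - s * x + c * y) \<partial>lborel) \<partial>lborel)"
    using c by (intro nn_integral_cong nn_integral_real_affine) auto
  also have "\<dots> = ennreal \<bar>c\<bar> * (\<integral>\<^sup>+x. \<integral>\<^sup>+y. F (c * x + s * y, - s * x + c * y) \<partial>lborel \<partial>lborel)"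
    unfolding arg by (rule nn_integral_cmult) auto
  also have "ennreal \<bar>1/c\<bar> * (ennreal \<bar>c\<bar> * (\<integral>\<^sup>+x. \<integral>\<^sup>+y. F (c * x + s * y, - s * x + c * y) \<partial>lborel \<partial>lborel)) =
    (\<integral>\<^sup>+x. \<integral>\<^sup>+y. F (c * x + s * y, - s * x + c * y) \<partial>lborel \<partial>lborel)"
    using c by (subst mult.assoc[symmetric], subst ennreal_mult[symmetric]) (auto simp: abs_divide)
  finally show ?thesis by (simp add: algebra_simps)
qed

abbreviation centred_normal :: "real \<Rightarrow> real measure" where
  "centred_normal \<sigma> \<equiv> density lborel (normal_density 0 \<sigma>)"

text \<open>The product density depends only on x^2 + y^2, which rotations preserve.\<close>

lemma nn_integral_normal_rotation:
  assumes [measurable]: "f \<in> borel_measurable (borel \<Otimes>\<^sub>M borel)" and cs: "c\<^sup>2 + s\<^sup>2 = 1"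
  shows "(\<integral>\<^sup>+x. \<integral>\<^sup>+y. f (c * x + s * y, c * y - s * x) \<partial>centred_normal \<sigma> \<partial>centred_normal \<sigma>) =
    (\<integral>\<^sup>+x. \<integral>\<^sup>+y. f (x, y) \<partial>centred_normal \<sigma> \<partial>centred_normal \<sigma>)"
proof -
  define F where "F = (\<lambda>(x, y). ennreal (normal_density 0 \<sigma> x * normal_density 0 \<sigma> y) * f (x, y))"
  have [measurable]: "F \<in> borel_measurable (borel \<Otimes>\<^sub>M borel)"
    unfolding F_def by measurable
  have rot: "normal_density 0 \<sigma> (c * x + s * y) * normal_density 0 \<sigma> (c * y - s * x) =
      normal_density 0 \<sigma> x * normal_density 0 \<sigma> y" for x y
  proof -
    have "(c * x + s * y)\<^sup>2 + (c * y - s * x)\<^sup>2 = (c\<^sup>2 + s\<^sup>2) * (x\<^sup>2 + y\<^sup>2)"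
      by (simp add: algebra_simps power2_eq_square)
    then have "(c * x + s * y)\<^sup>2 + (c * y - s * x)\<^sup>2 = x\<^sup>2 + y\<^sup>2" using cs by simp
    then have "- ((c * x + s * y)\<^sup>2 / (2 * \<sigma>\<^sup>2)) + - ((c * y - s * x)\<^sup>2 / (2 * \<sigma>\<^sup>2)) = - (x\<^sup>2 / (2 * \<sigma>\<^sup>2)) + - (y\<^sup>2 / (2 * \<sigma>\<^sup>2))"
      by (metis add_divide_distrib minus_add_distrib)
    then show ?thesis by (simp add: normal_density_def exp_add[symmetric])
  qed
  have *: "(\<integral>\<^sup>+x. \<integral>\<^sup>+y. g (x, y) \<partial>centred_normal \<sigma> \<partial>centred_normal \<sigma>) =
    (\<integral>\<^sup>+x. \<integral>\<^sup>+y. ennreal (normal_density 0 \<sigma> x * normal_density 0 \<sigma> y) * g (x, y) \<partial>lborel \<partial>lborel)"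
    if [measurable]: "g \<in> borel_measurable (borel \<Otimes>\<^sub>M borel)" for g :: "real \<times> real \<Rightarrow> ennreal"
    by (simp add: nn_integral_density nn_integral_cmult[symmetric] ennreal_mult mult.assoc)
  show ?thesis
    using nn_integral_lborel_rotation[OF _ cs, of F]
      *[of f] *[of "\<lambda>(x, y). f (c * x + s * y, c * y - s * x)"]
    by (simp add: F_def rot)
qed

text \<open>Weighting a centred normal law with exp(l x^2) gives a multiple of another one, with
  variance \<sigma>^2/(1 - 2 l \<sigma>^2). A positive \<open>l\<close> serves exponential moments,
  a negative one the computation of the complex mean modulus.\<close>

lemma nn_integral_normal_exp_square:
  assumes \<sigma>: "0 < \<sigma>" and l: "2 * l * \<sigma>\<^sup>2 < 1"
    and [measurable]: "f \<in> borel_measurable borel"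
  shows "(\<integral>\<^sup>+x. ennreal (exp (l * x\<^sup>2)) * f x \<partial>centred_normal \<sigma>) =
    ennreal (1 / sqrt (1 - 2 * l * \<sigma>\<^sup>2)) * (\<integral>\<^sup>+x. f x \<partial>centred_normal (\<sigma> / sqrt (1 - 2 * l * \<sigma>\<^sup>2)))"
proof -
  define k where "k = 1 - 2 * l * \<sigma>\<^sup>2"
  have k: "k > 0" using l by (simp add: k_def)
  have d: "normal_density 0 \<sigma> x * exp (l * x\<^sup>2) = 1 / sqrt k * normal_density 0 (\<sigma> / sqrt k) x" for x
  proof -
    have "- (x\<^sup>2 / (2 * \<sigma>\<^sup>2)) + l * x\<^sup>2 = - (k * x\<^sup>2 / (2 * \<sigma>\<^sup>2))"
      using \<sigma> by (simp add: k_def field_simps)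
    then show ?thesis using k \<sigma>
      by (simp add: normal_density_def exp_add[symmetric] power_divide real_sqrt_mult real_sqrt_divide field_simps)
  qed
  have "(\<integral>\<^sup>+x. ennreal (exp (l * x\<^sup>2)) * f x \<partial>centred_normal \<sigma>) =
     (\<integral>\<^sup>+x. ennreal (normal_density 0 \<sigma> x * exp (l * x\<^sup>2)) * f x \<partial>lborel)"
    by (simp add: nn_integral_density ennreal_mult mult.assoc)
  also have "\<dots> = (\<integral>\<^sup>+x. ennreal (1 / sqrt k) * (ennreal (normal_density 0 (\<sigma> / sqrt k) x) * f x) \<partial>lborel)"
    unfolding d using k by (subst ennreal_mult) (auto simp: mult.assoc)
  also have "\<dots> = ennreal (1 / sqrt k) * (\<integral>\<^sup>+x. f x \<partial>centred_normal (\<sigma> / sqrt k))"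
    by (simp add: nn_integral_cmult nn_integral_density)
  finally show ?thesis by (simp add: k_def)
qed

lemma prob_space_centred_normal: "0 < \<sigma> \<Longrightarrow> prob_space (centred_normal \<sigma>)"
  by (rule prob_space_normal_density)

lemma nn_integral_normal_square:
  assumes "0 < \<sigma>"
  shows "(\<integral>\<^sup>+x. ennreal (x\<^sup>2) \<partial>centred_normal \<sigma>) = ennreal (\<sigma>\<^sup>2)"
proof -
  have "has_bochner_integral lborel (\<lambda>x. normal_density 0 \<sigma> x * x\<^sup>2) (\<sigma>\<^sup>2)"
    using normal_moment_even[OF assms, of 0 1] by (simp add: fact_numeral)
  then have "(\<integral>\<^sup>+x. ennreal (normal_density 0 \<sigma> x * x\<^sup>2) \<partial>lborel) = ennreal (\<sigma>\<^sup>2)"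
    by (intro nn_integral_has_integral_lebesgue nn_integral_eq_integral[THEN trans])
       (auto simp: has_bochner_integral_iff)
  then show ?thesis by (simp add: nn_integral_density ennreal_mult)
qed

lemma nn_integral_normal_abs:
  assumes "0 < \<sigma>"
  shows "(\<integral>\<^sup>+x. ennreal \<bar>x\<bar> \<partial>centred_normal \<sigma>) = ennreal (\<sigma> * sqrt (2 / pi))"
proof -
  have "has_bochner_integral lborel (\<lambda>x. normal_density 0 \<sigma> x * \<bar>x\<bar>) (\<sigma> * sqrt (2 / pi))"
    using normal_moment_abs_odd[OF assms, of 0 0] by (simp add: fact_numeral)
  then have "(\<integral>\<^sup>+x. ennreal (normal_density 0 \<sigma> x * \<bar>x\<bar>) \<partial>lborel) = ennreal (\<sigma> * sqrt (2 / pi))"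
    by (intro nn_integral_eq_integral[THEN trans])
       (auto simp: has_bochner_integral_iff)
  then show ?thesis by (simp add: nn_integral_density ennreal_mult)
qed

lemma emeasure_centred_normal_UNIV [simp]: "0 < \<sigma> \<Longrightarrow> emeasure (centred_normal \<sigma>) UNIV = 1"
  using prob_space.emeasure_space_1[OF prob_space_centred_normal, of \<sigma>] by simp

lemma emeasure_centred_normal_singleton: "emeasure (centred_normal \<sigma>) {a} = 0"
proof -
  have "AE x in lborel. ennreal (normal_density 0 \<sigma> x) * indicator {a} x = 0"
    using AE_lborel_singleton[of a] by eventually_elim auto
  then show ?thesis by (simp add: emeasure_density nn_integral_0_iff_AE)
qed

lemma integral_eq_of_nn_integral:
  assumes "f \<in> borel_measurable M" "\<And>x. 0 \<le> f x" "(\<integral>\<^sup>+x. ennreal (f x) \<partial>M) = ennreal t" "0 \<le> t"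
  shows "(\<integral>x. f x \<partial>M) = t"
  using has_bochner_integral_nn_integral[of f M t] assms by (simp add: has_bochner_integral_iff)

lemma gaussian_law_real: "gaussian_law gaussian_real (\<lambda>x. x) (2 / pi)"
proof -
  interpret prob_space gaussian_real
    unfolding gaussian_real_def by (rule prob_space_centred_normal) simp
  have second: "(\<integral>\<^sup>+x. ennreal (x\<^sup>2) \<partial>gaussian_real) = 1"
    using nn_integral_normal_square[of 1] by (simp add: gaussian_real_def)
  show ?thesis
  proof
    show "(\<integral>\<^sup>+x. \<integral>\<^sup>+y. f (of_real c * x + s * y, of_real c * y - s * x) \<partial>gaussian_real \<partial>gaussian_real) =
      (\<integral>\<^sup>+x. \<integral>\<^sup>+y. f (x, y) \<partial>gaussian_real \<partial>gaussian_real)"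
      if "f \<in> borel_measurable (borel \<Otimes>\<^sub>M borel)" "c\<^sup>2 + (norm s)\<^sup>2 = 1" for f :: "real \<times> real \<Rightarrow> ennreal" and c s
      using nn_integral_normal_rotation[of f c s 1] that by (simp add: gaussian_real_def)
    show "(\<integral>\<^sup>+x. ennreal (exp ((norm x)\<^sup>2 / 4)) \<partial>gaussian_real) \<le> 2"
    proof -
      have "(\<integral>\<^sup>+x. ennreal (exp ((norm x)\<^sup>2 / 4)) \<partial>gaussian_real) = ennreal (1 / sqrt (1 / 2))"
        using nn_integral_normal_exp_square[of 1 "1 / 4" "\<lambda>_. 1"] by (simp add: gaussian_real_def)
      also have "\<dots> \<le> ennreal 2"
        by (intro ennreal_leI) (simp add: real_sqrt_divide real_le_lsqrt)
      finally show ?thesis by simp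
    qed
    show "(\<integral>\<^sup>+x. ennreal (norm x) \<partial>gaussian_real) = ennreal (sqrt (2 / pi))"
      using nn_integral_normal_abs[of 1] by (simp add: gaussian_real_def)
    show "emeasure gaussian_real {0} = 0"
      unfolding gaussian_real_def by (rule emeasure_centred_normal_singleton)
    show "1 / 2 \<le> (\<integral>x. (x \<bullet> w)\<^sup>2 \<partial>gaussian_real)" if "norm w = 1" for w
    proof -
      have "w\<^sup>2 = 1" using that by (simp add: abs_square_eq_1)
      then have "(\<integral>x. (x \<bullet> w)\<^sup>2 \<partial>gaussian_real) = (\<integral>x. x\<^sup>2 \<partial>gaussian_real)"
        by (simp add: power_mult_distrib)
      also have "\<dots> = 1"
        by (rule integral_eq_of_nn_integral) (use second in \<open>auto simp: gaussian_real_def\<close>)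
      finally show ?thesis by simp
    qed
    show "1 / 2 < 2 / pi" "2 / pi \<le> 4 / 5" using pi_less_4 pi_gt3 by (auto simp: field_simps)
  qed (use second in \<open>auto simp: gaussian_real_def power2_eq_square\<close>)
qed

section \<open>The complex law and its mean modulus\<close>

abbreviation half_normal :: "real measure" where
  "half_normal \<equiv> centred_normal (sqrt (1 / 2))"

lemma measurable_Complex [measurable (raw)]:
  assumes [measurable]: "f \<in> borel_measurable M" "g \<in> borel_measurable M"
  shows "(\<lambda>x. Complex (f x) (g x)) \<in> borel_measurable M"
  unfolding Complex_eq by measurable

lemma sets_gaussian_complex [simp, measurable_cong]: "sets gaussian_complex = sets borel"
  by (simp add: gaussian_complex_def)

lemma prob_space_gaussian_complex: "prob_space gaussian_complex"
proof -
  interpret prob_space half_normal by (rule prob_space_centred_normal) simp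
  interpret pair_prob_space half_normal half_normal ..
  have "(\<lambda>(a, b). Complex a b) \<in> borel_measurable (half_normal \<Otimes>\<^sub>M half_normal)" by measurable
  then show ?thesis unfolding gaussian_complex_def by (rule P.prob_space_distr)
qed

interpretation half_normal: prob_space half_normal
  by (rule prob_space_centred_normal) simp

interpretation half_normal_pair: pair_prob_space half_normal half_normal ..

lemma nn_integral_gaussian_complex:
  assumes [measurable]: "f \<in> borel_measurable borel"
  shows "(\<integral>\<^sup>+z. f z \<partial>gaussian_complex) = (\<integral>\<^sup>+a. \<integral>\<^sup>+b. f (Complex a b) \<partial>half_normal \<partial>half_normal)"
proof -
  have "(\<integral>\<^sup>+z. f z \<partial>gaussian_complex) = (\<integral>\<^sup>+p. f (case p of (a, b) \<Rightarrow> Complex a b) \<partial>(half_normal \<Otimes>\<^sub>M half_normal))"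
    unfolding gaussian_complex_def by (rule nn_integral_distr) measurable
  also have "\<dots> = (\<integral>\<^sup>+a. \<integral>\<^sup>+b. f (Complex a b) \<partial>half_normal \<partial>half_normal)"
    by (subst half_normal.nn_integral_fst[symmetric]) auto
  finally show ?thesis .
qed

text \<open>Multiplication by a phase is a rotation of the plane of real and imaginary
  parts.\<close>

lemma nn_integral_gaussian_complex_phase:
  assumes [measurable]: "f \<in> borel_measurable borel" and e: "norm e = 1"
  shows "(\<integral>\<^sup>+z. f (e * z) \<partial>gaussian_complex) = (\<integral>\<^sup>+z. f z \<partial>gaussian_complex)"
proof -
  have "(Re e)\<^sup>2 + (- Im e)\<^sup>2 = 1" using e by (simp add: cmod_power2[symmetric])
  from nn_integral_normal_rotation[OF _ this, of "\<lambda>(a, b). f (Complex a b)" "sqrt (1 / 2)"]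
  show ?thesis by (simp add: nn_integral_gaussian_complex complex_mult algebra_simps flip: Complex_eq)
     (simp add: times_complex.ctr algebra_simps)
qed

text \<open>Real coefficients act on real and imaginary parts separately; with the four integrals
  reordered, the rotation is applied once to each pair.\<close>

lemma nn_integral_gaussian_complex_rotation_real:
  fixes f :: "complex \<times> complex \<Rightarrow> ennreal"
  assumes [measurable]: "f \<in> borel_measurable (borel \<Otimes>\<^sub>M borel)" and cr: "c\<^sup>2 + r\<^sup>2 = 1"
  shows "(\<integral>\<^sup>+x. \<integral>\<^sup>+y. f (of_real c * x + of_real r * y, of_real c * y - of_real r * x) \<partial>gaussian_complex \<partial>gaussian_complex) =
    (\<integral>\<^sup>+x. \<integral>\<^sup>+y. f (x, y) \<partial>gaussian_complex \<partial>gaussian_complex)"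
proof -
  let ?N = half_normal
  have split: "(\<integral>\<^sup>+x. \<integral>\<^sup>+y. g (x, y) \<partial>gaussian_complex \<partial>gaussian_complex) =
    (\<integral>\<^sup>+a. \<integral>\<^sup>+a'. \<integral>\<^sup>+b. \<integral>\<^sup>+b'. g (Complex a b, Complex a' b') \<partial>?N \<partial>?N \<partial>?N \<partial>?N)"
    if [measurable]: "g \<in> borel_measurable (borel \<Otimes>\<^sub>M borel)" for g :: "complex \<times> complex \<Rightarrow> ennreal"
  proof -
    have "(\<integral>\<^sup>+x. \<integral>\<^sup>+y. g (x, y) \<partial>gaussian_complex \<partial>gaussian_complex) =
      (\<integral>\<^sup>+a. \<integral>\<^sup>+b. \<integral>\<^sup>+a'. \<integral>\<^sup>+b'. g (Complex a b, Complex a' b') \<partial>?N \<partial>?N \<partial>?N \<partial>?N)"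
    proof -
      interpret gaussian_complex: prob_space gaussian_complex by (rule prob_space_gaussian_complex)
      show ?thesis by (simp add: nn_integral_gaussian_complex)
    qed
    also have "\<dots> = (\<integral>\<^sup>+a. \<integral>\<^sup>+a'. \<integral>\<^sup>+b. \<integral>\<^sup>+b'. g (Complex a b, Complex a' b') \<partial>?N \<partial>?N \<partial>?N \<partial>?N)"
      by (intro nn_integral_cong half_normal_pair.Fubini') measurable
    finally show ?thesis .
  qed
  define G where "G = (\<lambda>(a, a'). \<integral>\<^sup>+b. \<integral>\<^sup>+b'. f (Complex a b, Complex a' b') \<partial>?N \<partial>?N)"
  have G: "G \<in> borel_measurable (borel \<Otimes>\<^sub>M borel)" unfolding G_def by measurable
  have coord: "of_real c * Complex a b + of_real r * Complex a' b' = Complex (c * a + r * a') (c * b + r * b')"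
    "of_real c * Complex a' b' - of_real r * Complex a b = Complex (c * a' - r * a) (c * b' - r * b)" for a b a' b'
    by (simp_all add: complex_eq_iff)
  have "(\<integral>\<^sup>+x. \<integral>\<^sup>+y. f (of_real c * x + of_real r * y, of_real c * y - of_real r * x) \<partial>gaussian_complex \<partial>gaussian_complex) =
    (\<integral>\<^sup>+a. \<integral>\<^sup>+a'. \<integral>\<^sup>+b. \<integral>\<^sup>+b'. f (Complex (c * a + r * a') (c * b + r * b'), Complex (c * a' - r * a) (c * b' - r * b)) \<partial>?N \<partial>?N \<partial>?N \<partial>?N)"
    using split[of "\<lambda>(x, y). f (of_real c * x + of_real r * y, of_real c * y - of_real r * x)"] by (simp add: coord)
  also have "\<dots> = (\<integral>\<^sup>+a. \<integral>\<^sup>+a'. G (c * a + r * a', c * a' - r * a) \<partial>?N \<partial>?N)"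
  proof (intro nn_integral_cong)
    fix a a' :: real
    show "(\<integral>\<^sup>+b. \<integral>\<^sup>+b'. f (Complex (c * a + r * a') (c * b + r * b'), Complex (c * a' - r * a) (c * b' - r * b)) \<partial>?N \<partial>?N) =
      G (c * a + r * a', c * a' - r * a)"
      using nn_integral_normal_rotation[OF _ cr, of "\<lambda>(b, b'). f (Complex (c * a + r * a') b, Complex (c * a' - r * a) b')" "sqrt (1 / 2)"]
      by (simp add: G_def)
  qed
  also have "\<dots> = (\<integral>\<^sup>+a. \<integral>\<^sup>+a'. G (a, a') \<partial>?N \<partial>?N)"
    by (rule nn_integral_normal_rotation[OF G cr])
  also have "\<dots> = (\<integral>\<^sup>+x. \<integral>\<^sup>+y. f (x, y) \<partial>gaussian_complex \<partial>gaussian_complex)"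
    by (simp add: split G_def)
  finally show ?thesis .
qed

text \<open>Writing s = r e with a phase \<open>e\<close> reduces this to real coefficients:
  \<open>e\<close> is absorbed into \<open>y\<close> before the rotation, and \<open>cnj e\<close>
  is removed from the second coordinate after it, both by phase invariance.\<close>

lemma nn_integral_gaussian_complex_rotation:
  fixes f :: "complex \<times> complex \<Rightarrow> ennreal"
  assumes [measurable]: "f \<in> borel_measurable (borel \<Otimes>\<^sub>M borel)" and cs: "c\<^sup>2 + (norm s)\<^sup>2 = 1"
  shows "(\<integral>\<^sup>+x. \<integral>\<^sup>+y. f (of_real c * x + s * y, of_real c * y - cnj s * x) \<partial>gaussian_complex \<partial>gaussian_complex) =
    (\<integral>\<^sup>+x. \<integral>\<^sup>+y. f (x, y) \<partial>gaussian_complex \<partial>gaussian_complex)"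
proof -
  interpret gaussian_complex: prob_space gaussian_complex by (rule prob_space_gaussian_complex)
  define r where "r = norm s"
  define e where "e = (if s = 0 then 1 else s / of_real r)"
  have e: "norm e = 1" "s = of_real r * e" by (auto simp: e_def r_def norm_divide)
  have ee: "cnj e * e = 1" using e(1) complex_norm_square[of e] by (simp add: mult.commute)
  have cy: "of_real c * y - cnj s * x = cnj e * (of_real c * (e * y) - of_real r * x)" for x y
  proof -
    have "cnj e * (of_real c * (e * y) - of_real r * x) = (cnj e * e) * (of_real c * y) - of_real r * cnj e * x"
      by (simp add: algebra_simps)
    then show ?thesis unfolding ee e(2) by simp
  qed
  have "(\<integral>\<^sup>+x. \<integral>\<^sup>+y. f (of_real c * x + s * y, of_real c * y - cnj s * x) \<partial>gaussian_complex \<partial>gaussian_complex) =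
    (\<integral>\<^sup>+x. \<integral>\<^sup>+y. f (of_real c * x + of_real r * (e * y), cnj e * (of_real c * (e * y) - of_real r * x)) \<partial>gaussian_complex \<partial>gaussian_complex)"
    unfolding cy by (simp only: e(2) mult.assoc)
  also have "\<dots> = (\<integral>\<^sup>+x. \<integral>\<^sup>+y. f (of_real c * x + of_real r * y, cnj e * (of_real c * y - of_real r * x)) \<partial>gaussian_complex \<partial>gaussian_complex)"
    by (rule nn_integral_cong, rule nn_integral_gaussian_complex_phase[OF _ e(1)]) measurable
  also have "\<dots> = (\<integral>\<^sup>+x. \<integral>\<^sup>+y. f (x, cnj e * y) \<partial>gaussian_complex \<partial>gaussian_complex)"
    using nn_integral_gaussian_complex_rotation_real[of "\<lambda>(u, v). f (u, cnj e * v)" c r] cs by (simp add: r_def)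
  also have "\<dots> = (\<integral>\<^sup>+x. \<integral>\<^sup>+y. f (x, y) \<partial>gaussian_complex \<partial>gaussian_complex)"
    using e(1) by (intro nn_integral_cong nn_integral_gaussian_complex_phase) auto
  finally show ?thesis .
qed

lemma nn_integral_half_normal_square: "(\<integral>\<^sup>+a. ennreal (a\<^sup>2) \<partial>half_normal) = ennreal (1 / 2)"
  using nn_integral_normal_square[of "sqrt (1 / 2)"] by simp

lemma nn_integral_gaussian_complex_square: "(\<integral>\<^sup>+z. ennreal ((norm z)\<^sup>2) \<partial>gaussian_complex) = 1"
proof -
  have "(\<integral>\<^sup>+z. ennreal ((norm z)\<^sup>2) \<partial>gaussian_complex) = (\<integral>\<^sup>+a. \<integral>\<^sup>+b. ennreal (a\<^sup>2) + ennreal (b\<^sup>2) \<partial>half_normal \<partial>half_normal)"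
    by (subst nn_integral_gaussian_complex) (auto simp: cmod_power2)
  also have "\<dots> = ennreal (1 / 2) + ennreal (1 / 2)"
    by (simp add: nn_integral_add nn_integral_half_normal_square)
  also have "\<dots> = ennreal (1 / 2 + 1 / 2)" by (rule ennreal_plus[symmetric]) auto
  also have "\<dots> = 1" by simp
  finally show ?thesis .
qed

lemma nn_integral_gaussian_complex_exp_square:
  assumes "l < 1"
  shows "(\<integral>\<^sup>+z. ennreal (exp (l * (norm z)\<^sup>2)) \<partial>gaussian_complex) = ennreal (1 / (1 - l))"
proof -
  have *: "(\<integral>\<^sup>+a. ennreal (exp (l * a\<^sup>2)) \<partial>half_normal) = ennreal (1 / sqrt (1 - l))"
    using nn_integral_normal_exp_square[of "sqrt (1 / 2)" l "\<lambda>_. 1"] assms by simp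
  have "(\<integral>\<^sup>+z. ennreal (exp (l * (norm z)\<^sup>2)) \<partial>gaussian_complex) =
    (\<integral>\<^sup>+a. \<integral>\<^sup>+b. ennreal (exp (l * a\<^sup>2)) * ennreal (exp (l * b\<^sup>2)) \<partial>half_normal \<partial>half_normal)"
    by (subst nn_integral_gaussian_complex) (auto simp: cmod_power2 distrib_left exp_add ennreal_mult)
  also have "\<dots> = ennreal (1 / sqrt (1 - l)) * ennreal (1 / sqrt (1 - l))"
    by (simp add: nn_integral_cmult nn_integral_multc *)
  also have "\<dots> = ennreal (1 / (1 - l))"
    using assms by (simp flip: ennreal_mult)
  finally show ?thesis .
qed

text \<open>The integrand for the subordination formula below. Splitting |z|^2 into a^2 + b^2 leaves
  products of weighted one-dimensional moments.\<close>

lemma nn_integral_gaussian_complex_square_exp: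
  "(\<integral>\<^sup>+z. ennreal ((norm z)\<^sup>2 * exp (- s\<^sup>2 * (norm z)\<^sup>2)) \<partial>gaussian_complex) = ennreal (1 / (1 + s\<^sup>2)\<^sup>2)"
proof -
  define t where "t = sqrt (1 + s\<^sup>2)"
  have t: "0 < t" "t\<^sup>2 = 1 + s\<^sup>2" by (auto simp: t_def add_pos_nonneg)
  have B: "(\<integral>\<^sup>+a. ennreal (exp (- (s\<^sup>2 * a\<^sup>2))) \<partial>half_normal) = ennreal (1 / t)"
    using nn_integral_normal_exp_square[of "sqrt (1 / 2)" "- s\<^sup>2" "\<lambda>_. 1"] t(1)
    by (simp add: t_def add_nonneg_pos less_le_trans[OF _ zero_le_power2])
  have A: "(\<integral>\<^sup>+a. ennreal (exp (- (s\<^sup>2 * a\<^sup>2))) * ennreal (a\<^sup>2) \<partial>half_normal) = ennreal (1 / (2 * t ^ 3))"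
  proof -
    have "(\<integral>\<^sup>+a. ennreal (exp (- (s\<^sup>2 * a\<^sup>2))) * ennreal (a\<^sup>2) \<partial>half_normal) =
      ennreal (1 / t) * (\<integral>\<^sup>+a. ennreal (a\<^sup>2) \<partial>centred_normal (sqrt (1 / 2) / t))"
      using nn_integral_normal_exp_square[of "sqrt (1 / 2)" "- s\<^sup>2" "\<lambda>a. ennreal (a\<^sup>2)"]
      by (simp add: t_def less_le_trans[OF _ zero_le_power2])
    also have "\<dots> = ennreal (1 / t) * ennreal (1 / 2 / t\<^sup>2)"
      using t(1) by (simp add: nn_integral_normal_square power_divide)
    also have "\<dots> = ennreal (1 / (2 * t ^ 3))"
      using t(1) by (simp add: power2_eq_square power3_eq_cube flip: ennreal_mult)
    finally show ?thesis .
  qed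
  have "(\<integral>\<^sup>+z. ennreal ((norm z)\<^sup>2 * exp (- s\<^sup>2 * (norm z)\<^sup>2)) \<partial>gaussian_complex) =
    (\<integral>\<^sup>+a. \<integral>\<^sup>+b. (ennreal (exp (- (s\<^sup>2 * a\<^sup>2))) * ennreal (a\<^sup>2)) * ennreal (exp (- (s\<^sup>2 * b\<^sup>2))) +
      ennreal (exp (- (s\<^sup>2 * a\<^sup>2))) * (ennreal (exp (- (s\<^sup>2 * b\<^sup>2))) * ennreal (b\<^sup>2)) \<partial>half_normal \<partial>half_normal)"
    by (subst nn_integral_gaussian_complex)
       (auto simp: cmod_power2 exp_add[symmetric] algebra_simps simp flip: ennreal_mult ennreal_plus)
  also have "\<dots> = ennreal (1 / (2 * t ^ 3)) * ennreal (1 / t) + ennreal (1 / t) * ennreal (1 / (2 * t ^ 3))"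
    by (simp add: nn_integral_add nn_integral_cmult nn_integral_multc A B)
  also have "\<dots> = ennreal (1 / (1 + s\<^sup>2)\<^sup>2)"
    unfolding t(2)[symmetric] using t(1)
    by (simp add: power2_eq_square power3_eq_cube flip: ennreal_mult ennreal_plus)
  finally show ?thesis .
qed

lemma nn_integral_half_line_exp_square:
  assumes "0 < k"
  shows "(\<integral>\<^sup>+s. indicator {0..} s * ennreal (exp (- s\<^sup>2 * k\<^sup>2)) \<partial>lborel) = ennreal (sqrt pi / (2 * k))"
proof -
  have "(\<integral>\<^sup>+s. ennreal (indicator {0..} s *\<^sub>R exp (- s\<^sup>2)) \<partial>lborel) = ennreal (sqrt pi / 2)"
    using gaussian_moment_0
    by (intro nn_integral_eq_integral[THEN trans]) (auto simp: has_bochner_integral_iff)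
  also have "(\<integral>\<^sup>+s. ennreal (indicator {0..} s *\<^sub>R exp (- s\<^sup>2)) \<partial>lborel) =
    ennreal \<bar>k\<bar> * (\<integral>\<^sup>+s. ennreal (indicator {0..} (0 + k * s) *\<^sub>R exp (- (0 + k * s)\<^sup>2)) \<partial>lborel)"
    using assms by (intro nn_integral_real_affine) auto
  also have "(\<integral>\<^sup>+s. ennreal (indicator {0..} (0 + k * s) *\<^sub>R exp (- (0 + k * s)\<^sup>2)) \<partial>lborel) =
    (\<integral>\<^sup>+s. indicator {0..} s * ennreal (exp (- s\<^sup>2 * k\<^sup>2)) \<partial>lborel)"
    using assms
    by (intro nn_integral_cong) (auto simp: indicator_def power_mult_distrib zero_le_mult_iff mult.commute)
  finally have "ennreal k * (\<integral>\<^sup>+s. indicator {0..} s * ennreal (exp (- s\<^sup>2 * k\<^sup>2)) \<partial>lborel) = ennreal (sqrt pi / 2)"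
    using assms by simp
  then have "ennreal (1 / k) * (ennreal k * (\<integral>\<^sup>+s. indicator {0..} s * ennreal (exp (- s\<^sup>2 * k\<^sup>2)) \<partial>lborel)) =
    ennreal (1 / k) * ennreal (sqrt pi / 2)" by simp
  then show ?thesis
    using assms by (simp add: mult.assoc[symmetric] flip: ennreal_mult)
qed

lemma nn_integral_inverse_quadratic_sq:
  "(\<integral>\<^sup>+s. indicator {0..} s * ennreal (1 / (1 + s\<^sup>2)\<^sup>2) \<partial>lborel) = ennreal (pi / 4)"
proof -
  \<comment> \<open>The primitive of 1/(1 + s^2)^2; it vanishes at 0 and tends to \<pi>/4.\<close>
  define F where "F s = (s / (1 + s\<^sup>2) + arctan s) / 2" for s :: real
  have pos: "1 + s\<^sup>2 \<noteq> 0" for s :: real by (simp add: add_nonneg_eq_0_iff)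
  have "(\<integral>\<^sup>+s. ennreal (1 / (1 + s\<^sup>2)\<^sup>2) * indicator {0..} s \<partial>lborel) = pi / 4 - F 0"
  proof (rule nn_integral_FTC_atLeast)
    show "DERIV F s :> 1 / (1 + s\<^sup>2)\<^sup>2" for s
    proof -
      have "DERIV F s :> (((1 + s\<^sup>2) - s * (2 * s)) / ((1 + s\<^sup>2) * (1 + s\<^sup>2)) + inverse (1 + s\<^sup>2)) / 2"
        unfolding F_def[abs_def] using pos[of s]
        by (auto intro!: derivative_eq_intros)
      also have "(((1 + s\<^sup>2) - s * (2 * s)) / ((1 + s\<^sup>2) * (1 + s\<^sup>2)) + inverse (1 + s\<^sup>2)) / 2 = 1 / (1 + s\<^sup>2)\<^sup>2"
        using pos[of s] by (simp add: divide_simps) (simp add: algebra_simps power2_eq_square)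
      finally show ?thesis .
    qed
    have "((\<lambda>s::real. s / (1 + s\<^sup>2)) \<longlongrightarrow> 0) at_top" by real_asymp
    then have "(F \<longlongrightarrow> (0 + pi / 2) / 2) at_top"
      unfolding F_def[abs_def] by (intro tendsto_intros tendsto_arctan_at_top) auto
    then show "(F \<longlongrightarrow> pi / 4) at_top" by simp
  qed auto
  then show ?thesis by (simp add: F_def mult.commute)
qed

text \<open>Subordination: \<open>\<bar>z\<bar> = 2 / sqrt \<pi> * (\<integral> \<bar>z\<bar>\<^sup>2 * exp (- s\<^sup>2 * \<bar>z\<bar>\<^sup>2) ds)\<close> over \<open>s \<ge> 0\<close> avoids polar coordinates.\<close>

lemma nn_integral_gaussian_complex_norm:
  "(\<integral>\<^sup>+z. ennreal (norm z) \<partial>gaussian_complex) = ennreal (sqrt (pi / 4))"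
proof -
  interpret gaussian_complex: prob_space gaussian_complex by (rule prob_space_gaussian_complex)
  interpret pair_sigma_finite gaussian_complex lborel ..
  let ?k = "2 / sqrt pi"
  have norm_eq: "ennreal (norm z) =
    ennreal ?k * (\<integral>\<^sup>+s. indicator {0..} s * ennreal ((norm z)\<^sup>2 * exp (- s\<^sup>2 * (norm z)\<^sup>2)) \<partial>lborel)" for z :: complex
  proof (cases "z = 0")
    case False
    have "(\<integral>\<^sup>+s. indicator {0..} s * ennreal ((norm z)\<^sup>2 * exp (- s\<^sup>2 * (norm z)\<^sup>2)) \<partial>lborel) =
      ennreal ((norm z)\<^sup>2) * (\<integral>\<^sup>+s. indicator {0..} s * ennreal (exp (- s\<^sup>2 * (norm z)\<^sup>2)) \<partial>lborel)"
      by (subst nn_integral_cmult[symmetric]) (auto simp: ennreal_mult mult_ac)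
    also have "\<dots> = ennreal ((norm z)\<^sup>2) * ennreal (sqrt pi / (2 * norm z))"
      using False by (subst nn_integral_half_line_exp_square) auto
    finally show ?thesis
      using False by (simp add: power2_eq_square flip: ennreal_mult)
  qed simp
  have "(\<integral>\<^sup>+z. ennreal (norm z) \<partial>gaussian_complex) =
    ennreal ?k * (\<integral>\<^sup>+z. \<integral>\<^sup>+s. indicator {0..} s * ennreal ((norm z)\<^sup>2 * exp (- s\<^sup>2 * (norm z)\<^sup>2)) \<partial>lborel \<partial>gaussian_complex)"
    unfolding norm_eq by (rule nn_integral_cmult) measurable
  also have "(\<integral>\<^sup>+z. \<integral>\<^sup>+s. indicator {0..} s * ennreal ((norm z)\<^sup>2 * exp (- s\<^sup>2 * (norm z)\<^sup>2)) \<partial>lborel \<partial>gaussian_complex) =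
    (\<integral>\<^sup>+s. \<integral>\<^sup>+z. indicator {0..} s * ennreal ((norm z)\<^sup>2 * exp (- s\<^sup>2 * (norm z)\<^sup>2)) \<partial>gaussian_complex \<partial>lborel)"
    by (rule Fubini'[symmetric]) measurable
  also have "\<dots> = (\<integral>\<^sup>+s. indicator {0..} s * ennreal (1 / (1 + s\<^sup>2)\<^sup>2) \<partial>lborel)"
    by (intro nn_integral_cong) (subst nn_integral_cmult, auto simp: nn_integral_gaussian_complex_square_exp[simplified])
  also have "\<dots> = ennreal (pi / 4)" by (rule nn_integral_inverse_quadratic_sq)
  also have "ennreal ?k * ennreal (pi / 4) = ennreal (?k * (pi / 4))" by (rule ennreal_mult[symmetric]) auto
  also have "?k * (pi / 4) = sqrt (pi / 4)"
  proof -
    have "?k * (pi / 4) = pi / sqrt pi / 2" by simp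
    also have "\<dots> = sqrt pi / 2" by (simp only: real_div_sqrt pi_ge_zero)
    also have "\<dots> = sqrt (pi / 4)" by (simp add: real_sqrt_divide)
    finally show ?thesis .
  qed
  finally show ?thesis .
qed

lemma gaussian_law_complex: "gaussian_law gaussian_complex cnj (pi / 4)"
proof -
  interpret prob_space gaussian_complex by (rule prob_space_gaussian_complex)
  show ?thesis
  proof
    show "(\<integral>\<^sup>+z. ennreal (exp ((norm z)\<^sup>2 / 4)) \<partial>gaussian_complex) \<le> 2"
    proof -
      have "(\<integral>\<^sup>+z. ennreal (exp ((norm z)\<^sup>2 / 4)) \<partial>gaussian_complex) = ennreal (4 / 3)"
        using nn_integral_gaussian_complex_exp_square[of "1 / 4"] by simp
      also have "\<dots> \<le> ennreal 2" by (intro ennreal_leI) simp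
      finally show ?thesis by simp
    qed
    show "emeasure gaussian_complex {0} = 0"
    proof -
      \<comment> \<open>The atom is excluded already by the real part, whose law has a
        density.\<close>
      have "emeasure gaussian_complex {0} = (\<integral>\<^sup>+z. indicator {0} z \<partial>gaussian_complex)" by simp
      also have "\<dots> \<le> (\<integral>\<^sup>+a. \<integral>\<^sup>+b. indicator {0} a \<partial>half_normal \<partial>half_normal)"
        by (subst nn_integral_gaussian_complex)
           (auto intro!: nn_integral_mono simp: indicator_def complex_eq_iff simp del: nn_integral_const)
      also have "\<dots> = emeasure half_normal {0}" by simp
      also have "\<dots> = 0" by (rule emeasure_centred_normal_singleton)
      finally show ?thesis by simp
    qed
    show "1 / 2 \<le> (\<integral>z. (z \<bullet> w)\<^sup>2 \<partial>gaussian_complex)" if "norm w = 1" for w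
    proof -
      \<comment> \<open>The inner product is the real part of \<open>cnj w * z\<close>, so phase
        invariance reduces every direction to the real axis, of variance 1/2.\<close>
      have "(\<integral>z. (z \<bullet> w)\<^sup>2 \<partial>gaussian_complex) = 1 / 2"
      proof (rule integral_eq_of_nn_integral)
        have "(\<integral>\<^sup>+z. ennreal ((z \<bullet> w)\<^sup>2) \<partial>gaussian_complex) = (\<integral>\<^sup>+z. ennreal ((Re (cnj w * z))\<^sup>2) \<partial>gaussian_complex)"
          by (simp add: inner_complex_def mult.commute)
        also have "\<dots> = (\<integral>\<^sup>+z. ennreal ((Re z)\<^sup>2) \<partial>gaussian_complex)"
          using that by (intro nn_integral_gaussian_complex_phase) auto
        also have "\<dots> = ennreal (1 / 2)"
          by (subst nn_integral_gaussian_complex) (auto simp: nn_integral_half_normal_square)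
        finally show "(\<integral>\<^sup>+z. ennreal ((z \<bullet> w)\<^sup>2) \<partial>gaussian_complex) = ennreal (1 / 2)" .
      qed auto
      then show ?thesis by simp
    qed
    show "1 / 2 < pi / 4" "pi / 4 \<le> 4 / 5" using pi_gt3 pi_approx by auto
    show "x * cnj x = of_real ((norm x)\<^sup>2)" for x by (rule complex_norm_square[symmetric])
  qed (simp_all add: nn_integral_gaussian_complex_rotation nn_integral_gaussian_complex_square
        nn_integral_gaussian_complex_norm)
qed

theorem corollary4p4:
  "\<exists>C c :: real. C > 0 \<and> c > 0 \<and>
    (\<forall>(m::nat) (d::nat) (\<delta>::real) (x0 :: real Matrix.vec) (\<eta> :: real Matrix.vec).
      m \<ge> 1 \<and> d \<ge> 1 \<and> 0 < \<delta> \<and> \<delta> < 0.05 \<and> x0 \<in> carrier_vec d \<and> \<eta> \<in> carrier_vec m \<and>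
      real m \<ge> C * ln (1 / \<delta>) * (1 / \<delta>\<^sup>2) * real d \<longrightarrow>
      \<P>(\<omega> in iid_rows gaussian_real m d.
          \<forall>xh. is_arg_min (amplitude_loss (matrix_of m d \<omega>) x0 \<eta>) (\<lambda>x. x \<in> carrier_vec d) xh \<longrightarrow>
            phase_dist xh x0 \<le> 2 * beta0_real / (1 - \<delta>) * (norm2 \<eta> / sqrt (real m)))
        \<ge> 1 - 2 * exp (- c * \<delta>\<^sup>2 * real m)) \<and>
    (\<forall>(m::nat) (d::nat) (\<delta>::real) (x0 :: complex Matrix.vec) (\<eta> :: real Matrix.vec).
      m \<ge> 1 \<and> d \<ge> 1 \<and> 0 < \<delta> \<and> \<delta> < 0.05 \<and> x0 \<in> carrier_vec d \<and> \<eta> \<in> carrier_vec m \<and>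
      real m \<ge> C * ln (1 / \<delta>) * (1 / \<delta>\<^sup>2) * real d \<longrightarrow>
      \<P>(\<omega> in iid_rows gaussian_complex m d.
          \<forall>xh. is_arg_min (amplitude_loss (matrix_of m d \<omega>) x0 \<eta>) (\<lambda>x. x \<in> carrier_vec d) xh \<longrightarrow>
            phase_dist xh x0 \<le> 2 * beta0_complex / (1 - \<delta>) * (norm2 \<eta> / sqrt (real m)))
        \<ge> 1 - 2 * exp (- c * \<delta>\<^sup>2 * real m))"
proof -
  have beta: "sqrt (1 / (1 - 2 / pi)) = beta0_real" "sqrt (1 / (1 - pi / 4)) = beta0_complex"
    using pi_less_4 by (simp_all add: beta0_real_def beta0_complex_def divide_simps)
  obtain C\<^sub>1 c\<^sub>1 where 1: "0 < C\<^sub>1" "0 < c\<^sub>1" "recovers gaussian_real beta0_real C\<^sub>1 c\<^sub>1"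
    by (rule gaussian_law.recovery[OF gaussian_law_real, unfolded beta])
  obtain C\<^sub>2 c\<^sub>2 where 2: "0 < C\<^sub>2" "0 < c\<^sub>2" "recovers gaussian_complex beta0_complex C\<^sub>2 c\<^sub>2"
    by (rule gaussian_law.recovery[OF gaussian_law_complex, unfolded beta])
  \<comment> \<open>Constants common to both fields: the more demanding \<open>C\<close> and the
    slower rate \<open>c\<close>.\<close>
  define C c where "C = max C\<^sub>1 C\<^sub>2" and "c = min c\<^sub>1 c\<^sub>2"
  have "0 < C" "0 < c" using 1(1,2) 2(1,2) by (auto simp: C_def c_def)
  moreover have "recovers gaussian_real beta0_real C c"
    by (rule recovers_mono[OF 1(3)]) (auto simp: C_def c_def)
  moreover have "recovers gaussian_complex beta0_complex C c"
    by (rule recovers_mono[OF 2(3)]) (auto simp: C_def c_def)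
  ultimately show ?thesis unfolding recovers_def by blast
qed

end
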